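(* Let $d\ge 1$ and $0<\alpha<2$. Let $S$ be the simple random walk on $\mathbb{Z}^d$ started at $0$ and let $S^\alpha_n=S_{\tau^\alpha_n}$ be the $\alpha$-subordinate random walk. Then the sequence of random elements $$\big(n^{-1/\alpha}S^\alpha_{[nt]}:t\ge 0\big),\qquad n\to\infty,$$ converges in law in the Skorohod space $\mathbf{D}([0,\infty),\mathbb{R}^d)$ (with the $J_1$-topology) to the symmetric $\alpha$-stable process $B^\alpha$.
   Context: $[\cdot]$ denotes the integer part. The discrete subordinator $\tau^\alpha=(\tau^\alpha_n)_{n\ge0}$ is the random walk on the nonnegative integers with $\tau^\alpha_0=0$, with i.i.d. positive integer valued increments, independent of $S$, whose law is determined by $$\mathbb{E}\big(e^{-\lambda\tau^\alpha_n}\big)=\big(1-(1-e^{-\lambda})^{\alpha/2}\big)^n,\qquad \lambda\ge 0.$$ Equivalently, if $P$ is the transition operator of $S$ then the transition operator $P_\alpha$ of $S^\alpha$ satisfies $I-P_\alpha=(I-P)^{\alpha/2}$. The process $B^\alpha$ is defined by $B^\alpha_t=B_{\sigma^\alpha_t}$, where $B$ is a Brownian motion in $\mathbb{R}^d$ and $\sigma^\alpha=(\sigma^\alpha_s)_{s\ge 0}$ is a non-decreasing L\'evy process independent of $B$ with $\mathbb{E}(e^{-\lambda\sigma^\alpha_s})=e^{-s\lambda^{\alpha/2}}$ for $\lambda\ge0$. The Brownian motion $B$ is normalized as the scaling limit of $n^{-1/2}S_{[nt]}$, i.e. $B$ is centred with $B_t$ having covariance matrix $(t/d)I$. *)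

theory Defs
  imports "HOL-Probability.Probability"
begin

section \<open>Skorohod space with the J1 topology\<close>

text \<open>Paths on \<open>[0,\<infinity>)\<close> are represented by functions on the reals that are
  \<^const>\<open>undefined\<close> at negative times.\<close>

definition cadlag_paths :: "(real \<Rightarrow> 'b::metric_space) set" where
  "cadlag_paths = {x \<in> extensional {0..}.
     (\<forall>t\<ge>0. (x \<longlongrightarrow> x t) (at_right t)) \<and> (\<forall>t>0. \<exists>l. (x \<longlongrightarrow> l) (at_left t))}"

text \<open>Increasing bijections of \<open>[0,\<infinity>)\<close>; these are automatically homeomorphisms fixing 0.\<close>

definition time_changes :: "(real \<Rightarrow> real) set" where
  "time_changes = {\<rho>. strict_mono_on {0..} \<rho> \<and> \<rho> ` {0..} = {0..}}"

definition J1_nbhd :: "(real \<Rightarrow> 'b::metric_space) \<Rightarrow> real \<Rightarrow> real \<Rightarrow> (real \<Rightarrow> 'b) set" where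
  "J1_nbhd x T \<epsilon> = {y \<in> cadlag_paths. \<exists>\<rho>\<in>time_changes. \<forall>t\<in>{0..T}.
      \<bar>\<rho> t - t\<bar> < \<epsilon> \<and> dist (y (\<rho> t)) (x t) < \<epsilon>}"

text \<open>The J1 topology, given by its neighbourhood filters.  It is first countable, and
  \<open>limitin_skorohod_J1\<close> below shows that its convergent sequences are
  exactly those of the usual description of the (metrizable) J1 topology: \<open>X\<^sub>n\<close> tends to \<open>x\<close>
  iff there are time changes \<open>\<lambda>\<^sub>n\<close> tending to the identity uniformly on \<open>[0,\<infinity>)\<close> such that
  \<open>X\<^sub>n \<circ> \<lambda>\<^sub>n\<close> tends to \<open>x\<close> uniformly on each \<open>[0,T]\<close>.\<close>

definition skorohod_J1 :: "(real \<Rightarrow> 'b::metric_space) topology" where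
  "skorohod_J1 = topology (\<lambda>U. U \<subseteq> cadlag_paths \<and> (\<forall>x\<in>U. \<exists>T. \<exists>\<epsilon>>0. J1_nbhd x T \<epsilon> \<subseteq> U))"

lemma J1_nbhd_mono: "T \<le> T' \<Longrightarrow> \<epsilon>' \<le> \<epsilon> \<Longrightarrow> J1_nbhd x T' \<epsilon>' \<subseteq> J1_nbhd x T \<epsilon>"
proof
  assume T: "T \<le> T'" "\<epsilon>' \<le> \<epsilon>"
  fix y assume "y \<in> J1_nbhd x T' \<epsilon>'"
  then obtain \<rho> where y: "y \<in> cadlag_paths" "\<rho> \<in> time_changes"
    and b: "\<And>t. t \<in> {0..T'} \<Longrightarrow> \<bar>\<rho> t - t\<bar> < \<epsilon>' \<and> dist (y (\<rho> t)) (x t) < \<epsilon>'"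
    unfolding J1_nbhd_def by auto
  have "\<bar>\<rho> t - t\<bar> < \<epsilon> \<and> dist (y (\<rho> t)) (x t) < \<epsilon>" if "t \<in> {0..T}" for t
    using b[of t] that T by auto
  with y show "y \<in> J1_nbhd x T \<epsilon>"
    unfolding J1_nbhd_def by blast
qed

lemma openin_skorohod_J1:
  fixes U :: "(real \<Rightarrow> 'b::metric_space) set"
  shows "openin skorohod_J1 U \<longleftrightarrow> U \<subseteq> cadlag_paths \<and> (\<forall>x\<in>U. \<exists>T. \<exists>\<epsilon>>0. J1_nbhd x T \<epsilon> \<subseteq> U)"
proof -
  have "istopology (\<lambda>U::(real \<Rightarrow> 'b) set.
      U \<subseteq> cadlag_paths \<and> (\<forall>x\<in>U. \<exists>T. \<exists>\<epsilon>>0. J1_nbhd x T \<epsilon> \<subseteq> U))"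
    unfolding istopology_def
  proof (intro conjI allI impI ballI)
    fix U V :: "(real \<Rightarrow> 'b) set" and x
    assume U: "U \<subseteq> cadlag_paths \<and> (\<forall>x\<in>U. \<exists>T. \<exists>\<epsilon>>0. J1_nbhd x T \<epsilon> \<subseteq> U)"
      and V: "V \<subseteq> cadlag_paths \<and> (\<forall>x\<in>V. \<exists>T. \<exists>\<epsilon>>0. J1_nbhd x T \<epsilon> \<subseteq> V)"
    show "U \<inter> V \<subseteq> cadlag_paths" using U by blast
    assume x: "x \<in> U \<inter> V"
    obtain T1 e1 where 1: "e1 > 0" "J1_nbhd x T1 e1 \<subseteq> U" using U x by blast
    obtain T2 e2 where 2: "e2 > 0" "J1_nbhd x T2 e2 \<subseteq> V" using V x by blast
    have "J1_nbhd x (max T1 T2) (min e1 e2) \<subseteq> J1_nbhd x T1 e1"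
      "J1_nbhd x (max T1 T2) (min e1 e2) \<subseteq> J1_nbhd x T2 e2"
      by (intro J1_nbhd_mono; simp)+
    then have "J1_nbhd x (max T1 T2) (min e1 e2) \<subseteq> U \<inter> V"
      using 1 2 by blast
    moreover have "min e1 e2 > 0" using 1 2 by simp
    ultimately show "\<exists>T. \<exists>\<epsilon>>0. J1_nbhd x T \<epsilon> \<subseteq> U \<inter> V" by blast
  next
    fix K :: "(real \<Rightarrow> 'b) set set"
    assume K: "\<forall>U\<in>K. U \<subseteq> cadlag_paths \<and> (\<forall>x\<in>U. \<exists>T. \<exists>\<epsilon>>0. J1_nbhd x T \<epsilon> \<subseteq> U)"
    show "\<Union>K \<subseteq> cadlag_paths" using K by blast
    fix x assume "x \<in> \<Union>K"
    then obtain U where U: "U \<in> K" "x \<in> U" by blast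
    then obtain T e where "e > 0" "J1_nbhd x T e \<subseteq> U" using K by blast
    then show "\<exists>T. \<exists>\<epsilon>>0. J1_nbhd x T \<epsilon> \<subseteq> \<Union>K" using U by blast
  qed
  then show ?thesis
    unfolding skorohod_J1_def by simp
qed

lemma topspace_skorohod_J1 [simp]:
  "topspace skorohod_J1 = (cadlag_paths :: (real \<Rightarrow> 'b::metric_space) set)"
proof
  show "topspace skorohod_J1 \<subseteq> (cadlag_paths :: (real \<Rightarrow> 'b) set)"
    using openin_skorohod_J1 openin_topspace by blast
  have "openin skorohod_J1 (cadlag_paths :: (real \<Rightarrow> 'b) set)"
    unfolding openin_skorohod_J1 by (auto simp: J1_nbhd_def intro: exI[of _ 1])
  then show "cadlag_paths \<subseteq> topspace (skorohod_J1 :: (real \<Rightarrow> 'b) topology)"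
    by (rule openin_subset)
qed

lemma id_time_changes: "(\<lambda>t. t) \<in> time_changes"
  by (auto simp: time_changes_def strict_mono_on_def)

lemma time_changes_comp:
  assumes "\<rho> \<in> time_changes" "\<mu> \<in> time_changes"
  shows "(\<lambda>t. \<mu> (\<rho> t)) \<in> time_changes"
proof -
  have "(\<lambda>t. \<mu> (\<rho> t)) ` {0..} = \<mu> ` (\<rho> ` {0..})"
    by (simp add: image_image)
  moreover have "\<mu> (\<rho> r) < \<mu> (\<rho> s)" if "0 \<le> r" "r < s" for r s
  proof -
    have "\<rho> r \<in> {0..}" "\<rho> s \<in> {0..}" "\<rho> r < \<rho> s"
      using assms(1) that unfolding time_changes_def strict_mono_on_def by auto
    then show ?thesis
      using assms(2) unfolding time_changes_def strict_mono_on_def by auto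
  qed
  ultimately show ?thesis
    using assms unfolding time_changes_def strict_mono_on_def by simp
qed

lemma time_changes_nonneg: "\<rho> \<in> time_changes \<Longrightarrow> 0 \<le> t \<Longrightarrow> 0 \<le> \<rho> t"
  unfolding time_changes_def by auto

lemma time_changes_mono: "\<rho> \<in> time_changes \<Longrightarrow> 0 \<le> s \<Longrightarrow> s \<le> t \<Longrightarrow> \<rho> s \<le> \<rho> t"
  unfolding time_changes_def strict_mono_on_def by (cases "s = t") (auto intro: less_imp_le)

lemma time_changes_0: "\<rho> \<in> time_changes \<Longrightarrow> \<rho> 0 = 0"
proof -
  assume \<rho>: "\<rho> \<in> time_changes"
  then have "0 \<in> \<rho> ` {0..}" by (auto simp: time_changes_def)
  then obtain s where "s \<ge> 0" "\<rho> s = 0" by auto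
  then show "\<rho> 0 = 0"
    using time_changes_mono[OF \<rho>, of 0 s] time_changes_nonneg[OF \<rho>, of 0] by simp
qed

lemma J1_nbhd_is_nbhd:
  assumes x: "x \<in> cadlag_paths" and \<epsilon>: "\<epsilon> > 0"
  shows "\<exists>V. openin skorohod_J1 V \<and> x \<in> V \<and> V \<subseteq> J1_nbhd x T \<epsilon>"
proof (intro exI conjI)
  define V where "V = (\<Union>\<epsilon>'\<in>{0<..<\<epsilon>}. J1_nbhd x T \<epsilon>')"
  show "V \<subseteq> J1_nbhd x T \<epsilon>"
    unfolding V_def by (intro UN_least J1_nbhd_mono) auto
  have "x \<in> J1_nbhd x T (\<epsilon> / 2)"
    unfolding J1_nbhd_def using x \<epsilon> by (auto intro!: bexI[OF _ id_time_changes])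
  moreover have "\<epsilon> / 2 \<in> {0<..<\<epsilon>}" using \<epsilon> by simp
  ultimately show "x \<in> V" unfolding V_def by blast
  show "openin skorohod_J1 V"
    unfolding openin_skorohod_J1
  proof (intro conjI ballI)
    show "V \<subseteq> cadlag_paths" unfolding V_def J1_nbhd_def by auto
    fix y assume "y \<in> V"
    then obtain e where e: "0 < e" "e < \<epsilon>" "y \<in> J1_nbhd x T e" unfolding V_def by auto
    then obtain \<rho> where \<rho>: "\<rho> \<in> time_changes"
      and \<rho>x: "\<And>t. t \<in> {0..T} \<Longrightarrow> \<bar>\<rho> t - t\<bar> < e \<and> dist (y (\<rho> t)) (x t) < e"
      unfolding J1_nbhd_def by auto
    define d where "d = (\<epsilon> - e) / 2"
    have d: "d > 0" "e + d \<in> {0<..<\<epsilon>}" using e by (auto simp: d_def field_simps)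
    have "J1_nbhd y (\<rho> T) d \<subseteq> J1_nbhd x T (e + d)"
    proof
      fix z assume "z \<in> J1_nbhd y (\<rho> T) d"
      then obtain \<mu> where z: "z \<in> cadlag_paths" and \<mu>: "\<mu> \<in> time_changes"
        and \<mu>y: "\<And>t. t \<in> {0..\<rho> T} \<Longrightarrow> \<bar>\<mu> t - t\<bar> < d \<and> dist (z (\<mu> t)) (y t) < d"
        unfolding J1_nbhd_def by auto
      have "\<bar>\<mu> (\<rho> t) - t\<bar> < e + d \<and> dist (z (\<mu> (\<rho> t))) (x t) < e + d" if t: "t \<in> {0..T}" for t
      proof -
        have "\<rho> t \<in> {0..\<rho> T}"
          using t time_changes_mono[OF \<rho>] time_changes_nonneg[OF \<rho>] by simp
        with \<rho>x[OF t] \<mu>y[of "\<rho> t"] dist_triangle[of "z (\<mu> (\<rho> t))" "x t" "y (\<rho> t)"]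
        show ?thesis by auto
      qed
      then show "z \<in> J1_nbhd x T (e + d)"
        unfolding J1_nbhd_def using z by (auto intro!: bexI[OF _ time_changes_comp[OF \<rho> \<mu>]])
    qed
    then show "\<exists>T'. \<exists>\<epsilon>'>0. J1_nbhd y T' \<epsilon>' \<subseteq> V"
      using d unfolding V_def by blast
  qed
qed

lemma time_changes_extend:
  assumes \<rho>: "\<rho> \<in> time_changes" and T: "0 \<le> T"
  shows "(\<lambda>t. if t \<le> T then \<rho> t else \<rho> T + (t - T)) \<in> time_changes" (is "?\<mu> \<in> _")
proof -
  have sm: "\<And>s t. 0 \<le> s \<Longrightarrow> s < t \<Longrightarrow> \<rho> s < \<rho> t"
    using \<rho> unfolding time_changes_def strict_mono_on_def by auto
  have "strict_mono_on {0..} ?\<mu>"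
    unfolding strict_mono_on_def using sm time_changes_mono[OF \<rho>] T by fastforce
  moreover have "?\<mu> ` {0..} = {0..}"
  proof
    show "?\<mu> ` {0..} \<subseteq> {0..}"
    proof (rule image_subsetI)
      fix t :: real assume "t \<in> {0..}"
      then show "?\<mu> t \<in> {0..}"
        using time_changes_nonneg[OF \<rho>, of t] time_changes_nonneg[OF \<rho>, of T] T by simp
    qed
    show "{0..} \<subseteq> ?\<mu> ` {0..}"
    proof
      fix u :: real assume u: "u \<in> {0..}"
      show "u \<in> ?\<mu> ` {0..}"
      proof (cases "u \<le> \<rho> T")
        case True
        have "u \<in> \<rho> ` {0..}" using \<rho> u by (simp add: time_changes_def)
        then obtain s where s: "s \<ge> 0" "u = \<rho> s" by auto
        then have "s \<le> T" using sm[of T s] T True by force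
        then show ?thesis using s by (intro image_eqI[of _ _ s]) auto
      next
        case False
        then show ?thesis using T by (intro image_eqI[of _ _ "T + (u - \<rho> T)"]) auto
      qed
    qed
  qed
  ultimately show ?thesis by (simp add: time_changes_def)
qed

lemma limitin_skorohod_J1:
  fixes X :: "nat \<Rightarrow> real \<Rightarrow> 'b::metric_space"
  shows "limitin skorohod_J1 X x sequentially \<longleftrightarrow>
    x \<in> cadlag_paths \<and> (\<forall>\<^sub>F n in sequentially. X n \<in> cadlag_paths) \<and>
    (\<exists>\<rho>. (\<forall>n. \<rho> n \<in> time_changes) \<and> uniform_limit {0..} \<rho> (\<lambda>t. t) sequentially \<and>
         (\<forall>T. uniform_limit {0..T} (\<lambda>n t. X n (\<rho> n t)) x sequentially))"
  (is "?L \<longleftrightarrow> ?x \<and> ?X \<and> ?R")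
proof
  assume L: ?L
  then have x: ?x and X: ?X
    using limitin_topspace[OF L] unfolding limitin_def
    by (simp, metis openin_topspace topspace_skorohod_J1)
  have ev: "\<forall>\<^sub>F n in sequentially. X n \<in> J1_nbhd x T \<epsilon>" if "\<epsilon> > 0" for T \<epsilon>
    using J1_nbhd_is_nbhd[OF x that, of T] L unfolding limitin_def
    by (blast intro: eventually_mono)
  define P where "P = (\<lambda>n k. X n \<in> J1_nbhd x (real k) (1 / real (Suc k)))"
  define k where "k = (\<lambda>n. Max (insert 0 {k. k \<le> n \<and> P n k}))"
  have kP: "P n (k n)" if "\<exists>j\<le>n. P n j" for n
  proof -
    obtain j where j: "j \<le> n" "P n j" using \<open>\<exists>j\<le>n. P n j\<close> by blast
    have fin: "finite (insert 0 {k. k \<le> n \<and> P n k})" by simp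
    have "k n \<in> insert 0 {k. k \<le> n \<and> P n k}"
      unfolding k_def by (rule Max_in) auto
    moreover have "k n \<ge> j"
      unfolding k_def using j by (intro Max_ge[OF fin]) auto
    ultimately show ?thesis using j by auto
  qed
  have kge: "k n \<ge> j" if "j \<le> n" "P n j" for n j
    unfolding k_def using that by (intro Max_ge) auto
  have "\<exists>\<rho>\<in>time_changes. (\<exists>j\<le>n. P n j) \<longrightarrow>
      (\<forall>t\<ge>0. \<bar>\<rho> t - t\<bar> < 1 / real (Suc (k n))) \<and>
      (\<forall>t\<in>{0..real (k n)}. dist (X n (\<rho> t)) (x t) < 1 / real (Suc (k n)))" for n
  proof (cases "\<exists>j\<le>n. P n j")
    case False
    then show ?thesis using id_time_changes by blast
  next
    case True
    from kP[OF True] obtain \<rho> where \<rho>: "\<rho> \<in> time_changes" and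
      b: "\<And>t. t \<in> {0..real (k n)} \<Longrightarrow> \<bar>\<rho> t - t\<bar> < 1 / real (Suc (k n)) \<and>
             dist (X n (\<rho> t)) (x t) < 1 / real (Suc (k n))"
      unfolding P_def J1_nbhd_def by auto
    let ?\<mu> = "\<lambda>t. if t \<le> real (k n) then \<rho> t else \<rho> (real (k n)) + (t - real (k n))"
    have 1: "?\<mu> \<in> time_changes" by (rule time_changes_extend[OF \<rho>]) simp
    have 2: "\<bar>?\<mu> t - t\<bar> < 1 / real (Suc (k n))" if "t \<ge> 0" for t
      using b[of t] b[of "real (k n)"] that by (cases "t \<le> real (k n)") auto
    have 3: "dist (X n (?\<mu> t)) (x t) < 1 / real (Suc (k n))" if "t \<in> {0..real (k n)}" for t
      using b[of t] that by auto
    show ?thesis by (intro bexI[of _ ?\<mu>] impI conjI allI ballI) (erule 2, erule 3, rule 1)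
  qed
  then obtain \<rho> where \<rho>: "\<And>n. \<rho> n \<in> time_changes" and
    b: "\<And>n. (\<exists>j\<le>n. P n j) \<Longrightarrow>
      (\<forall>t\<ge>0. \<bar>\<rho> n t - t\<bar> < 1 / real (Suc (k n))) \<and>
      (\<forall>t\<in>{0..real (k n)}. dist (X n (\<rho> n t)) (x t) < 1 / real (Suc (k n)))"
    by metis
  have evj: "\<forall>\<^sub>F n in sequentially. (\<exists>j\<le>n. P n j) \<and> k n \<ge> j" for j
  proof -
    have "\<forall>\<^sub>F n in sequentially. P n j"
      unfolding P_def by (rule ev) simp
    moreover have "\<forall>\<^sub>F n in sequentially. j \<le> n"
      by (rule eventually_ge_at_top)
    ultimately show ?thesis
      by eventually_elim (use kge in blast)
  qed
  have small: "1 / real (Suc (k n)) < \<epsilon>" if "k n \<ge> j" "1 / real (Suc j) < \<epsilon>" for n j \<epsilon>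
    using that by (smt (verit) frac_le of_nat_0_less_iff of_nat_le_iff Suc_le_mono zero_less_Suc)
  have ?R
  proof (intro exI conjI allI)
    show "\<rho> n \<in> time_changes" for n by (rule \<rho>)
    show "uniform_limit {0..} \<rho> (\<lambda>t. t) sequentially"
    proof (rule uniform_limitI)
      fix \<epsilon> :: real assume "\<epsilon> > 0"
      then obtain j where j: "1 / real (Suc j) < \<epsilon>" using nat_approx_posE by blast
      show "\<forall>\<^sub>F n in sequentially. \<forall>t\<in>{0..}. dist (\<rho> n t) t < \<epsilon>"
        using evj[of j] by eventually_elim (use b small[OF _ j] in \<open>force simp: dist_real_def\<close>)
    qed
    fix T :: real
    show "uniform_limit {0..T} (\<lambda>n t. X n (\<rho> n t)) x sequentially"
    proof (rule uniform_limitI)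
      fix \<epsilon> :: real assume "\<epsilon> > 0"
      then obtain j where j: "1 / real (Suc j) < \<epsilon>" using nat_approx_posE by blast
      obtain m where m: "T \<le> real m" using real_arch_simple by blast
      show "\<forall>\<^sub>F n in sequentially. \<forall>t\<in>{0..T}. dist (X n (\<rho> n t)) (x t) < \<epsilon>"
        using evj[of j] evj[of m]
      proof eventually_elim
        case (elim n)
        have "T \<le> real (k n)" using elim m by linarith
        moreover have "\<forall>t\<in>{0..real (k n)}. dist (X n (\<rho> n t)) (x t) < 1 / real (Suc (k n))"
          using b elim by blast
        moreover have "1 / real (Suc (k n)) < \<epsilon>"
          using small[OF _ j] elim by blast
        ultimately show ?case by (meson atLeastAtMost_iff less_trans order_trans)
      qed
    qed
  qed
  with x X show "?x \<and> ?X \<and> ?R" by blast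
next
  assume "?x \<and> ?X \<and> ?R"
  then obtain \<rho> where x: ?x and X: ?X and \<rho>: "\<And>n. \<rho> n \<in> time_changes"
    and u: "uniform_limit {0..} \<rho> (\<lambda>t. t) sequentially"
    and v: "\<And>T. uniform_limit {0..T} (\<lambda>n t. X n (\<rho> n t)) x sequentially"
    by blast
  show ?L
    unfolding limitin_def
  proof (intro conjI allI impI)
    show "x \<in> topspace skorohod_J1" using x by simp
    fix U assume U: "openin skorohod_J1 U \<and> x \<in> U"
    then obtain T \<epsilon> where \<epsilon>: "\<epsilon> > 0" and sub: "J1_nbhd x T \<epsilon> \<subseteq> U"
      unfolding openin_skorohod_J1 by blast
    show "\<forall>\<^sub>F n in sequentially. X n \<in> U"
      using X uniform_limitD[OF u \<epsilon>] uniform_limitD[OF v[of T] \<epsilon>]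
    proof eventually_elim
      case (elim n)
      then have "X n \<in> J1_nbhd x T \<epsilon>"
        unfolding J1_nbhd_def by (auto simp: dist_real_def intro!: bexI[OF _ \<rho>[of n]])
      then show ?case using sub by blast
    qed
  qed
qed


section \<open>Convergence in law\<close>

definition borel_of :: "'b topology \<Rightarrow> 'b measure" where
  "borel_of T = sigma (topspace T) {U. openin T U}"

text \<open>Weak convergence of the laws of random elements of a topological space: the \<open>X n\<close> live
  on \<open>M\<close>, the limit \<open>Y\<close> on a possibly different probability space \<open>N\<close>.  Measurability is
  part of the notion.\<close>

definition converges_in_law ::
  "'b topology \<Rightarrow> 'a measure \<Rightarrow> (nat \<Rightarrow> 'a \<Rightarrow> 'b) \<Rightarrow> 'c measure \<Rightarrow> ('c \<Rightarrow> 'b) \<Rightarrow> bool" where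
  "converges_in_law T M X N Y \<longleftrightarrow>
     (\<forall>n. X n \<in> M \<rightarrow>\<^sub>M borel_of T) \<and> Y \<in> N \<rightarrow>\<^sub>M borel_of T \<and>
     (\<forall>f. continuous_map T euclideanreal f \<and> bounded (f ` topspace T) \<longrightarrow>
        (\<lambda>n. \<integral>\<omega>. f (X n \<omega>) \<partial>M) \<longlonglongrightarrow> (\<integral>\<omega>. f (Y \<omega>) \<partial>N))"


section \<open>Random walks and subordinators\<close>

text \<open>The library's \<open>indep_var\<close> requires both variables to have the same value type.\<close>

definition indep_elements ::
  "'a measure \<Rightarrow> 'b measure \<Rightarrow> ('a \<Rightarrow> 'b) \<Rightarrow> 'c measure \<Rightarrow> ('a \<Rightarrow> 'c) \<Rightarrow> bool" where
  "indep_elements M A X B Y \<longleftrightarrow> X \<in> M \<rightarrow>\<^sub>M A \<and> Y \<in> M \<rightarrow>\<^sub>M B \<and>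
     prob_space.indep_set M (sets (vimage_algebra (space M) X A)) (sets (vimage_algebra (space M) Y B))"

definition lattice_neighbours :: "(int ^ 'd) set" where
  "lattice_neighbours = (\<Union>i. {axis i 1, axis i (- 1)})"

locale simple_random_walk = prob_space M for M :: "'a measure" +
  fixes S :: "nat \<Rightarrow> 'a \<Rightarrow> int ^ 'd"
  assumes measurable_walk: "\<And>n. S n \<in> M \<rightarrow>\<^sub>M count_space UNIV"
    and start: "\<And>\<omega>. \<omega> \<in> space M \<Longrightarrow> S 0 \<omega> = 0"
    and indep_steps: "indep_vars (\<lambda>_. count_space UNIV) (\<lambda>n \<omega>. S (Suc n) \<omega> - S n \<omega>) UNIV"
    and distr_steps: "\<And>n. distr M (count_space UNIV) (\<lambda>\<omega>. S (Suc n) \<omega> - S n \<omega>) =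
                      measure_pmf (pmf_of_set lattice_neighbours)"

locale discrete_subordinator = prob_space M for M :: "'a measure" +
  fixes \<alpha> :: real and \<tau> :: "nat \<Rightarrow> 'a \<Rightarrow> nat"
  assumes measurable_subordinator: "\<And>n. \<tau> n \<in> M \<rightarrow>\<^sub>M count_space UNIV"
    and start: "\<And>\<omega>. \<omega> \<in> space M \<Longrightarrow> \<tau> 0 \<omega> = 0"
    and pos_steps: "\<And>n \<omega>. \<omega> \<in> space M \<Longrightarrow> \<tau> n \<omega> < \<tau> (Suc n) \<omega>"
    and indep_steps: "indep_vars (\<lambda>_. count_space UNIV) (\<lambda>n \<omega>. \<tau> (Suc n) \<omega> - \<tau> n \<omega>) UNIV"
    and distr_steps: "\<And>n. distr M (count_space UNIV) (\<lambda>\<omega>. \<tau> (Suc n) \<omega> - \<tau> n \<omega>) =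
                      distr M (count_space UNIV) (\<lambda>\<omega>. \<tau> 1 \<omega> - \<tau> 0 \<omega>)"
    and laplace: "\<And>n \<theta>. \<theta> \<ge> 0 \<Longrightarrow> expectation (\<lambda>\<omega>. exp (- \<theta> * real (\<tau> n \<omega>))) =
                      (1 - (1 - exp (- \<theta>)) powr (\<alpha> / 2)) ^ n"


section \<open>Brownian motion and stable subordinators\<close>

definition independent_increments ::
  "'a measure \<Rightarrow> (real \<Rightarrow> 'a \<Rightarrow> 'b::euclidean_space) \<Rightarrow> bool" where
  "independent_increments M X \<longleftrightarrow>
     (\<forall>k (t :: nat \<Rightarrow> real). 0 \<le> t 0 \<and> (\<forall>i<k. t i \<le> t (Suc i)) \<longrightarrow>
        prob_space.indep_vars M (\<lambda>_. borel) (\<lambda>i \<omega>. X (t (Suc i)) \<omega> - X (t i) \<omega>) {..<k})"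

locale levy_process = prob_space M for M :: "'a measure" +
  fixes X :: "real \<Rightarrow> 'a \<Rightarrow> 'b::euclidean_space"
  assumes measurable_process: "\<And>t. t \<ge> 0 \<Longrightarrow> X t \<in> borel_measurable M"
    and start: "\<And>\<omega>. \<omega> \<in> space M \<Longrightarrow> X 0 \<omega> = 0"
    and cadlag: "\<And>\<omega>. \<omega> \<in> space M \<Longrightarrow> (\<lambda>t\<in>{0..}. X t \<omega>) \<in> cadlag_paths"
    and indep_increments: "independent_increments M X"
    and stationary_increments: "\<And>s t. 0 \<le> s \<Longrightarrow> s \<le> t \<Longrightarrow>
          distr M borel (\<lambda>\<omega>. X t \<omega> - X s \<omega>) = distr M borel (X (t - s))"

locale stable_subordinator = levy_process M \<sigma> for M :: "'a measure" and \<sigma> :: "real \<Rightarrow> 'a \<Rightarrow> real" +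
  fixes \<alpha> :: real
  assumes nondecreasing: "\<And>\<omega>. \<omega> \<in> space M \<Longrightarrow> mono_on {0..} (\<lambda>t. \<sigma> t \<omega>)"
    and laplace: "\<And>s \<theta>. s \<ge> 0 \<Longrightarrow> \<theta> \<ge> 0 \<Longrightarrow>
          expectation (\<lambda>\<omega>. exp (- \<theta> * \<sigma> s \<omega>)) = exp (- s * \<theta> powr (\<alpha> / 2))"

text \<open>Brownian motion in dimension \<open>d\<close> such that the covariance matrix at time \<open>t\<close> is \<open>(t/d) I\<close>:
  the coordinates of the increment over \<open>[s,t]\<close> are independent and
  \<open>N(0, (t - s)/d)\<close>-distributed.\<close>

locale walk_brownian_motion = prob_space M for M :: "'a measure" +
  fixes B :: "real \<Rightarrow> 'a \<Rightarrow> real ^ 'd"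
  assumes measurable_process: "\<And>t. t \<ge> 0 \<Longrightarrow> B t \<in> borel_measurable M"
    and start: "\<And>\<omega>. \<omega> \<in> space M \<Longrightarrow> B 0 \<omega> = 0"
    and continuous_paths: "\<And>\<omega>. \<omega> \<in> space M \<Longrightarrow> continuous_on {0..} (\<lambda>t. B t \<omega>)"
    and indep_increments: "independent_increments M B"
    and gaussian_increments: "\<And>s t. 0 \<le> s \<Longrightarrow> s < t \<Longrightarrow>
          distributed M lborel (\<lambda>\<omega>. B t \<omega> - B s \<omega>)
            (\<lambda>x. \<Prod>i\<in>UNIV. ennreal (normal_density 0 (sqrt ((t - s) / real CARD('d))) (x $ i)))"

definition rescaled_subordinate_walk ::
  "real \<Rightarrow> (nat \<Rightarrow> 'a \<Rightarrow> int ^ 'd) \<Rightarrow> (nat \<Rightarrow> 'a \<Rightarrow> nat) \<Rightarrow> nat \<Rightarrow> 'a \<Rightarrow> real \<Rightarrow> real ^ 'd" where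
  "rescaled_subordinate_walk \<alpha> S \<tau> n \<omega> =
     (\<lambda>t\<in>{0..}. real n powr (- 1 / \<alpha>) *\<^sub>R (\<chi> i. real_of_int (S (\<tau> (nat \<lfloor>real n * t\<rfloor>) \<omega>) \<omega> $ i)))"

definition subordinate_process ::
  "(real \<Rightarrow> 'a \<Rightarrow> 'b) \<Rightarrow> (real \<Rightarrow> 'a \<Rightarrow> real) \<Rightarrow> 'a \<Rightarrow> real \<Rightarrow> 'b" where
  "subordinate_process B \<sigma> \<omega> = (\<lambda>t\<in>{0..}. B (\<sigma> t \<omega>) \<omega>)"

end

theory Submission
  imports Defs "HOL-Real_Asymp.Real_Asymp"
begin

text \<open>Sampling a cadlag path at the points \<open>k/m\<close> approximates it in the J1 topology, because a time
  change can move its finitely many large jumps to the next grid point.  For random paths this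
  reduces convergence in law to convergence of the grid marginals together with a bound, uniform in
  \<open>n\<close>, on the probability that the walk is far from its own sampled path; no compactness argument
  is needed.

  Conditioning on \<open>\<tau>\<close> turns the joint characteristic function of the increments of \<open>S\<^sup>\<alpha>\<close>
  into a product of powers of \<open>1 - (1 - \<phi>)\<^bsup>\<alpha>/2\<^esup>\<close>, where \<open>\<phi>\<close> is the characteristic function of
  one step of \<open>S\<close>; the scaling limit is that of \<open>B\<^sup>\<alpha>\<close>.  For the uniform bound, the Laplace
  transform of \<open>\<tau>\<close> gives \<open>E min(1, \<xi>/x) \<le> 2 x\<^bsup>-\<alpha>/2\<^esup>\<close> for a step \<open>\<xi>\<close> of \<open>\<tau>\<close>.  Hence two long
  steps of \<open>\<tau>\<close> are rarely close together, and, given \<open>\<tau>\<close>, the walk moves little during the short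
  steps by Kolmogorov's maximal inequality.\<close>

section \<open>Time changes and J1 neighbourhoods\<close>

text \<open>The outline leaves two points open. How continuous functionals are tested:
  \<open>skorohod_J1\<close> is given by neighbourhoods rather than by a metric, so instead of
  bounded Lipschitz functions for J1 the proof approaches \<open>f\<close> from below by infimal
  convolutions that are Lipschitz for the uniform distance. On sampled paths these depend on
  finitely many coordinates, and a double liminf over the regularisation index and the mesh recovers
  \<open>f\<close>; this settles Borel measurability and, by Fatou's lemma, the lower bound for
  expectations, whose upper counterpart comes from \<open>-f\<close>. Which steps of \<tau> count as
  long: those above \<eta> n^(2/\<alpha>), the order of \<tau> after n steps. Such a step has
  probability O(\<eta>^(-\<alpha>/2) / n), so two of them at distance below n/m cost
  O(\<eta>^(-\<alpha>) / m), while the short steps contribute a rescaled variance O(\<eta>^(1 -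
  \<alpha>/2)). Since \<alpha> < 2 this exponent is positive: \<eta> is fixed first, m afterwards,
  and both bounds hold for all n > 0.\<close>

lemma time_changes_strict_mono:
  "\<rho> \<in> time_changes \<Longrightarrow> 0 \<le> s \<Longrightarrow> s < t \<Longrightarrow> \<rho> s < \<rho> t"
  unfolding time_changes_def strict_mono_on_def by auto

lemma time_changes_le_iff:
  assumes "\<rho> \<in> time_changes" "0 \<le> s" "0 \<le> t"
  shows "\<rho> s \<le> \<rho> t \<longleftrightarrow> s \<le> t"
  using time_changes_strict_mono[OF assms(1), of t s] time_changes_mono[OF assms(1), of s t] assms
  by force

text \<open>A free slope makes piecewise linear time changes available: extending twice in a row
  inserts a segment with prescribed end point and then continues with slope 1.\<close>

lemma time_changes_extend_linear:
  assumes \<rho>: "\<rho> \<in> time_changes" and T: "0 \<le> T" and c: "0 < c"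
  shows "(\<lambda>t. if t \<le> T then \<rho> t else \<rho> T + c * (t - T)) \<in> time_changes" (is "?\<mu> \<in> _")
proof -
  have sm: "\<And>s t. 0 \<le> s \<Longrightarrow> s < t \<Longrightarrow> \<rho> s < \<rho> t"
    by (rule time_changes_strict_mono[OF \<rho>])
  have "?\<mu> s < ?\<mu> t" if st: "0 \<le> s" "s < t" for s t
  proof (cases "t \<le> T")
    case True
    then show ?thesis using sm st by simp
  next
    case False
    have "\<rho> s \<le> \<rho> T" if "s \<le> T" using time_changes_mono[OF \<rho>] that st by simp
    moreover have "c * (t - T) > 0" "c * (s - T) < c * (t - T)" using False c st by auto
    ultimately show ?thesis using False by auto
  qed
  then have "strict_mono_on {0..} ?\<mu>"
    unfolding strict_mono_on_def by simp
  moreover have "?\<mu> ` {0..} = {0..}"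
  proof
    show "?\<mu> ` {0..} \<subseteq> {0..}"
    proof (rule image_subsetI)
      fix t :: real assume "t \<in> {0..}"
      then show "?\<mu> t \<in> {0..}"
        using time_changes_nonneg[OF \<rho>, of t] time_changes_nonneg[OF \<rho>, of T] T c by simp
    qed
    show "{0..} \<subseteq> ?\<mu> ` {0..}"
    proof
      fix u :: real assume u: "u \<in> {0..}"
      show "u \<in> ?\<mu> ` {0..}"
      proof (cases "u \<le> \<rho> T")
        case True
        have "u \<in> \<rho> ` {0..}" using \<rho> u by (simp add: time_changes_def)
        then obtain s where s: "s \<ge> 0" "u = \<rho> s" by auto
        then have "s \<le> T" using sm[of T s] T True by force
        then show ?thesis using s by (intro image_eqI[of _ _ s]) auto
      next
        case False
        then show ?thesis using T c by (intro image_eqI[of _ _ "T + (u - \<rho> T) / c"]) (auto simp: divide_le_0_iff)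
      qed
    qed
  qed
  ultimately show ?thesis by (simp add: time_changes_def)
qed

lemma time_changes_inverse:
  assumes \<rho>: "\<rho> \<in> time_changes"
  obtains \<mu> where "\<mu> \<in> time_changes" "\<And>t. t \<ge> 0 \<Longrightarrow> \<mu> (\<rho> t) = t" "\<And>t. t \<ge> 0 \<Longrightarrow> \<rho> (\<mu> t) = t"
proof
  have inj: "inj_on \<rho> {0..}" and im: "\<rho> ` {0..} = {0..}"
    using \<rho> by (auto simp: time_changes_def strict_mono_on_imp_inj_on)
  let ?\<mu> = "inv_into {0..} \<rho>"
  show 1: "?\<mu> (\<rho> t) = t" if "t \<ge> 0" for t
    using inj that by simp
  show 2: "\<rho> (?\<mu> t) = t" if "t \<ge> 0" for t
    using im that by (auto intro: f_inv_into_f)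
  have nn: "?\<mu> t \<ge> 0" if "t \<ge> 0" for t
    using im that inv_into_into[of t \<rho> "{0..}"] by simp
  have "?\<mu> s < ?\<mu> t" if "0 \<le> s" "s < t" for s t
    using time_changes_le_iff[OF \<rho> nn[of t] nn[of s]] 2[of s] 2[of t] that by force
  moreover have "?\<mu> ` {0..} = {0..}"
  proof
    show "?\<mu> ` {0..} \<subseteq> {0..}" using nn by auto
    show "{0..} \<subseteq> ?\<mu> ` {0..}"
    proof
      fix t :: real assume t: "t \<in> {0..}"
      then show "t \<in> ?\<mu> ` {0..}"
        using 1[of t] time_changes_nonneg[OF \<rho>, of t] by (intro image_eqI[of _ _ "\<rho> t"]) auto
    qed
  qed
  ultimately show "?\<mu> \<in> time_changes"
    by (auto simp: time_changes_def strict_mono_on_def)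
qed

text \<open>The inverse time change serves. It may carry times up to T as far as T + \<epsilon>,
  which is why the hypothesis has the longer horizon.\<close>

lemma J1_nbhd_sym:
  assumes "y \<in> J1_nbhd x (T + \<epsilon>) \<epsilon>" "x \<in> cadlag_paths" "\<epsilon> > 0"
  shows "x \<in> J1_nbhd y T \<epsilon>"
proof -
  obtain \<rho> where \<rho>: "\<rho> \<in> time_changes"
    and b: "\<And>t. t \<in> {0..T + \<epsilon>} \<Longrightarrow> \<bar>\<rho> t - t\<bar> < \<epsilon> \<and> dist (y (\<rho> t)) (x t) < \<epsilon>"
    using assms(1) by (auto simp: J1_nbhd_def)
  obtain \<mu> where \<mu>: "\<mu> \<in> time_changes" "\<And>t. t \<ge> 0 \<Longrightarrow> \<mu> (\<rho> t) = t" "\<And>t. t \<ge> 0 \<Longrightarrow> \<rho> (\<mu> t) = t"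
    using time_changes_inverse[OF \<rho>] by blast
  have "\<bar>\<mu> s - s\<bar> < \<epsilon> \<and> dist (x (\<mu> s)) (y s) < \<epsilon>" if s: "s \<in> {0..T}" for s
  proof -
    have \<mu>s: "\<mu> s \<ge> 0" "\<rho> (\<mu> s) = s" using s time_changes_nonneg[OF \<mu>(1)] \<mu>(3) by auto
    have "\<mu> s \<le> T + \<epsilon>"
    proof (rule ccontr)
      assume "\<not> \<mu> s \<le> T + \<epsilon>"
      moreover have "T + \<epsilon> \<ge> 0" using s assms(3) by auto
      ultimately have "\<rho> (T + \<epsilon>) < s"
        using time_changes_strict_mono[OF \<rho>, of "T + \<epsilon>" "\<mu> s"] \<mu>s(2) by auto
      then show False using b[of "T + \<epsilon>"] s \<open>T + \<epsilon> \<ge> 0\<close> by auto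
    qed
    then have "\<mu> s \<in> {0..T + \<epsilon>}" using \<mu>s by auto
    from b[OF this] \<mu>s show ?thesis by (simp add: dist_commute abs_minus_commute)
  qed
  then show ?thesis
    using assms(2) \<mu>(1) unfolding J1_nbhd_def by blast
qed

text \<open>The first time change may carry a time below T past T, by less than \<epsilon>; hence
  the longer horizon around \<open>y\<close>.\<close>

lemma J1_nbhd_trans:
  assumes y: "y \<in> J1_nbhd x T \<epsilon>" and z: "z \<in> J1_nbhd y (T + \<epsilon>) \<delta>"
  shows "z \<in> J1_nbhd x T (\<epsilon> + \<delta>)"
proof -
  obtain \<rho> where \<rho>: "\<rho> \<in> time_changes"
    and \<rho>x: "\<And>t. t \<in> {0..T} \<Longrightarrow> \<bar>\<rho> t - t\<bar> < \<epsilon> \<and> dist (y (\<rho> t)) (x t) < \<epsilon>"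
    using y by (auto simp: J1_nbhd_def)
  obtain \<mu> where z': "z \<in> cadlag_paths" and \<mu>: "\<mu> \<in> time_changes"
    and \<mu>y: "\<And>t. t \<in> {0..T + \<epsilon>} \<Longrightarrow> \<bar>\<mu> t - t\<bar> < \<delta> \<and> dist (z (\<mu> t)) (y t) < \<delta>"
    using z by (auto simp: J1_nbhd_def)
  have "\<bar>\<mu> (\<rho> t) - t\<bar> < \<epsilon> + \<delta> \<and> dist (z (\<mu> (\<rho> t))) (x t) < \<epsilon> + \<delta>" if t: "t \<in> {0..T}" for t
  proof -
    have "\<rho> t \<in> {0..T + \<epsilon>}"
      using t \<rho>x[OF t] time_changes_nonneg[OF \<rho>, of t] by auto
    with \<rho>x[OF t] \<mu>y[of "\<rho> t"] dist_triangle[of "z (\<mu> (\<rho> t))" "x t" "y (\<rho> t)"]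
    show ?thesis by auto
  qed
  then show ?thesis
    unfolding J1_nbhd_def using z' by (auto intro!: bexI[OF _ time_changes_comp[OF \<rho> \<mu>]])
qed

lemma J1_nbhd_uniform:
  assumes "y \<in> cadlag_paths" "\<And>t. t \<ge> 0 \<Longrightarrow> dist (x t) (y t) \<le> r" "r < \<epsilon>"
  shows "y \<in> J1_nbhd x T \<epsilon>"
proof -
  have "\<bar>t - t\<bar> < \<epsilon> \<and> dist (y t) (x t) < \<epsilon>" if "t \<in> {0..T}" for t
    using assms(2)[of t] assms(3) that zero_le_dist[of "x t" "y t"]
    by (auto simp: dist_commute simp del: zero_le_dist)
  then show ?thesis
    unfolding J1_nbhd_def using assms(1) by (auto intro!: bexI[OF _ id_time_changes])
qed

section \<open>Step paths and sampling on the grid of mesh 1/m\<close>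

lemma step_cadlag_pos:
  fixes g :: "nat \<Rightarrow> 'b::metric_space"
  assumes c: "c > 0"
  shows "(\<lambda>t\<in>{0..}. g (nat \<lfloor>c * t\<rfloor>)) \<in> cadlag_paths"
proof -
  let ?x = "\<lambda>t\<in>{0..}. g (nat \<lfloor>c * t\<rfloor>)"
  have "(?x \<longlongrightarrow> ?x t) (at_right t)" if t: "t \<ge> 0" for t
  proof (rule tendsto_eventually)
    define b where "b = (of_int \<lfloor>c * t\<rfloor> + 1) / c"
    have "c * t < of_int \<lfloor>c * t\<rfloor> + 1" by linarith
    then have "t < b" using c by (simp add: b_def field_simps)
    moreover have "?x s = ?x t" if s: "t < s" "s < b" for s
    proof -
      have "c * s < of_int \<lfloor>c * t\<rfloor> + 1" using s(2) c by (simp add: b_def field_simps)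
      moreover have "c * t < c * s" using s c by simp
      ultimately have "\<lfloor>c * s\<rfloor> = \<lfloor>c * t\<rfloor>" by linarith
      then show ?thesis using s t by simp
    qed
    ultimately show "\<forall>\<^sub>F s in at_right t. ?x s = ?x t"
      unfolding eventually_at_right_field by blast
  qed
  moreover have "\<exists>l. (?x \<longlongrightarrow> l) (at_left t)" if t: "t > 0" for t
  proof (intro exI tendsto_eventually)
    \<comment> \<open>The last grid point strictly before \<open>t\<close>; the ceiling matters when
      \<open>t\<close> is itself a grid point, where the left limit is the preceding value.\<close>
    define b where "b = (of_int \<lceil>c * t\<rceil> - 1) / c"
    have "c * t > of_int \<lceil>c * t\<rceil> - 1" by linarith
    then have bt: "b < t" using c by (simp add: b_def field_simps)
    have "?x s = g (nat (\<lceil>c * t\<rceil> - 1))" if s: "max b 0 < s" "s < t" for s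
    proof -
      have "c * s > of_int \<lceil>c * t\<rceil> - 1" using s(1) c by (simp add: b_def field_simps)
      moreover have "c * s < c * t" using s c by simp
      ultimately have "\<lfloor>c * s\<rfloor> = \<lceil>c * t\<rceil> - 1" by linarith
      then show ?thesis using s by simp
    qed
    then show "\<forall>\<^sub>F s in at_left t. ?x s = g (nat (\<lceil>c * t\<rceil> - 1))"
      unfolding eventually_at_left_field using bt t by (intro exI[of _ "max b 0"]) auto
  qed
  ultimately show ?thesis by (simp add: cadlag_paths_def)
qed

lemma step_cadlag:
  fixes g :: "nat \<Rightarrow> 'b::metric_space"
  assumes "c \<ge> 0"
  shows "(\<lambda>t\<in>{0..}. g (nat \<lfloor>c * t\<rfloor>)) \<in> cadlag_paths"
proof (cases "c = 0")
  case True
  then show ?thesis using step_cadlag_pos[of 1 "\<lambda>_. g 0"] by simp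
next
  case False
  then show ?thesis using step_cadlag_pos[of c g] assms by simp
qed

text \<open>Mesh 1/m and horizon m are tied to one parameter; the path is frozen from time m on, so
  it is a function of the m * m + 1 values \<open>v 0\<close>, ...,
  \<open>v (m * m)\<close>.\<close>

definition grid_path :: "nat \<Rightarrow> (nat \<Rightarrow> 'b) \<Rightarrow> real \<Rightarrow> 'b" where
  "grid_path m v = (\<lambda>t\<in>{0..}. v (min (nat \<lfloor>real m * t\<rfloor>) (m * m)))"

definition sample_path :: "nat \<Rightarrow> (real \<Rightarrow> 'b) \<Rightarrow> real \<Rightarrow> 'b" where
  "sample_path m y = grid_path m (\<lambda>k. y (real k / real m))"

lemma grid_path_cadlag: "grid_path m v \<in> cadlag_paths"
  unfolding grid_path_def
  by (rule step_cadlag[of "real m" "\<lambda>k. v (min k (m * m))"]) simp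

lemma sample_path_cadlag: "sample_path m y \<in> cadlag_paths"
  by (simp add: sample_path_def grid_path_cadlag)

lemma sample_path_apply:
  assumes "0 \<le> t" "t \<le> real m"
  shows "sample_path m y t = y (real_of_int \<lfloor>real m * t\<rfloor> / real m)"
proof -
  have "real m * t \<le> real (m * m)" using assms by (simp add: mult_left_mono)
  then have "\<lfloor>real m * t\<rfloor> \<le> int (m * m)" by (simp add: floor_le_iff)
  then have "nat \<lfloor>real m * t\<rfloor> \<le> m * m" by (simp add: nat_le_iff)
  moreover have "0 \<le> \<lfloor>real m * t\<rfloor>" using assms by simp
  ultimately show ?thesis
    using assms by (simp add: sample_path_def grid_path_def min_absorb1)
qed

text \<open>Rounding up moves every point to the right by less than 1/m, and points at least 1/m
  apart keep their strict order, so linear interpolation between the rounded points gives an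
  increasing map.\<close>

lemma time_change_to_grid:
  assumes m: "m > 0" and D: "finite D" "D \<subseteq> {0<..}"
    and gap: "\<And>s s'. s \<in> D \<Longrightarrow> s' \<in> D \<Longrightarrow> s < s' \<Longrightarrow> 1 / real m \<le> s' - s"
  shows "\<exists>\<rho>\<in>time_changes. (\<forall>s\<in>D. \<rho> (\<lceil>real m * s\<rceil> / real m) = s) \<and> (\<forall>t\<ge>0. \<bar>\<rho> t - t\<bar> \<le> 1 / real m)"
proof -
  let ?r = "\<lambda>s. real_of_int \<lceil>real m * s\<rceil> / real m"
  have r: "s \<le> ?r s" "?r s < s + 1 / real m" for s
  proof -
    have "real m * s \<le> \<lceil>real m * s\<rceil>" "\<lceil>real m * s\<rceil> < real m * s + 1" by linarith+
    then show "s \<le> ?r s" "?r s < s + 1 / real m" using m by (auto simp: field_simps)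
  qed
  \<comment> \<open>For the induction on the largest point: \<open>u\<close> is the last prescribed
    node, or 0 if there is none, and only the part of the time change beyond \<open>u\<close> is
    altered.\<close>
  have "\<exists>\<rho>\<in>time_changes. \<exists>u\<ge>0. (\<forall>s\<in>D. \<rho> (?r s) = s \<and> ?r s \<le> u) \<and> (u = 0 \<or> (\<exists>s\<in>D. u = ?r s)) \<and>
     (\<forall>t\<ge>0. - 1 / real m \<le> \<rho> t - t \<and> \<rho> t - t \<le> 0)"
    using D gap
  proof (induction rule: finite_linorder_max_induct)
    case empty
    show ?case by (intro bexI[OF _ id_time_changes] exI[of _ 0]) auto
  next
    case (insert b D)
    have "\<exists>\<rho>\<in>time_changes. \<exists>u\<ge>0. (\<forall>s\<in>D. \<rho> (?r s) = s \<and> ?r s \<le> u) \<and> (u = 0 \<or> (\<exists>s\<in>D. u = ?r s)) \<and>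
        (\<forall>t\<ge>0. - 1 / real m \<le> \<rho> t - t \<and> \<rho> t - t \<le> 0)"
      by (rule insert.IH) (use insert.prems in auto)
    then obtain \<rho> u where \<rho>: "\<rho> \<in> time_changes" and u0: "u \<ge> 0"
      and uD: "\<forall>s\<in>D. \<rho> (?r s) = s \<and> ?r s \<le> u"
      and u': "u = 0 \<or> (\<exists>s\<in>D. u = ?r s)"
      and id': "\<forall>t\<ge>0. - 1 / real m \<le> \<rho> t - t \<and> \<rho> t - t \<le> 0"
      by (elim bexE exE conjE)
    note u = u0 uD[rule_format] and id = id'[rule_format]
    have b: "b > 0" using insert by auto
    \<comment> \<open>The gap condition enters here: the rounded position of an earlier point stays
      below \<open>b\<close>, so the new segment has positive length and positive slope.\<close>
    have ub: "u < ?r b \<and> \<rho> u < b"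
      using u'
    proof
      assume "u = 0"
      then show ?thesis using b r(1)[of b] time_changes_0[OF \<rho>] by auto
    next
      assume "\<exists>s\<in>D. u = ?r s"
      then obtain s where s: "s \<in> D" "u = ?r s" by blast
      then have "s < b" "1 / real m \<le> b - s" using insert by auto
      then have "?r s < b" using r(2)[of s] by linarith
      then show ?thesis using s u(2)[of s] \<open>s < b\<close> r(1)[of b] by auto
    qed
    define w where "w = ?r b"
    \<comment> \<open>The slope of the segment joining (u, \<rho> u) to (w, b); past
      \<open>w\<close> the slope is 1, so the displacement reached there persists.\<close>
    define c where "c = (b - \<rho> u) / (w - u)"
    have c: "c > 0" and cw: "c * (w - u) = b - \<rho> u" using ub by (auto simp: c_def w_def)
    define \<mu> where "\<mu> = (\<lambda>t. if t \<le> u then \<rho> t else \<rho> u + c * (t - u))"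
    define \<nu> where "\<nu> = (\<lambda>t. if t \<le> w then \<mu> t else \<mu> w + 1 * (t - w))"
    have uw: "u < w" "w \<ge> 0" using ub u by (auto simp: w_def)
    have \<mu>: "\<mu> \<in> time_changes" unfolding \<mu>_def by (rule time_changes_extend_linear[OF \<rho> u(1) c])
    have \<nu>: "\<nu> \<in> time_changes" unfolding \<nu>_def by (rule time_changes_extend_linear[OF \<mu> uw(2)]) simp
    have \<mu>w: "\<mu> w = b" using uw cw by (simp add: \<mu>_def)
    have bw: "- 1 / real m \<le> b - w \<and> b - w \<le> 0" using r[of b] by (auto simp: w_def)
    have 1: "- 1 / real m \<le> \<nu> t - t \<and> \<nu> t - t \<le> 0" if t: "t \<ge> 0" for t
    proof -
      consider "t \<le> u" | "u < t" "t \<le> w" | "w < t" by linarith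
      then show ?thesis
      proof cases
        case 1
        then show ?thesis using id[OF t] uw by (simp add: \<nu>_def \<mu>_def)
      next
        case 2
        \<comment> \<open>Along the new segment the displacement is the convex combination, with
          weight \<open>l\<close>, of its values at the two ends, so the bounds at the ends carry
          over.\<close>
        define l where "l = (t - u) / (w - u)"
        have l: "0 \<le> l" "l \<le> 1" using 2 by (auto simp: l_def)
        have lt: "t - u = l * (w - u)" using uw by (simp add: l_def)
        have "\<nu> t = \<rho> u + c * (l * (w - u))" using 2 lt by (simp add: \<nu>_def \<mu>_def)
        also have "c * (l * (w - u)) = l * (b - \<rho> u)" by (simp flip: cw)
        finally have "\<nu> t = \<rho> u + l * (b - \<rho> u)" .
        moreover have "t = u + l * (w - u)" using lt by simp
        ultimately have "\<nu> t - t = \<rho> u + l * (b - \<rho> u) - (u + l * (w - u))" by linarith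
        also have "\<dots> = (1 - l) * (\<rho> u - u) + l * (b - w)" by (simp add: algebra_simps)
        finally have eq: "\<nu> t - t = (1 - l) * (\<rho> u - u) + l * (b - w)" .
        have "(1 - l) * (- 1 / real m) + l * (- 1 / real m) \<le> \<nu> t - t"
          unfolding eq using l id[OF u(1)] bw by (intro add_mono mult_left_mono) auto
        moreover have "\<nu> t - t \<le> (1 - l) * 0 + l * 0"
          unfolding eq using l id[OF u(1)] bw by (intro add_mono mult_left_mono) auto
        moreover have "(1 - l) * c + l * c = c" for c :: real by (simp add: algebra_simps)
        ultimately show ?thesis by (simp only: mult_zero_right add_0_left)
      next
        case 3
        then show ?thesis using bw \<mu>w by (simp add: \<nu>_def)
      qed
    qed
    have 2: "\<nu> (?r s) = s \<and> ?r s \<le> w" if "s \<in> insert b D" for s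
      using that u(2)[of s] uw \<mu>w by (auto simp: \<nu>_def \<mu>_def w_def)
    show ?case
      using \<nu> uw 1 2 by (intro bexI[of _ \<nu>] exI[of _ w]) (auto simp: w_def)
  qed
  then obtain \<rho> where "\<rho> \<in> time_changes" "\<forall>s\<in>D. \<rho> (?r s) = s"
    "\<forall>t\<ge>0. - 1 / real m \<le> \<rho> t - t \<and> \<rho> t - t \<le> 0"
    by blast
  then show ?thesis by (intro bexI[of _ \<rho>] conjI allI impI) (auto simp: abs_le_iff)
qed

text \<open>\<open>D\<close> collects the large jumps of \<open>y\<close>. The time change puts
  \<open>\<rho> t\<close> and the grid point below \<open>t\<close> on the same side of every point
  of \<open>D\<close>, so only the oscillation between jumps remains. The horizon
  \<open>T + 1\<close> absorbs the displacement of at most 1/m.\<close>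

lemma sample_path_nbhd:
  fixes y :: "real \<Rightarrow> 'b::metric_space"
  assumes y: "y \<in> cadlag_paths" and m: "m > 0" "T \<le> real m" and D: "finite D" "D \<subseteq> {0<..}"
    and gap: "\<And>s s'. s \<in> D \<Longrightarrow> s' \<in> D \<Longrightarrow> s < s' \<Longrightarrow> 1 / real m \<le> s' - s"
    and osc: "\<And>a b. 0 \<le> a \<Longrightarrow> 0 \<le> b \<Longrightarrow> a \<le> T + 1 \<Longrightarrow> b \<le> T + 1 \<Longrightarrow> (\<forall>s\<in>D. s \<le> a \<longleftrightarrow> s \<le> b)
                 \<Longrightarrow> dist (y a) (y b) < \<epsilon>"
    and \<epsilon>: "1 / real m < \<epsilon>"
  shows "y \<in> J1_nbhd (sample_path m y) T \<epsilon>"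
proof -
  obtain \<rho> where \<rho>: "\<rho> \<in> time_changes" "\<And>s. s \<in> D \<Longrightarrow> \<rho> (\<lceil>real m * s\<rceil> / real m) = s"
    and id: "\<And>t. t \<ge> 0 \<Longrightarrow> \<bar>\<rho> t - t\<bar> \<le> 1 / real m"
    using time_change_to_grid[OF m(1) D gap] by blast
  have "\<bar>\<rho> t - t\<bar> < \<epsilon> \<and> dist (y (\<rho> t)) (sample_path m y t) < \<epsilon>" if t: "t \<in> {0..T}" for t
  proof
    show "\<bar>\<rho> t - t\<bar> < \<epsilon>" using id[of t] t \<epsilon> by auto
    define b where "b = real_of_int \<lfloor>real m * t\<rfloor> / real m"
    have b: "0 \<le> b" "b \<le> t"
      using t m of_int_floor_le[of "real m * t"] by (auto simp: b_def field_simps)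
    \<comment> \<open>A point of \<open>D\<close> is at most \<open>\<rho> t\<close> exactly when
      its rounded position is at most \<open>t\<close>; as that position lies on the grid,
      \<open>t\<close> may be replaced by \<open>b\<close>.\<close>
    have "s \<le> \<rho> t \<longleftrightarrow> s \<le> b" if s: "s \<in> D" for s
    proof -
      have s0: "s > 0" using s D by auto
      then have "0 < real m * s" using m(1) by simp
      then have "0 \<le> \<lceil>real m * s\<rceil>" by linarith
      then have r0: "0 \<le> \<lceil>real m * s\<rceil> / real m" by simp
      have "s \<le> \<rho> t \<longleftrightarrow> \<rho> (\<lceil>real m * s\<rceil> / real m) \<le> \<rho> t" using \<rho>(2)[OF s] by simp
      also have "\<dots> \<longleftrightarrow> \<lceil>real m * s\<rceil> / real m \<le> t"
        using t s0 m r0 by (intro time_changes_le_iff[OF \<rho>(1)]) auto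
      also have "\<dots> \<longleftrightarrow> \<lceil>real m * s\<rceil> \<le> real m * t" using m by (simp add: field_simps)
      also have "\<dots> \<longleftrightarrow> \<lceil>real m * s\<rceil> \<le> \<lfloor>real m * t\<rfloor>" by (simp add: le_floor_iff)
      also have "\<dots> \<longleftrightarrow> real m * s \<le> \<lfloor>real m * t\<rfloor>" by (simp add: ceiling_le_iff)
      also have "\<dots> \<longleftrightarrow> s \<le> b" using m by (simp add: b_def field_simps)
      finally show ?thesis .
    qed
    moreover have "\<rho> t \<ge> 0" using time_changes_nonneg[OF \<rho>(1)] t by auto
    moreover have "1 / real m \<le> 1" using m by simp
    then have "\<rho> t \<le> T + 1" using id[of t] t unfolding abs_le_iff by (auto simp del: divide_le_eq_1_pos)
    ultimately have "dist (y (\<rho> t)) (y b) < \<epsilon>"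
      using osc[of "\<rho> t" b] b t by auto
    then show "dist (y (\<rho> t)) (sample_path m y t) < \<epsilon>"
      using sample_path_apply[of t m y] t m by (simp add: b_def)
  qed
  then show ?thesis using y \<rho>(1) unfolding J1_nbhd_def by blast
qed

text \<open>Bisection: at each point the one-sided limits control the oscillation once a single cut
  is made there, and two intervals are glued by a cut at their common end. The condition on
  \<open>D\<close> says that \<open>a\<close> and \<open>b\<close> lie in the same half-open
  interval, closed on the left as right continuity demands.\<close>

lemma cadlag_finite_oscillation:
  fixes y :: "real \<Rightarrow> 'b::metric_space"
  assumes y: "y \<in> cadlag_paths" and \<epsilon>: "\<epsilon> > 0" and T: "0 \<le> T"
  shows "\<exists>D. finite D \<and> D \<subseteq> {0<..} \<and> (\<forall>a\<in>{0..T}. \<forall>b\<in>{0..T}. (\<forall>s\<in>D. s \<le> a \<longleftrightarrow> s \<le> b) \<longrightarrow> dist (y a) (y b) < \<epsilon>)"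
proof -
  define P where "P = (\<lambda>u v. 0 \<le> u \<longrightarrow> (\<exists>D. finite D \<and> D \<subseteq> {0<..} \<and>
     (\<forall>a\<in>{u..v}. \<forall>b\<in>{u..v}. (\<forall>s\<in>D. s \<le> a \<longleftrightarrow> s \<le> b) \<longrightarrow> dist (y a) (y b) < \<epsilon>)))"
  have "P 0 T"
  proof (rule Bolzano[OF T])
    fix u v w :: real assume P: "P u v" "P v w" "u \<le> v" "v \<le> w"
    show "P u w"
      unfolding P_def
    proof
      assume u: "0 \<le> u"
      obtain D1 where D1: "finite D1" "D1 \<subseteq> {0<..}"
        "\<forall>a\<in>{u..v}. \<forall>b\<in>{u..v}. (\<forall>s\<in>D1. s \<le> a \<longleftrightarrow> s \<le> b) \<longrightarrow> dist (y a) (y b) < \<epsilon>"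
        using P u unfolding P_def by blast
      obtain D2 where D2: "finite D2" "D2 \<subseteq> {0<..}"
        "\<forall>a\<in>{v..w}. \<forall>b\<in>{v..w}. (\<forall>s\<in>D2. s \<le> a \<longleftrightarrow> s \<le> b) \<longrightarrow> dist (y a) (y b) < \<epsilon>"
        using P u order_trans[OF u P(3)] unfolding P_def by blast
      \<comment> \<open>The cut at \<open>v\<close> keeps the two halves apart. Cuts must be
        positive, and for v = 0 the first half is just {0}.\<close>
      define D where "D = D1 \<union> D2 \<union> ({v} \<inter> {0<..})"
      have "dist (y a) (y b) < \<epsilon>"
        if ab: "a \<in> {u..w}" "b \<in> {u..w}" "\<forall>s\<in>D. s \<le> a \<longleftrightarrow> s \<le> b" for a b
      proof -
        have "v \<le> a \<longleftrightarrow> v \<le> b"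
          using ab u by (cases "v > 0") (auto simp: D_def)
        then consider "a \<in> {u..v}" "b \<in> {u..v}" | "a \<in> {v..w}" "b \<in> {v..w}"
          using ab by force
        then show ?thesis using D1(3) D2(3) ab(3) by cases (auto simp: D_def)
      qed
      then show "\<exists>D. finite D \<and> D \<subseteq> {0<..} \<and>
         (\<forall>a\<in>{u..w}. \<forall>b\<in>{u..w}. (\<forall>s\<in>D. s \<le> a \<longleftrightarrow> s \<le> b) \<longrightarrow> dist (y a) (y b) < \<epsilon>)"
        using D1 D2 by (intro exI[of _ D]) (auto simp: D_def)
    qed
  next
    fix x :: real assume x: "0 \<le> x" "x \<le> T"
    have "(y \<longlongrightarrow> y x) (at_right x)" using y x by (simp add: cadlag_paths_def)
    then have "\<forall>\<^sub>F s in at_right x. dist (y s) (y x) < \<epsilon> / 2"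
      using \<epsilon> by (intro tendstoD) auto
    then obtain r where r: "r > x" "\<And>s. x < s \<Longrightarrow> s < r \<Longrightarrow> dist (y s) (y x) < \<epsilon> / 2"
      unfolding eventually_at_right_field by blast
    obtain l z where l: "l < x" "\<And>s. 0 \<le> s \<Longrightarrow> l < s \<Longrightarrow> s < x \<Longrightarrow> dist (y s) z < \<epsilon> / 2"
    proof (cases "x = 0")
      case True
      then show ?thesis by (intro that[of "-1"]) auto
    next
      case False
      then obtain z where "(y \<longlongrightarrow> z) (at_left x)"
        using y x unfolding cadlag_paths_def by force
      then have "\<forall>\<^sub>F s in at_left x. dist (y s) z < \<epsilon> / 2"
        using \<epsilon> by (intro tendstoD) auto
      then show ?thesis
        unfolding eventually_at_left_field using that by blast
    qed
    show "\<exists>d>0. \<forall>a b. a \<le> x \<and> x \<le> b \<and> b - a < d \<longrightarrow> P a b"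
    proof (intro exI[of _ "min (x - l) (r - x)"] conjI allI impI)
      show "0 < min (x - l) (r - x)" using l r by auto
      fix u v assume uv: "u \<le> x \<and> x \<le> v \<and> v - u < min (x - l) (r - x)"
      have "dist (y a) (y b) < \<epsilon>"
        if u: "0 \<le> u" and ab: "a \<in> {u..v}" "b \<in> {u..v}" "\<forall>s\<in>{x} \<inter> {0<..}. s \<le> a \<longleftrightarrow> s \<le> b" for a b
      proof -
        have "x \<le> a \<longleftrightarrow> x \<le> b" using ab x u by (cases "x > 0") auto
        then consider "a < x" "b < x" | "a \<ge> x" "b \<ge> x" by force
        then show ?thesis
        proof cases
          case 1
          have "dist (y a) z < \<epsilon> / 2" "dist (y b) z < \<epsilon> / 2"
            using 1 ab uv u l(2)[of a] l(2)[of b] by auto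
          then show ?thesis using dist_triangle2[of "y a" "y b" z] by simp
        next
          case 2
          have "dist (y s) (y x) < \<epsilon> / 2" if "x \<le> s" "s \<le> v" for s
            using that r(2)[of s] uv \<epsilon> by (cases "s = x") auto
          then have "dist (y a) (y x) < \<epsilon> / 2" "dist (y b) (y x) < \<epsilon> / 2" using 2 ab by auto
          then show ?thesis using dist_triangle2[of "y a" "y b" "y x"] by simp
        qed
      qed
      then show "P u v"
        unfolding P_def by (intro impI exI[of _ "{x} \<inter> {0<..}"]) auto
    qed
  qed
  then show ?thesis by (auto simp: P_def)
qed

text \<open>The finitely many cuts for oscillation \<epsilon> have a smallest gap, and 1/m is
  eventually below it.\<close>

lemma cadlag_sample_path_nbhd:
  fixes y :: "real \<Rightarrow> 'b::metric_space"
  assumes y: "y \<in> cadlag_paths" and \<epsilon>: "\<epsilon> > 0"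
  shows "\<forall>\<^sub>F m in sequentially. y \<in> J1_nbhd (sample_path m y) T \<epsilon>"
proof -
  obtain D where D: "finite D" "D \<subseteq> {0<..}"
    and osc: "\<And>a b. a \<in> {0..max T 0 + 1} \<Longrightarrow> b \<in> {0..max T 0 + 1} \<Longrightarrow> (\<forall>s\<in>D. s \<le> a \<longleftrightarrow> s \<le> b) \<Longrightarrow> dist (y a) (y b) < \<epsilon>"
    using cadlag_finite_oscillation[OF y \<epsilon>, of "max T 0 + 1"] by auto
  define G where "G = (\<lambda>(s, s'). s' - s) ` {(s, s') \<in> D \<times> D. s < s'}"
  have G: "finite G" "\<And>g. g \<in> G \<Longrightarrow> g > 0"
    using D(1) unfolding G_def
    by (auto intro!: finite_imageI intro: finite_subset[of _ "D \<times> D"])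
  have lim: "(\<lambda>m. 1 / real m) \<longlonglongrightarrow> 0" by (rule lim_1_over_n)
  have "\<forall>\<^sub>F m in sequentially. \<forall>g\<in>G. 1 / real m < g"
    using G by (intro eventually_ball_finite) (auto intro: order_tendstoD(2)[OF lim])
  moreover have "\<forall>\<^sub>F m in sequentially. 1 / real m < \<epsilon>"
    by (rule order_tendstoD(2)[OF lim \<epsilon>])
  moreover have "\<forall>\<^sub>F m in sequentially. T \<le> real m"
    using eventually_ge_at_top[of "nat \<lceil>T\<rceil>"] by eventually_elim linarith
  moreover have "\<forall>\<^sub>F m::nat in sequentially. 0 < m" by (rule eventually_gt_at_top)
  ultimately show ?thesis
  proof eventually_elim
    case (elim m)
    show ?case
    proof (rule sample_path_nbhd[OF y elim(4) elim(3) D])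
      show "1 / real m \<le> s' - s" if "s \<in> D" "s' \<in> D" "s < s'" for s s'
      proof -
        have "s' - s \<in> G" using that by (force simp: G_def)
        then show ?thesis using elim(1) by force
      qed
    qed (use osc elim in auto)
  qed
qed

section \<open>Lipschitz regularisation of functionals on Skorohod space\<close>

text \<open>Lower semicontinuity covers both uses below: continuous functionals for the expectations
  and indicators of open sets for measurability.\<close>

definition J1_lsc :: "((real \<Rightarrow> 'b::metric_space) \<Rightarrow> real) \<Rightarrow> bool" where
  "J1_lsc f \<longleftrightarrow> (\<forall>y\<in>cadlag_paths. \<forall>c<f y. \<exists>T \<delta>. \<delta> > 0 \<and> (\<forall>z\<in>J1_nbhd y T \<delta>. c \<le> f z))"

text \<open>An infimal convolution: it is Lipschitz for the uniform distance, and it lies below every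
  value of \<open>f\<close> on a J1 neighbourhood of its argument.\<close>

abbreviation reg_values :: "nat \<Rightarrow> ((real \<Rightarrow> 'b::metric_space) \<Rightarrow> real) \<Rightarrow> (real \<Rightarrow> 'b) \<Rightarrow> real set" where
  "reg_values j f x \<equiv> {f z + real j * s | a z s. a \<in> cadlag_paths \<and>
     z \<in> J1_nbhd a (real j) (1 / real j) \<and> 0 \<le> s \<and> (\<forall>t\<ge>0. dist (x t) (a t) \<le> s)}"

definition lower_reg :: "nat \<Rightarrow> ((real \<Rightarrow> 'b::metric_space) \<Rightarrow> real) \<Rightarrow> (real \<Rightarrow> 'b) \<Rightarrow> real" where
  "lower_reg j f x = Inf (reg_values j f x)"

lemma J1_nbhd_refl: "x \<in> cadlag_paths \<Longrightarrow> \<epsilon> > 0 \<Longrightarrow> x \<in> J1_nbhd x T \<epsilon>"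
  by (rule J1_nbhd_uniform[of _ _ 0]) auto

lemma J1_nbhd_cadlag: "y \<in> J1_nbhd x T \<epsilon> \<Longrightarrow> y \<in> cadlag_paths"
  by (simp add: J1_nbhd_def)

lemma continuous_imp_J1_lsc:
  assumes f: "continuous_map skorohod_J1 euclideanreal f"
  shows "J1_lsc f"
  unfolding J1_lsc_def
proof (intro ballI allI impI)
  fix y c assume y: "y \<in> cadlag_paths" and c: "c < f y"
  have "openin skorohod_J1 {z \<in> topspace skorohod_J1. f z \<in> {c<..}}"
    by (rule openin_continuous_map_preimage[OF f]) simp
  then have "openin skorohod_J1 {z \<in> cadlag_paths. c < f z}" by simp
  then obtain T \<delta> where "\<delta> > 0" "J1_nbhd y T \<delta> \<subseteq> {z \<in> cadlag_paths. c < f z}"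
    using y c unfolding openin_skorohod_J1 by blast
  then show "\<exists>T \<delta>. \<delta> > 0 \<and> (\<forall>z\<in>J1_nbhd y T \<delta>. c \<le> f z)"
    by (intro exI[of _ T] exI[of _ \<delta>]) auto
qed

lemma open_imp_J1_lsc:
  assumes U: "openin skorohod_J1 U"
  shows "J1_lsc (indicator U)"
  unfolding J1_lsc_def
proof (intro ballI allI impI)
  fix y and c :: real assume c: "c < indicator U y"
  show "\<exists>T \<delta>. \<delta> > 0 \<and> (\<forall>z\<in>J1_nbhd y T \<delta>. c \<le> indicator U z)"
  proof (cases "y \<in> U")
    case True
    then obtain T \<delta> where "\<delta> > 0" "J1_nbhd y T \<delta> \<subseteq> U"
      using U unfolding openin_skorohod_J1 by blast
    then show ?thesis
      using c True by (intro exI[of _ T] exI[of _ \<delta>]) (auto simp: indicator_def)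
  next
    case False
    then have "c \<le> indicator U z" for z using c by (auto simp: indicator_def)
    then show ?thesis by (intro exI[of _ 0] exI[of _ 1]) auto
  qed
qed

context
  fixes f :: "(real \<Rightarrow> 'b::metric_space) \<Rightarrow> real"
  assumes f01: "\<And>x. x \<in> cadlag_paths \<Longrightarrow> 0 \<le> f x \<and> f x \<le> 1"
begin

lemma lower_reg_bdd:
  "bdd_below (reg_values j f x)"
  using f01 by (intro bdd_belowI[of _ 0]) (auto dest!: J1_nbhd_cadlag)

lemma lower_reg_lower:
  assumes "a \<in> cadlag_paths" "z \<in> J1_nbhd a (real j) (1 / real j)" "0 \<le> s"
    "\<And>t. t \<ge> 0 \<Longrightarrow> dist (x t) (a t) \<le> s"
  shows "lower_reg j f x \<le> f z + real j * s"
  unfolding lower_reg_def using assms by (intro cInf_lower lower_reg_bdd) blast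

lemma lower_reg_greatest:
  assumes "x \<in> cadlag_paths" "j > 0"
    and "\<And>a z s. a \<in> cadlag_paths \<Longrightarrow> z \<in> J1_nbhd a (real j) (1 / real j) \<Longrightarrow> 0 \<le> s \<Longrightarrow>
      (\<And>t. t \<ge> 0 \<Longrightarrow> dist (x t) (a t) \<le> s) \<Longrightarrow> c \<le> f z + real j * s"
  shows "c \<le> lower_reg j f x"
  unfolding lower_reg_def
proof (rule cInf_greatest)
  have "f x + real j * 0 \<in> reg_values j f x"
    using assms(1,2) by (intro CollectI exI[of _ x] exI[of _ 0] conjI refl J1_nbhd_refl) auto
  then show "reg_values j f x \<noteq> {}"
    by blast
qed (use assms(3) in blast)

lemma lower_reg_le:
  assumes "x \<in> cadlag_paths" "z \<in> J1_nbhd x (real j) (1 / real j)"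
  shows "lower_reg j f x \<le> f z"
  using lower_reg_lower[OF assms, of 0 x] by simp

lemma lower_reg_01:
  assumes "x \<in> cadlag_paths" "j > 0"
  shows "0 \<le> lower_reg j f x" "lower_reg j f x \<le> 1"
proof -
  show "0 \<le> lower_reg j f x"
    using f01 by (intro lower_reg_greatest[OF assms]) (auto dest!: J1_nbhd_cadlag)
  have "lower_reg j f x \<le> f x"
    using assms by (intro lower_reg_le J1_nbhd_refl) auto
  then show "lower_reg j f x \<le> 1" using f01[OF assms(1)] by simp
qed

text \<open>If \<open>a\<close> is admissible for one path at cost \<open>s\<close>, it is
  admissible for the other at cost \<open>r + s\<close>, by the triangle inequality.\<close>

lemma lower_reg_lipschitz:
  assumes "x \<in> cadlag_paths" "y \<in> cadlag_paths" "j > 0" "\<And>t. t \<ge> 0 \<Longrightarrow> dist (x t) (y t) \<le> r"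
  shows "\<bar>lower_reg j f x - lower_reg j f y\<bar> \<le> real j * r"
proof -
  have r: "r \<ge> 0" using assms(4)[of 0] zero_le_dist[of "x 0" "y 0"] by linarith
  have *: "lower_reg j f u - real j * r \<le> lower_reg j f v"
    if uv: "v \<in> cadlag_paths" "\<And>t. t \<ge> 0 \<Longrightarrow> dist (u t) (v t) \<le> r" for u v
  proof (rule lower_reg_greatest[OF uv(1) assms(3)])
    fix a z s assume a: "a \<in> cadlag_paths" "z \<in> J1_nbhd a (real j) (1 / real j)" "0 \<le> s"
      "\<And>t. t \<ge> 0 \<Longrightarrow> dist (v t) (a t) \<le> s"
    have "dist (u t) (a t) \<le> r + s" if "t \<ge> 0" for t
      using a(4)[OF that] uv(2)[OF that] dist_triangle[of "u t" "a t" "v t"] by linarith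
    then have "lower_reg j f u \<le> f z + real j * (r + s)"
      using r a(3) by (intro lower_reg_lower[OF a(1,2)]) auto
    then show "lower_reg j f u - real j * r \<le> f z + real j * s" by (simp add: algebra_simps)
  qed
  show ?thesis
    using *[of y x] *[of x y] assms by (auto simp: dist_commute)
qed

lemma lower_reg_sample_upper:
  assumes "y \<in> cadlag_paths" "j > 0"
  shows "\<forall>\<^sub>F m in sequentially. lower_reg j f (sample_path m y) \<le> f y"
  using cadlag_sample_path_nbhd[OF assms(1), of "1 / real j" "real j"] assms(2)
  by (auto elim!: eventually_mono intro!: lower_reg_le sample_path_cadlag)

text \<open>A competitor at distance at least 1/j already costs 1, which exceeds \<open>c\<close>.
  Any other leads from \<open>y\<close> to \<open>z\<close> in three hops of radius \<delta>/3: to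
  the sampled path, to \<open>a\<close>, to \<open>z\<close>.\<close>

lemma lower_reg_sample_lower:
  assumes f: "J1_lsc f" and y: "y \<in> cadlag_paths" and c: "c < f y"
  shows "\<forall>\<^sub>F j in sequentially. \<forall>\<^sub>F m in sequentially. c \<le> lower_reg j f (sample_path m y)"
proof -
  obtain T \<delta> where \<delta>: "\<delta> > 0" and low: "\<And>z. z \<in> J1_nbhd y T \<delta> \<Longrightarrow> c \<le> f z"
    using f y c unfolding J1_lsc_def by blast
  have lim: "(\<lambda>j. 1 / real j) \<longlonglongrightarrow> 0" by (rule lim_1_over_n)
  have "\<forall>\<^sub>F j in sequentially. 1 / real j < \<delta> / 3"
    using \<delta> by (intro order_tendstoD(2)[OF lim]) simp
  moreover have "\<forall>\<^sub>F j in sequentially. T + \<delta> \<le> real j"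
    using eventually_ge_at_top[of "nat \<lceil>T + \<delta>\<rceil>"] by eventually_elim linarith
  moreover have "\<forall>\<^sub>F j::nat in sequentially. 0 < j" by (rule eventually_gt_at_top)
  ultimately show ?thesis
  proof eventually_elim
    case (elim j)
    \<comment> \<open>The extra \<delta>/3 in the horizon is spent on reversing the
      neighbourhood.\<close>
    have "\<forall>\<^sub>F m in sequentially. y \<in> J1_nbhd (sample_path m y) (T + \<delta> / 3) (\<delta> / 3)"
      using \<delta> by (intro cadlag_sample_path_nbhd[OF y]) simp
    then show ?case
    proof eventually_elim
      case (elim m)
      let ?x = "sample_path m y"
      have x: "?x \<in> J1_nbhd y T (\<delta> / 3)"
        by (rule J1_nbhd_sym[OF elim sample_path_cadlag]) (use \<delta> in simp)
      show ?case
      proof (rule lower_reg_greatest[OF sample_path_cadlag \<open>0 < j\<close>])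
        fix a z s assume a: "a \<in> cadlag_paths" "z \<in> J1_nbhd a (real j) (1 / real j)" "0 \<le> s"
          "\<And>t. t \<ge> 0 \<Longrightarrow> dist (?x t) (a t) \<le> s"
        show "c \<le> f z + real j * s"
        proof (cases "s < 1 / real j")
          case True
          then have "a \<in> J1_nbhd ?x (T + \<delta> / 3) (\<delta> / 3)"
            using a \<open>1 / real j < \<delta> / 3\<close> by (intro J1_nbhd_uniform[where r = s]) auto
          with x have "a \<in> J1_nbhd y T (\<delta> / 3 + \<delta> / 3)" by (rule J1_nbhd_trans)
          moreover have "z \<in> J1_nbhd a (T + (\<delta> / 3 + \<delta> / 3)) (\<delta> / 3)"
            using a(2) \<open>1 / real j < \<delta> / 3\<close> \<open>T + \<delta> \<le> real j\<close> \<delta>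
            by (intro subsetD[OF J1_nbhd_mono a(2)]) auto
          ultimately have "z \<in> J1_nbhd y T (\<delta> / 3 + \<delta> / 3 + \<delta> / 3)" by (rule J1_nbhd_trans)
          then have "c \<le> f z" by (intro low) simp
          moreover have "real j * s \<ge> 0" using a(3) by simp
          ultimately show ?thesis by linarith
        next
          case False
          then have "1 \<le> real j * s" using \<open>0 < j\<close> by (simp add: field_simps)
          moreover have "f z \<ge> 0" using f01 J1_nbhd_cadlag[OF a(2)] by blast
          ultimately show ?thesis using c f01[OF y] by linarith
        qed
      qed
    qed
  qed
qed

text \<open>This expresses \<open>f\<close> through functions of finitely many path values. Values
  in \<open>ennreal\<close> suit Fatou's lemma, and the index \<open>Suc j\<close> keeps the radius
  1/j positive.\<close>

lemma lower_reg_sample_liminf: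
  assumes f: "J1_lsc f" and y: "y \<in> cadlag_paths"
  shows "ennreal (f y) =
    liminf (\<lambda>j. liminf (\<lambda>m. ennreal (lower_reg (Suc j) f (sample_path m y))))"
proof (rule antisym)
  show "ennreal (f y) \<le> liminf (\<lambda>j. liminf (\<lambda>m. ennreal (lower_reg (Suc j) f (sample_path m y))))"
    unfolding le_Liminf_iff
  proof (intro allI impI)
    fix r assume r: "r < ennreal (f y)"
    obtain c where c: "c \<ge> 0" "r < ennreal c" "c < f y"
    proof -
      from r obtain q where q: "r < q" "q < ennreal (f y)" using dense by blast
      then show ?thesis
        using that[of "enn2real q"] f01[OF y]
        by (cases q) (auto simp: ennreal_less_iff top_unique)
    qed
    have "\<forall>\<^sub>F j in sequentially. \<forall>\<^sub>F m in sequentially. c \<le> lower_reg (Suc j) f (sample_path m y)"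
      using lower_reg_sample_lower[OF f y c(3)]
      by (rule eventually_compose_filterlim) (rule filterlim_Suc)
    then show "\<forall>\<^sub>F j in sequentially. r < liminf (\<lambda>m. ennreal (lower_reg (Suc j) f (sample_path m y)))"
    proof eventually_elim
      case (elim j)
      have "ennreal c \<le> liminf (\<lambda>m. ennreal (lower_reg (Suc j) f (sample_path m y)))"
        using elim by (intro Liminf_bounded) (auto elim!: eventually_mono intro: ennreal_leI)
      with c(2) show ?case by (rule less_le_trans)
    qed
  qed
  have "liminf (\<lambda>m. ennreal (lower_reg (Suc j) f (sample_path m y))) \<le> ennreal (f y)" for j
  proof -
    have "liminf (\<lambda>m. ennreal (lower_reg (Suc j) f (sample_path m y))) \<le> liminf (\<lambda>m::nat. ennreal (f y))"
      using lower_reg_sample_upper[OF y, of "Suc j"]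
      by (intro Liminf_mono) (auto elim!: eventually_mono intro: ennreal_leI)
    then show ?thesis by (simp add: Liminf_const)
  qed
  then have "liminf (\<lambda>j. liminf (\<lambda>m. ennreal (lower_reg (Suc j) f (sample_path m y))))
      \<le> liminf (\<lambda>j::nat. ennreal (f y))"
    by (intro Liminf_mono always_eventually allI)
  then show "liminf (\<lambda>j. liminf (\<lambda>m. ennreal (lower_reg (Suc j) f (sample_path m y)))) \<le> ennreal (f y)"
    by (simp add: Liminf_const)
qed

text \<open>Two step paths on the same grid differ uniformly by at most the largest difference of
  their values, hence by at most the sum.\<close>

lemma lower_reg_grid_lipschitz:
  assumes "j > 0"
  shows "\<bar>lower_reg j f (grid_path m v) - lower_reg j f (grid_path m w)\<bar>
    \<le> real j * (\<Sum>k\<le>m * m. dist (v k) (w k))"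
proof (rule lower_reg_lipschitz[OF grid_path_cadlag grid_path_cadlag assms])
  fix t :: real assume "t \<ge> 0"
  then show "dist (grid_path m v t) (grid_path m w t) \<le> (\<Sum>k\<le>m * m. dist (v k) (w k))"
    by (auto simp: grid_path_def intro!: member_le_sum)
qed

end

section \<open>Measurability of cadlag processes\<close>

text \<open>The right-hand side involves finitely many coordinates, so \<open>F\<close> is
  continuous for the product topology, whose Borel sets over a countable index type are those of the
  product sigma-algebra.\<close>

lemma borel_measurable_lipschitz_functional:
  fixes F :: "('i::countable \<Rightarrow> 'b::{metric_space, second_countable_topology}) \<Rightarrow> real"
  assumes I: "finite I" and F: "\<And>v w. \<bar>F v - F w\<bar> \<le> L * (\<Sum>i\<in>I. dist (v i) (w i))"
    and \<xi>: "\<And>i. i \<in> I \<Longrightarrow> \<xi> i \<in> borel_measurable M"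
  shows "(\<lambda>\<omega>. F (\<lambda>i. \<xi> i \<omega>)) \<in> borel_measurable M"
proof -
  have "isCont F v" for v
  proof -
    have "((\<lambda>w. L * (\<Sum>i\<in>I. dist (w i) (v i))) \<longlongrightarrow> L * (\<Sum>i\<in>I. dist (v i) (v i))) (at v)"
    proof (intro tendsto_intros)
      fix i
      have "continuous_on UNIV (\<lambda>w::'i \<Rightarrow> 'b. w i)" by (rule continuous_on_product_coordinates)
      then show "((\<lambda>w. w i) \<longlongrightarrow> v i) (at v)"
        unfolding continuous_on_def by blast
    qed
    then have "((\<lambda>w. L * (\<Sum>i\<in>I. dist (w i) (v i))) \<longlongrightarrow> 0) (at v)" by simp
    then have "((\<lambda>w. F w - F v) \<longlongrightarrow> 0) (at v)"
      by (rule Lim_null_comparison[rotated]) (use F in auto)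
    then show ?thesis by (simp add: isCont_def LIM_zero_iff)
  qed
  then have "continuous_on UNIV F" by (simp add: continuous_on_eq_continuous_at)
  then have F': "F \<in> borel_measurable borel" by (rule borel_measurable_continuous_onI)
  \<comment> \<open>Nothing is known about \<xi> outside \<open>I\<close>; a constant is put there,
    which by the Lipschitz bound leaves the value of \<open>F\<close> unchanged.\<close>
  obtain b :: 'b where True by blast
  have "(\<lambda>\<omega> i. if i \<in> I then \<xi> i \<omega> else b) \<in> M \<rightarrow>\<^sub>M PiM UNIV (\<lambda>_. borel)"
  proof (rule measurable_PiM_single')
    fix i show "(\<lambda>\<omega>. if i \<in> I then \<xi> i \<omega> else b) \<in> borel_measurable M"
      using \<xi>[of i] by (cases "i \<in> I") auto
  qed simp
  then have "(\<lambda>\<omega> i. if i \<in> I then \<xi> i \<omega> else b) \<in> M \<rightarrow>\<^sub>M borel"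
    using measurable_cong_sets[OF refl sets_PiM_equal_borel] by blast
  from measurable_compose[OF this F']
  have "(\<lambda>\<omega>. F (\<lambda>i. if i \<in> I then \<xi> i \<omega> else b)) \<in> borel_measurable M" .
  moreover have "F (\<lambda>i. if i \<in> I then \<xi> i \<omega> else b) = F (\<lambda>i. \<xi> i \<omega>)" for \<omega>
    using F[of "\<lambda>i. if i \<in> I then \<xi> i \<omega> else b" "\<lambda>i. \<xi> i \<omega>"] by (simp cong: sum.cong)
  ultimately show ?thesis by simp
qed

lemma borel_measurable_lower_reg_sample:
  fixes X :: "'a \<Rightarrow> real \<Rightarrow> 'b::{metric_space, second_countable_topology}"
  assumes "\<And>x. x \<in> cadlag_paths \<Longrightarrow> 0 \<le> f x \<and> f x \<le> 1" "j > 0"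
    and X: "\<And>t. t \<ge> 0 \<Longrightarrow> (\<lambda>\<omega>. X \<omega> t) \<in> borel_measurable M"
  shows "(\<lambda>\<omega>. lower_reg j f (sample_path m (X \<omega>))) \<in> borel_measurable M"
  unfolding sample_path_def
  using borel_measurable_lipschitz_functional[where F = "\<lambda>v. lower_reg j f (grid_path m v)"
      and I = "{..m * m}" and \<xi> = "\<lambda>k \<omega>. X \<omega> (real k / real m)" and L = "real j"]
    lower_reg_grid_lipschitz[where f = f, OF assms(1,2)] X
  by simp

text \<open>Along the process, \<open>f\<close> is a double liminf of measurable grid
  functionals.\<close>

lemma borel_measurable_J1_lsc:
  fixes X :: "'a \<Rightarrow> real \<Rightarrow> 'b::{metric_space, second_countable_topology}"
  assumes f: "\<And>x. x \<in> cadlag_paths \<Longrightarrow> 0 \<le> f x \<and> f x \<le> 1" "J1_lsc f"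
    and X: "\<And>\<omega>. \<omega> \<in> space M \<Longrightarrow> X \<omega> \<in> cadlag_paths" "\<And>t. t \<ge> 0 \<Longrightarrow> (\<lambda>\<omega>. X \<omega> t) \<in> borel_measurable M"
  shows "(\<lambda>\<omega>. f (X \<omega>)) \<in> borel_measurable M"
proof -
  have [measurable]: "(\<lambda>\<omega>. lower_reg (Suc j) f (sample_path m (X \<omega>))) \<in> borel_measurable M" for j m
    by (rule borel_measurable_lower_reg_sample) (use f X in auto)
  have "(\<lambda>\<omega>. enn2real (liminf (\<lambda>j. liminf (\<lambda>m. ennreal (lower_reg (Suc j) f (sample_path m (X \<omega>)))))))
      \<in> borel_measurable M"
    by measurable
  moreover have "enn2real (liminf (\<lambda>j. liminf (\<lambda>m. ennreal (lower_reg (Suc j) f (sample_path m (X \<omega>)))))) = f (X \<omega>)"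
    if "\<omega> \<in> space M" for \<omega>
    using lower_reg_sample_liminf[where f = f, OF f X(1)[OF that], symmetric] f(1)[OF X(1)[OF that]] by simp
  ultimately show ?thesis by (simp cong: measurable_cong)
qed

text \<open>Indicators of open sets are lower semicontinuous, so measurability of every coordinate
  carries over to the Borel sets of J1.\<close>

lemma measurable_skorohod_J1:
  fixes X :: "'a \<Rightarrow> real \<Rightarrow> 'b::{metric_space, second_countable_topology}"
  assumes X: "\<And>\<omega>. \<omega> \<in> space M \<Longrightarrow> X \<omega> \<in> cadlag_paths" "\<And>t. t \<ge> 0 \<Longrightarrow> (\<lambda>\<omega>. X \<omega> t) \<in> borel_measurable M"
  shows "X \<in> M \<rightarrow>\<^sub>M borel_of skorohod_J1"
  unfolding borel_of_def
proof (rule measurable_measure_of)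
  show "{U. openin skorohod_J1 U} \<subseteq> Pow (topspace (skorohod_J1 :: (real \<Rightarrow> 'b) topology))"
    using openin_subset by blast
  show "X \<in> space M \<rightarrow> topspace skorohod_J1" using X(1) by simp
  fix U assume "U \<in> {U. openin (skorohod_J1 :: (real \<Rightarrow> 'b) topology) U}"
  then have "(\<lambda>\<omega>. indicator U (X \<omega>) :: real) \<in> borel_measurable M"
    by (intro borel_measurable_J1_lsc[where f = "indicator U"] open_imp_J1_lsc X)
      (auto simp: indicator_def)
  then have "(\<lambda>\<omega>. indicator U (X \<omega>) :: real) -` {1} \<inter> space M \<in> sets M" by (rule measurable_sets) simp
  also have "(\<lambda>\<omega>. indicator U (X \<omega>) :: real) -` {1} \<inter> space M = X -` U \<inter> space M"
    by (auto simp: indicator_def split: if_splits)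
  finally show "X -` U \<inter> space M \<in> sets M" .
qed

section \<open>A convergence criterion in Skorohod space\<close>

text \<open>An exceptional event \<open>A\<close> is asked for, instead of a bound on the
  probability of a complement, so that the set of well approximated outcomes may be
  non-measurable.\<close>

abbreviation well_sampled ::
    "'a measure \<Rightarrow> ('a \<Rightarrow> real \<Rightarrow> 'b::metric_space) \<Rightarrow> nat \<Rightarrow> real \<Rightarrow> real \<Rightarrow> real \<Rightarrow> bool" where
  "well_sampled M X m T \<epsilon> \<kappa> \<equiv> \<exists>A\<in>sets M. measure M A \<le> \<kappa> \<and>
     (\<forall>\<omega>\<in>space M - A. X \<omega> \<in> J1_nbhd (sample_path m (X \<omega>)) T \<epsilon>)"

text \<open>\<open>fdd\<close> is convergence of the grid values, tested on bounded Lipschitz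
  functions. In \<open>tight\<close> the mesh comes before \<open>n\<close>: for every sufficiently
  fine fixed mesh the sampling error is controlled for all large \<open>n\<close>.\<close>

locale discretised_convergence = M: prob_space M + N: prob_space N
  for M :: "'a measure" and N :: "'c measure" +
  fixes X :: "nat \<Rightarrow> 'a \<Rightarrow> real \<Rightarrow> 'b::{metric_space, second_countable_topology}" and Y :: "'c \<Rightarrow> real \<Rightarrow> 'b"
  assumes X: "\<And>n \<omega>. \<omega> \<in> space M \<Longrightarrow> X n \<omega> \<in> cadlag_paths"
      "\<And>n t. t \<ge> 0 \<Longrightarrow> (\<lambda>\<omega>. X n \<omega> t) \<in> borel_measurable M"
    and Y: "\<And>\<omega>. \<omega> \<in> space N \<Longrightarrow> Y \<omega> \<in> cadlag_paths"
      "\<And>t. t \<ge> 0 \<Longrightarrow> (\<lambda>\<omega>. Y \<omega> t) \<in> borel_measurable N"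
    and fdd: "\<And>m G L. m > 0 \<Longrightarrow> (\<And>v. 0 \<le> G v \<and> G v \<le> 1) \<Longrightarrow>
      (\<And>v w. \<bar>G v - G w\<bar> \<le> L * (\<Sum>k\<le>m * m. dist (v k) (w k))) \<Longrightarrow>
      (\<lambda>n. \<integral>\<omega>. G (\<lambda>k. X n \<omega> (real k / real m)) \<partial>M) \<longlonglongrightarrow> (\<integral>\<omega>. G (\<lambda>k. Y \<omega> (real k / real m)) \<partial>N)"
    and tight: "\<And>T \<epsilon> \<kappa>. T > 0 \<Longrightarrow> \<epsilon> > 0 \<Longrightarrow> \<kappa> > 0 \<Longrightarrow>
      \<forall>\<^sub>F m in sequentially. \<forall>\<^sub>F n in sequentially. well_sampled M (X n) m T \<epsilon> \<kappa>"
begin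

text \<open>Fatou's lemma, applied to each liminf in turn, finds \<open>j\<close> and
  \<open>m\<close> for which the regularised functional of the sampled \<open>Y\<close> still
  exceeds \<open>c\<close> in mean. That functional passes to the limit in \<open>n\<close>, and it
  is below \<open>f (X n \<omega>)\<close> outside the exceptional event.\<close>

lemma eventually_expectation_greater_01:
  assumes f: "\<And>x. x \<in> cadlag_paths \<Longrightarrow> 0 \<le> f x \<and> f x \<le> 1" "J1_lsc f"
    and c: "c < (\<integral>\<omega>. f (Y \<omega>) \<partial>N)"
  shows "\<forall>\<^sub>F n in sequentially. c < (\<integral>\<omega>. f (X n \<omega>) \<partial>M)"
proof -
  define g where "g = (\<lambda>j m x. lower_reg (Suc j) f (sample_path m x))"
  have g01: "0 \<le> g j m x \<and> g j m x \<le> 1" for j m x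
    unfolding g_def using lower_reg_01[where f = f, OF f(1) sample_path_cadlag] by auto
  have [measurable]: "(\<lambda>\<omega>. g j m (Y \<omega>)) \<in> borel_measurable N" "(\<lambda>\<omega>. g j m (X n \<omega>)) \<in> borel_measurable M"
     for j m n
    unfolding g_def by (rule borel_measurable_lower_reg_sample; use f X Y in auto)+
  have [measurable]: "(\<lambda>\<omega>. f (Y \<omega>)) \<in> borel_measurable N" "(\<lambda>\<omega>. f (X n \<omega>)) \<in> borel_measurable M" for n
    by (rule borel_measurable_J1_lsc; use f X Y in auto)+
  have intg: "integrable N (\<lambda>\<omega>. g j m (Y \<omega>))" "integrable M (\<lambda>\<omega>. g j m (X n \<omega>))" for j m n
    using g01 by (auto intro!: N.integrable_const_bound[where B = 1] M.integrable_const_bound[where B = 1])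
  have intf: "integrable N (\<lambda>\<omega>. f (Y \<omega>))" "integrable M (\<lambda>\<omega>. f (X n \<omega>))" for n
    using f(1) X(1) Y(1)
    by (auto intro!: N.integrable_const_bound[where B = 1] M.integrable_const_bound[where B = 1] AE_I2)
  show ?thesis
  proof (cases "c < 0")
    case True
    have "0 \<le> (\<integral>\<omega>. f (X n \<omega>) \<partial>M)" for n using f(1) X(1) by (intro integral_nonneg_AE AE_I2) auto
    then show ?thesis using True by (auto intro!: always_eventually less_le_trans[of c 0])
  next
    case False
    \<comment> \<open>The midpoint leaves a margin, half of which pays for the exceptional
      event.\<close>
    define c' where "c' = (c + (\<integral>\<omega>. f (Y \<omega>) \<partial>N)) / 2"
    have c': "c < c'" "c' < (\<integral>\<omega>. f (Y \<omega>) \<partial>N)" "0 \<le> c'" using c False by (auto simp: c'_def)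
    have "ennreal c' < (\<integral>\<^sup>+\<omega>. ennreal (f (Y \<omega>)) \<partial>N)"
      using c' f(1) Y(1) intf by (subst nn_integral_eq_integral) (auto simp: ennreal_less_iff)
    also have "\<dots> = (\<integral>\<^sup>+\<omega>. liminf (\<lambda>j. liminf (\<lambda>m. ennreal (g j m (Y \<omega>)))) \<partial>N)"
      using lower_reg_sample_liminf[where f = f, OF f Y(1)]
      by (intro nn_integral_cong) (simp add: g_def)
    also have "\<dots> \<le> liminf (\<lambda>j. \<integral>\<^sup>+\<omega>. liminf (\<lambda>m. ennreal (g j m (Y \<omega>))) \<partial>N)"
      by (rule nn_integral_liminf) measurable
    also have "\<dots> \<le> liminf (\<lambda>j. liminf (\<lambda>m. \<integral>\<^sup>+\<omega>. ennreal (g j m (Y \<omega>)) \<partial>N))"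
      by (intro Liminf_mono always_eventually allI nn_integral_liminf) measurable
    also have "\<dots> = liminf (\<lambda>j. liminf (\<lambda>m. ennreal (\<integral>\<omega>. g j m (Y \<omega>) \<partial>N)))"
      using intg g01 by (subst nn_integral_eq_integral) auto
    finally have "\<forall>\<^sub>F j in sequentially. ennreal c' < liminf (\<lambda>m. ennreal (\<integral>\<omega>. g j m (Y \<omega>) \<partial>N))"
      by (rule less_LiminfD)
    then obtain j where "ennreal c' < liminf (\<lambda>m. ennreal (\<integral>\<omega>. g j m (Y \<omega>) \<partial>N))"
      by (auto dest!: eventually_happens)
    then have "\<forall>\<^sub>F m in sequentially. ennreal c' < ennreal (\<integral>\<omega>. g j m (Y \<omega>) \<partial>N)"
      by (rule less_LiminfD)
    moreover have "\<forall>\<^sub>F m in sequentially. \<forall>\<^sub>F n in sequentially. well_sampled M (X n) m (real (Suc j)) (1 / real (Suc j)) ((c' - c) / 2)"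
      using c' by (intro tight) auto
    moreover have "\<forall>\<^sub>F m::nat in sequentially. 0 < m" by (rule eventually_gt_at_top)
    ultimately have "\<forall>\<^sub>F m in sequentially. ennreal c' < ennreal (\<integral>\<omega>. g j m (Y \<omega>) \<partial>N) \<and> 0 < m \<and>
       (\<forall>\<^sub>F n in sequentially. well_sampled M (X n) m (real (Suc j)) (1 / real (Suc j)) ((c' - c) / 2))"
      by eventually_elim blast
    then have "\<exists>m. ennreal c' < ennreal (\<integral>\<omega>. g j m (Y \<omega>) \<partial>N) \<and> 0 < m \<and>
       (\<forall>\<^sub>F n in sequentially. well_sampled M (X n) m (real (Suc j)) (1 / real (Suc j)) ((c' - c) / 2))"
      by (rule eventually_happens'[OF sequentially_bot])
    then obtain m where m: "ennreal c' < ennreal (\<integral>\<omega>. g j m (Y \<omega>) \<partial>N)" "0 < m"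
      and A: "\<forall>\<^sub>F n in sequentially. well_sampled M (X n) m (real (Suc j)) (1 / real (Suc j)) ((c' - c) / 2)"
      by blast
    have gm: "c' < (\<integral>\<omega>. g j m (Y \<omega>) \<partial>N)" using m(1) c' by (simp add: ennreal_less_iff)
    have "(\<lambda>n. \<integral>\<omega>. g j m (X n \<omega>) \<partial>M) \<longlonglongrightarrow> (\<integral>\<omega>. g j m (Y \<omega>) \<partial>N)"
      unfolding g_def sample_path_def
    proof (rule fdd[OF m(2)])
      show "0 \<le> lower_reg (Suc j) f (grid_path m v) \<and> lower_reg (Suc j) f (grid_path m v) \<le> 1" for v
        using lower_reg_01[where f = f, OF f(1) grid_path_cadlag] by auto
      show "\<bar>lower_reg (Suc j) f (grid_path m v) - lower_reg (Suc j) f (grid_path m w)\<bar>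
          \<le> real (Suc j) * (\<Sum>k\<le>m * m. dist (v k) (w k))" for v w
        by (rule lower_reg_grid_lipschitz) (use f in auto)
    qed
    then have "\<forall>\<^sub>F n in sequentially. c' < (\<integral>\<omega>. g j m (X n \<omega>) \<partial>M)"
      using gm by (rule order_tendstoD(1))
    with A show ?thesis
    proof eventually_elim
      case (elim n)
      then obtain A where A: "A \<in> sets M" "measure M A \<le> (c' - c) / 2"
        and near: "\<And>\<omega>. \<omega> \<in> space M - A \<Longrightarrow> X n \<omega> \<in> J1_nbhd (sample_path m (X n \<omega>)) (real (Suc j)) (1 / real (Suc j))"
        by blast
      \<comment> \<open>Off \<open>A\<close> the path itself competes, at cost 0, in the infimum
        taken at its sampled path; on \<open>A\<close> the bound by 1 suffices.\<close>
      have "g j m (X n \<omega>) \<le> f (X n \<omega>) + indicator A \<omega>" if \<omega>: "\<omega> \<in> space M" for \<omega>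
      proof (cases "\<omega> \<in> A")
        case True
        then show ?thesis using f(1)[OF X(1)[OF \<omega>, of n]] g01[of j m "X n \<omega>"] by auto
      next
        case False
        then show ?thesis
          using lower_reg_le[where f = f, OF f(1) sample_path_cadlag near, of \<omega>] \<omega> by (simp add: g_def)
      qed
      then have "(\<integral>\<omega>. g j m (X n \<omega>) \<partial>M) \<le> (\<integral>\<omega>. f (X n \<omega>) + indicator A \<omega> \<partial>M)"
        using A intg intf by (intro integral_mono) (auto simp: M.emeasure_finite less_top[symmetric])
      also have "\<dots> = (\<integral>\<omega>. f (X n \<omega>) \<partial>M) + measure M A"
        using A intf by (subst Bochner_Integration.integral_add) (auto simp: M.emeasure_finite less_top[symmetric])
      finally have "(\<integral>\<omega>. g j m (X n \<omega>) \<partial>M) \<le> (\<integral>\<omega>. f (X n \<omega>) \<partial>M) + measure M A" .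
      then have "c' < (\<integral>\<omega>. f (X n \<omega>) \<partial>M) + (c' - c) / 2"
        using A(2) elim(2) by (smt (verit))
      then show "c < (\<integral>\<omega>. f (X n \<omega>) \<partial>M)" using c'(1) by (simp add: field_simps)
    qed
  qed
qed

lemma eventually_expectation_greater:
  assumes f: "continuous_map skorohod_J1 euclideanreal f" "bounded (f ` topspace skorohod_J1)"
    and c: "c < (\<integral>\<omega>. f (Y \<omega>) \<partial>N)"
  shows "\<forall>\<^sub>F n in sequentially. c < (\<integral>\<omega>. f (X n \<omega>) \<partial>M)"
proof -
  obtain K where K: "K > 0" "\<And>x. x \<in> cadlag_paths \<Longrightarrow> \<bar>f x\<bar> \<le> K"
    using f(2) unfolding bounded_pos by auto
  define h where "h = (\<lambda>x. (f x + K) / (2 * K))"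
  have h01: "0 \<le> h x \<and> h x \<le> 1" if "x \<in> cadlag_paths" for x
    using K(2)[OF that] K(1) by (auto simp: h_def field_simps abs_le_iff)
  have "continuous_map skorohod_J1 euclideanreal h"
    unfolding h_def by (intro continuous_intros f) (use K in auto)
  then have lsc: "J1_lsc h" by (rule continuous_imp_J1_lsc)
  have f_h: "f = (\<lambda>x. 2 * K * h x - K)" using K(1) by (auto simp: h_def field_simps)
  have [measurable]: "(\<lambda>\<omega>. h (Y \<omega>)) \<in> borel_measurable N" "(\<lambda>\<omega>. h (X n \<omega>)) \<in> borel_measurable M" for n
    by (rule borel_measurable_J1_lsc; use h01 lsc X Y in auto)+
  have inth: "integrable N (\<lambda>\<omega>. h (Y \<omega>))" "integrable M (\<lambda>\<omega>. h (X n \<omega>))" for n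
    using h01 X(1) Y(1)
    by (auto intro!: N.integrable_const_bound[where B = 1] M.integrable_const_bound[where B = 1] AE_I2)
  have IY: "(\<integral>\<omega>. f (Y \<omega>) \<partial>N) = 2 * K * (\<integral>\<omega>. h (Y \<omega>) \<partial>N) - K"
    unfolding f_h using inth by (simp add: N.prob_space)
  have IX: "(\<integral>\<omega>. f (X n \<omega>) \<partial>M) = 2 * K * (\<integral>\<omega>. h (X n \<omega>) \<partial>M) - K" for n
    unfolding f_h using inth by (simp add: M.prob_space)
  have "(c + K) / (2 * K) < (\<integral>\<omega>. h (Y \<omega>) \<partial>N)"
    using c K(1) unfolding IY by (simp add: field_simps)
  have "\<forall>\<^sub>F n in sequentially. (c + K) / (2 * K) < (\<integral>\<omega>. h (X n \<omega>) \<partial>M)"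
    by (rule eventually_expectation_greater_01[OF _ lsc \<open>(c + K) / (2 * K) < (\<integral>\<omega>. h (Y \<omega>) \<partial>N)\<close>]) (rule h01)
  then show ?thesis
    by eventually_elim (use K(1) in \<open>auto simp: IX field_simps\<close>)
qed

text \<open>Both halves of the limit come from the lower bound, the second one applied to
  \<open>-f\<close>.\<close>

theorem converges_in_law_skorohod_J1: "converges_in_law skorohod_J1 M X N Y"
  unfolding converges_in_law_def
proof (intro conjI allI impI)
  show "X n \<in> M \<rightarrow>\<^sub>M borel_of skorohod_J1" for n by (rule measurable_skorohod_J1) (use X in auto)
  show "Y \<in> N \<rightarrow>\<^sub>M borel_of skorohod_J1" by (rule measurable_skorohod_J1) (use Y in auto)
  fix f :: "(real \<Rightarrow> 'b) \<Rightarrow> real"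
  assume f: "continuous_map skorohod_J1 euclideanreal f \<and> bounded (f ` topspace skorohod_J1)"
  show "(\<lambda>n. \<integral>\<omega>. f (X n \<omega>) \<partial>M) \<longlonglongrightarrow> (\<integral>\<omega>. f (Y \<omega>) \<partial>N)"
  proof (rule order_tendstoI)
    show "\<forall>\<^sub>F n in sequentially. c < (\<integral>\<omega>. f (X n \<omega>) \<partial>M)" if "c < (\<integral>\<omega>. f (Y \<omega>) \<partial>N)" for c
      using eventually_expectation_greater f that by blast
    show "\<forall>\<^sub>F n in sequentially. (\<integral>\<omega>. f (X n \<omega>) \<partial>M) < c" if c: "(\<integral>\<omega>. f (Y \<omega>) \<partial>N) < c" for c
    proof -
      have "bounded ((\<lambda>x. - f x) ` topspace skorohod_J1)"
        using f bounded_uminus[of "f ` topspace skorohod_J1"] by (simp add: image_image)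
      then have "\<forall>\<^sub>F n in sequentially. - c < (\<integral>\<omega>. - f (X n \<omega>) \<partial>M)"
        using f c by (intro eventually_expectation_greater continuous_map_minus) auto
      then show ?thesis by simp
    qed
  qed
qed

end

section \<open>Gaussian smoothing and the multivariate continuity theorem\<close>

text \<open>The substitution \<theta> = \<sigma> z turns this into the characteristic function of
  the standard normal law at \<sigma> u.\<close>

lemma fourier_normal_density:
  assumes \<sigma>: "\<sigma> > 0"
  shows "(\<integral>\<theta>. complex_of_real (normal_density 0 \<sigma> \<theta>) * iexp (u * \<theta>) \<partial>lborel) =
    complex_of_real (exp (- (\<sigma> * u)\<^sup>2 / 2))"
proof -
  have nd: "normal_density 0 \<sigma> (\<sigma> * z) = std_normal_density z / \<sigma>" for z
    using \<sigma> by (simp add: normal_density_def real_sqrt_mult power_mult_distrib field_simps)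
  have "(\<integral>\<theta>. complex_of_real (normal_density 0 \<sigma> \<theta>) * iexp (u * \<theta>) \<partial>lborel) =
      \<bar>\<sigma>\<bar> *\<^sub>R (\<integral>z. complex_of_real (normal_density 0 \<sigma> (0 + \<sigma> * z)) * iexp (u * (0 + \<sigma> * z)) \<partial>lborel)"
    by (rule lborel_integral_real_affine) (use \<sigma> in simp)
  also have "\<dots> = (\<integral>z. \<bar>\<sigma>\<bar> *\<^sub>R (complex_of_real (normal_density 0 \<sigma> (\<sigma> * z)) * iexp (u * (\<sigma> * z))) \<partial>lborel)"
    by simp
  also have "\<dots> = (\<integral>z. std_normal_density z *\<^sub>R iexp ((\<sigma> * u) * z) \<partial>lborel)"
    using \<sigma> by (intro Bochner_Integration.integral_cong refl)
      (simp add: nd[unfolded mult.commute[of \<sigma>]] scaleR_conv_of_real ac_simps)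
  also have "\<dots> = char std_normal_distribution (\<sigma> * u)"
    unfolding char_def by (subst integral_density) (auto simp: normal_density_nonneg)
  finally show ?thesis by (simp add: char_std_normal_distribution)
qed

lemma integrable_norm_eq:
  fixes f :: "'a \<Rightarrow> 'b::{banach, second_countable_topology}"
  assumes "integrable M g" "f \<in> borel_measurable M" "\<And>x. x \<in> space M \<Longrightarrow> norm (f x) \<le> g x"
  shows "integrable M f"
  by (rule Bochner_Integration.integrable_bound[OF assms(1,2)])
    (use assms(3) in \<open>force intro: AE_I2 order_trans\<close>)

section \<open>Gaussian kernels on a finite product of lines\<close>

locale gaussian_kernel =
  fixes I :: "'i::countable set" and s :: real
  assumes fin: "finite I" and s: "s > 0"
begin

abbreviation P :: "('i \<Rightarrow> real) measure" where "P \<equiv> PiM I (\<lambda>_. lborel)"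

definition K :: "('i \<Rightarrow> real) \<Rightarrow> ('i \<Rightarrow> real) \<Rightarrow> real" where
  "K x y = (\<Prod>i\<in>I. normal_density (x i) s (y i))"

text \<open>The Fourier dual of \<open>K\<close>: a narrow kernel in space corresponds to a wide one
  in frequency, hence the standard deviation 1/s.\<close>

definition g :: "('i \<Rightarrow> real) \<Rightarrow> real" where
  "g \<theta> = (\<Prod>i\<in>I. normal_density 0 (1 / s) (\<theta> i))"

sublocale product_sigma_finite "\<lambda>_::'i. lborel :: real measure" by standard
sublocale P: finite_product_sigma_finite "\<lambda>_::'i. lborel :: real measure" I by standard (rule fin)

lemma K_nonneg: "0 \<le> K x y" and g_nonneg: "0 \<le> g y"
  unfolding K_def g_def by (auto intro!: prod_nonneg)

lemma measurable_coord [measurable]: "i \<in> I \<Longrightarrow> (\<lambda>y. y i) \<in> borel_measurable P"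
  using measurable_component_singleton[of i I "\<lambda>_. lborel :: real measure"] by simp

lemma K_integrable: "integrable P (K x)" and K_integral: "(\<integral>y. K x y \<partial>P) = 1"
proof -
  show "integrable P (K x)" unfolding K_def using s fin by (auto intro!: product_integrable_prod)
  show "(\<integral>y. K x y \<partial>P) = 1"
    unfolding K_def by (subst product_integral_prod) (use s fin in auto)
qed

lemma g_integrable: "integrable P g"
  unfolding g_def using s fin by (auto intro!: product_integrable_prod)

lemma K_measurable [measurable]: "K x \<in> borel_measurable P"
  using K_integrable by (rule borel_measurable_integrable)

lemma g_measurable [measurable]: "g \<in> borel_measurable P"
  using g_integrable by (rule borel_measurable_integrable)

text \<open>Absorbing the factor into the i-th marginal keeps the integrand a product; s * sqrt (2 /
  pi) is the mean absolute value of a centred normal variable of variance s^2.\<close>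

lemma K_first_moment:
  assumes i: "i \<in> I"
  shows "integrable P (\<lambda>y. K x y * \<bar>y i - x i\<bar>)" "(\<integral>y. K x y * \<bar>y i - x i\<bar> \<partial>P) = s * sqrt (2 / pi)"
proof -
  define h where "h = (\<lambda>j u. normal_density (x j) s u * (if j = i then \<bar>u - x j\<bar> else 1))"
  have eq: "(\<lambda>y. K x y * \<bar>y i - x i\<bar>) = (\<lambda>y. \<Prod>j\<in>I. h j (y j))"
    using i fin by (auto simp: h_def K_def prod.distrib prod.delta)
  have h: "integrable lborel (h j)" for j
    using integrable_normal_moment_abs[OF s, of "x j" 1] s by (cases "j = i") (simp_all add: h_def)
  have hi: "integral\<^sup>L lborel (h j) = (if j = i then s * sqrt (2 / pi) else 1)" for j
    using integral_normal_moment_abs_odd[OF s, of "x j" 0] s by (cases "j = i") (simp_all add: h_def)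
  show "integrable P (\<lambda>y. K x y * \<bar>y i - x i\<bar>)"
    unfolding eq by (rule product_integrable_prod[OF fin h])
  show "(\<integral>y. K x y * \<bar>y i - x i\<bar> \<partial>P) = s * sqrt (2 / pi)"
    unfolding eq using i fin by (subst product_integral_prod[OF fin h]) (simp_all add: hi prod.delta)
qed

text \<open>Per coordinate, the value at its mean of the normal density with standard deviation
  \<open>s\<close>.\<close>

definition C :: real where "C = (1 / sqrt (2 * pi * s\<^sup>2)) ^ card I"

text \<open>Gaussian Fourier inversion, one coordinate at a time: the transform of a factor of
  \<open>g\<close> is exp (- (x - y)^2 / (2 s^2)), which lacks only the normalising factor collected
  in \<open>C\<close>.\<close>

lemma K_fourier:
  "complex_of_real (K x y) =
     C * (\<integral>\<theta>. complex_of_real (g \<theta>) * iexp (\<Sum>i\<in>I. \<theta> i * (x i - y i)) \<partial>P)"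
proof -
  have "complex_of_real (g \<theta>) * iexp (\<Sum>i\<in>I. \<theta> i * (x i - y i)) =
      (\<Prod>i\<in>I. complex_of_real (normal_density 0 (1 / s) (\<theta> i)) * iexp ((x i - y i) * \<theta> i))" for \<theta>
    using fin by (simp add: g_def prod.distrib exp_sum sum_distrib_left ac_simps)
  then have "(\<integral>\<theta>. complex_of_real (g \<theta>) * iexp (\<Sum>i\<in>I. \<theta> i * (x i - y i)) \<partial>P) =
      (\<integral>\<theta>. (\<Prod>i\<in>I. complex_of_real (normal_density 0 (1 / s) (\<theta> i)) * iexp ((x i - y i) * \<theta> i)) \<partial>P)"
    by simp
  also have "\<dots> = (\<Prod>i\<in>I. (\<integral>t. complex_of_real (normal_density 0 (1 / s) t) * iexp ((x i - y i) * t) \<partial>lborel))"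
    by (rule product_integral_prod[OF fin, where f =
          "\<lambda>i t. complex_of_real (normal_density 0 (1 / s) t) * iexp ((x i - y i) * t)"],
        rule integrable_norm_eq[where g = "normal_density 0 (1 / s)"])
      (use s in \<open>auto simp: norm_mult\<close>)
  also have "\<dots> = (\<Prod>i\<in>I. complex_of_real (exp (- (1 / s * (x i - y i))\<^sup>2 / 2)))"
    using s by (intro prod.cong refl fourier_normal_density) simp
  also have "C * \<dots> = (\<Prod>i\<in>I. complex_of_real (1 / sqrt (2 * pi * s\<^sup>2)) *
      complex_of_real (exp (- (1 / s * (x i - y i))\<^sup>2 / 2)))"
    by (simp only: prod.distrib prod_constant C_def of_real_power)
  also have "\<dots> = (\<Prod>i\<in>I. complex_of_real (normal_density (x i) s (y i)))"
    by (intro prod.cong refl)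
      (simp add: normal_density_def power2_commute[of "x _"] power_divide mult.commute flip: of_real_mult)
  finally show ?thesis by (simp add: K_def)
qed

end

locale gaussian_smoothing = gaussian_kernel I s + M: prob_space M
  for I :: "'i::countable set" and s :: real and M :: "'a measure" +
  fixes \<xi> :: "'i \<Rightarrow> 'a \<Rightarrow> real"
  assumes \<xi>: "\<And>i. i \<in> I \<Longrightarrow> \<xi> i \<in> borel_measurable M"
begin

text \<open>The density of \<xi> plus an independent centred Gaussian vector with variance s^2 in
  each coordinate.\<close>

definition p :: "('i \<Rightarrow> real) \<Rightarrow> real" where "p y = (\<integral>\<omega>. K (\<lambda>i. \<xi> i \<omega>) y \<partial>M)"

sublocale MP: pair_sigma_finite M P ..

lemma K_pair_measurable [measurable]: "(\<lambda>(\<omega>, y). K (\<lambda>i. \<xi> i \<omega>) y) \<in> borel_measurable (M \<Otimes>\<^sub>M P)"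
  using \<xi> unfolding K_def normal_density_def split_beta by measurable

lemma K_pair_integrable: "integrable (M \<Otimes>\<^sub>M P) (\<lambda>(\<omega>, y). K (\<lambda>i. \<xi> i \<omega>) y)"
  by (rule MP.Fubini_integrable[OF K_pair_measurable])
    (auto simp: K_nonneg K_integrable K_integral)

lemma p_nonneg: "0 \<le> p y"
  unfolding p_def by (intro integral_nonneg_AE AE_I2 K_nonneg)

lemma p_integrable: "integrable P p"
  using MP.integrable_snd[OF K_pair_integrable] by (simp add: p_def[abs_def])

lemma p_integral: "(\<integral>y. p y \<partial>P) = 1"
  using MP.Fubini_integral[OF K_pair_integrable] by (simp add: p_def K_integral M.prob_space)

lemma smoothed_expectation:
  assumes F [measurable]: "F \<in> borel_measurable P" and b: "\<And>y. \<bar>F y\<bar> \<le> 1"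
  shows "(\<integral>\<omega>. (\<integral>y. F y * K (\<lambda>i. \<xi> i \<omega>) y \<partial>P) \<partial>M) = (\<integral>y. F y * p y \<partial>P)"
    and "integrable M (\<lambda>\<omega>. \<integral>y. F y * K (\<lambda>i. \<xi> i \<omega>) y \<partial>P)"
proof -
  have int: "integrable (M \<Otimes>\<^sub>M P) (\<lambda>(\<omega>, y). F y * K (\<lambda>i. \<xi> i \<omega>) y)"
    by (rule integrable_norm_eq[OF K_pair_integrable])
      (use b in \<open>auto simp: abs_mult K_nonneg split_beta intro!: mult_left_le_one_le\<close>)
  show "(\<integral>\<omega>. (\<integral>y. F y * K (\<lambda>i. \<xi> i \<omega>) y \<partial>P) \<partial>M) = (\<integral>y. F y * p y \<partial>P)"
    using MP.Fubini_integral[OF int] by (simp add: p_def)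
  show "integrable M (\<lambda>\<omega>. \<integral>y. F y * K (\<lambda>i. \<xi> i \<omega>) y \<partial>P)"
    using MP.integrable_fst[OF int] by simp
qed

text \<open>The law of \<xi> enters through its characteristic function alone, weighted by the
  integrable \<open>g\<close>; pointwise convergence of characteristic functions therefore gives
  pointwise convergence of the densities by domination.\<close>

lemma p_fourier:
  "complex_of_real (p y) = C * (\<integral>\<theta>. complex_of_real (g \<theta>) * iexp (- (\<Sum>i\<in>I. \<theta> i * y i)) *
     (\<integral>\<omega>. iexp (\<Sum>i\<in>I. \<theta> i * \<xi> i \<omega>) \<partial>M) \<partial>P)"
proof -
  let ?h = "\<lambda>\<omega> \<theta>. complex_of_real (g \<theta>) * iexp (\<Sum>i\<in>I. \<theta> i * (\<xi> i \<omega> - y i))"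
  let ?f = "\<lambda>(\<omega>, \<theta>). ?h \<omega> \<theta>"
  have meas: "?f \<in> borel_measurable (M \<Otimes>\<^sub>M P)"
    using \<xi> unfolding split_beta by measurable
  have int: "integrable (M \<Otimes>\<^sub>M P) ?f"
    by (rule MP.Fubini_integrable[OF meas])
      (auto simp: norm_mult g_nonneg intro!: integrable_norm_eq[OF g_integrable])
  have "complex_of_real (p y) = (\<integral>\<omega>. complex_of_real (K (\<lambda>i. \<xi> i \<omega>) y) \<partial>M)"
    by (simp add: p_def)
  also have "\<dots> = C * (\<integral>\<omega>. (\<integral>\<theta>. ?h \<omega> \<theta> \<partial>P) \<partial>M)"
    by (simp add: K_fourier)
  also have "(\<integral>\<omega>. (\<integral>\<theta>. ?h \<omega> \<theta> \<partial>P) \<partial>M) =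
     (\<integral>\<theta>. (\<integral>\<omega>. ?h \<omega> \<theta> \<partial>M) \<partial>P)"
    using MP.Fubini_integral[OF int] by simp
  also have "(\<lambda>\<theta>. \<integral>\<omega>. ?h \<omega> \<theta> \<partial>M) =
     (\<lambda>\<theta>. \<integral>\<omega>. (complex_of_real (g \<theta>) * iexp (- (\<Sum>i\<in>I. \<theta> i * y i))) * iexp (\<Sum>i\<in>I. \<theta> i * \<xi> i \<omega>) \<partial>M)"
    by (simp add: exp_add[symmetric] right_diff_distrib sum_subtractf mult.assoc ring_distribs add.commute)
  also have "\<dots> = (\<lambda>\<theta>. complex_of_real (g \<theta>) * iexp (- (\<Sum>i\<in>I. \<theta> i * y i)) * (\<integral>\<omega>. iexp (\<Sum>i\<in>I. \<theta> i * \<xi> i \<omega>) \<partial>M))"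
    by (simp only: integral_mult_right_zero)
  finally show ?thesis .
qed

text \<open>Gaussian noise of standard deviation \<open>s\<close> moves each coordinate by s * sqrt
  (2 / pi) on average, and \<open>F\<close> reacts with factor \<open>L\<close>.\<close>

lemma smoothing_error:
  assumes F: "\<And>v w. \<bar>F v - F w\<bar> \<le> L * (\<Sum>i\<in>I. dist (v i) (w i))" and b: "\<And>y. \<bar>F y\<bar> \<le> 1"
  shows "\<bar>(\<integral>\<omega>. F (\<lambda>i. \<xi> i \<omega>) \<partial>M) - (\<integral>y. F y * p y \<partial>P)\<bar> \<le> L * (real (card I) * (s * sqrt (2 / pi)))"
proof -
  have FP [measurable]: "F \<in> borel_measurable P"
    using borel_measurable_lipschitz_functional[OF fin F, of "\<lambda>i y. y i" P] by simp
  have FM [measurable]: "(\<lambda>\<omega>. F (\<lambda>i. \<xi> i \<omega>)) \<in> borel_measurable M"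
    by (rule borel_measurable_lipschitz_functional[OF fin F \<xi>])
  have intM: "integrable M (\<lambda>\<omega>. F (\<lambda>i. \<xi> i \<omega>))"
    using b by (intro M.integrable_const_bound[where B = 1]) auto
  have FK: "integrable P (\<lambda>y. F y * K x y)" for x
    by (rule integrable_norm_eq[OF K_integrable[of x]])
      (use b in \<open>auto simp: abs_mult K_nonneg intro!: mult_left_le_one_le\<close>)
  have *: "\<bar>F x - (\<integral>y. F y * K x y \<partial>P)\<bar> \<le> L * (real (card I) * (s * sqrt (2 / pi)))" for x
  proof -
    have "F x - (\<integral>y. F y * K x y \<partial>P) = (\<integral>y. F x * K x y \<partial>P) - (\<integral>y. F y * K x y \<partial>P)"
      by (simp add: K_integral)
    also have "\<dots> = (\<integral>y. (F x - F y) * K x y \<partial>P)"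
      using FK K_integrable by (simp add: left_diff_distrib)
    finally have "\<bar>F x - (\<integral>y. F y * K x y \<partial>P)\<bar> = \<bar>\<integral>y. (F x - F y) * K x y \<partial>P\<bar>" by simp
    also have "\<dots> \<le> (\<integral>y. \<bar>(F x - F y) * K x y\<bar> \<partial>P)" by (rule integral_abs_bound)
    also have "\<dots> \<le> (\<integral>y. L * (\<Sum>i\<in>I. K x y * \<bar>y i - x i\<bar>) \<partial>P)"
    proof (rule integral_mono)
      have "integrable P (\<lambda>y. (F x - F y) * K x y)"
        using FK K_integrable by (simp add: left_diff_distrib)
      then show "integrable P (\<lambda>y. \<bar>(F x - F y) * K x y\<bar>)" by simp
      show "integrable P (\<lambda>y. L * (\<Sum>i\<in>I. K x y * \<bar>y i - x i\<bar>))"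
        by (intro integrable_mult_right Bochner_Integration.integrable_sum K_first_moment)
      fix y
      have "\<bar>(F x - F y) * K x y\<bar> \<le> L * (\<Sum>i\<in>I. dist (x i) (y i)) * K x y"
        using F[of x y] K_nonneg[of x y] by (simp add: abs_mult mult_right_mono)
      also have "\<dots> = L * (\<Sum>i\<in>I. K x y * \<bar>y i - x i\<bar>)"
        by (simp add: dist_real_def sum_distrib_left sum_distrib_right abs_minus_commute ac_simps)
      finally show "\<bar>(F x - F y) * K x y\<bar> \<le> L * (\<Sum>i\<in>I. K x y * \<bar>y i - x i\<bar>)" .
    qed
    also have "\<dots> = L * (\<Sum>i\<in>I. (\<integral>y. K x y * \<bar>y i - x i\<bar> \<partial>P))"
      by (simp add: Bochner_Integration.integral_sum K_first_moment(1))
    also have "\<dots> = L * (real (card I) * (s * sqrt (2 / pi)))" by (simp add: K_first_moment(2))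
    finally show ?thesis .
  qed
  have "\<bar>(\<integral>\<omega>. F (\<lambda>i. \<xi> i \<omega>) \<partial>M) - (\<integral>y. F y * p y \<partial>P)\<bar> =
      \<bar>\<integral>\<omega>. F (\<lambda>i. \<xi> i \<omega>) - (\<integral>y. F y * K (\<lambda>i. \<xi> i \<omega>) y \<partial>P) \<partial>M\<bar>"
    using smoothed_expectation[OF FP b] intM by simp
  also have "\<dots> \<le> (\<integral>\<omega>. \<bar>F (\<lambda>i. \<xi> i \<omega>) - (\<integral>y. F y * K (\<lambda>i. \<xi> i \<omega>) y \<partial>P)\<bar> \<partial>M)"
    by (rule integral_abs_bound)
  also have "\<dots> \<le> (\<integral>\<omega>. L * (real (card I) * (s * sqrt (2 / pi))) \<partial>M)"
    using smoothed_expectation(2)[OF FP b] intM * by (intro integral_mono) auto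
  also have "\<dots> = L * (real (card I) * (s * sqrt (2 / pi)))" by (simp add: M.prob_space)
  finally show ?thesis .
qed

end

text \<open>The Gaussian-smoothed densities converge pointwise by the Fourier representation, hence in
  \<open>L\<^sup>1\<close> by Scheffe's lemma; the smoothing error is uniform.\<close>

theorem levy_continuity_lipschitz:
  fixes I :: "'i::countable set" and \<xi> :: "nat \<Rightarrow> 'i \<Rightarrow> 'a \<Rightarrow> real" and \<xi>' :: "'i \<Rightarrow> 'c \<Rightarrow> real"
  assumes "prob_space M" "prob_space N" and I: "finite I"
    and \<xi>: "\<And>n i. i \<in> I \<Longrightarrow> \<xi> n i \<in> borel_measurable M"
    and \<xi>': "\<And>i. i \<in> I \<Longrightarrow> \<xi>' i \<in> borel_measurable N"
    and cf: "\<And>\<theta>. (\<lambda>n. \<integral>\<omega>. iexp (\<Sum>i\<in>I. \<theta> i * \<xi> n i \<omega>) \<partial>M) \<longlonglongrightarrow> (\<integral>\<omega>. iexp (\<Sum>i\<in>I. \<theta> i * \<xi>' i \<omega>) \<partial>N)"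
    and F: "\<And>v w. \<bar>F v - F w\<bar> \<le> L * (\<Sum>i\<in>I. dist (v i) (w i))" and b: "\<And>y. \<bar>F y\<bar> \<le> 1"
  shows "(\<lambda>n. \<integral>\<omega>. F (\<lambda>i. \<xi> n i \<omega>) \<partial>M) \<longlonglongrightarrow> (\<integral>\<omega>. F (\<lambda>i. \<xi>' i \<omega>) \<partial>N)"
proof (rule LIMSEQ_I)
  fix r :: real assume r: "r > 0"
  \<comment> \<open>A smoothing error is at most D * s, so the choice of \<open>s\<close> makes each
    of the two errors at most r / 3; the added 1 guards against D = 0.\<close>
  define D where "D = \<bar>L\<bar> * (real (card I) * sqrt (2 / pi))"
  define s where "s = r / (3 * (D + 1))"
  have D: "D \<ge> 0" by (simp add: D_def)
  then have s: "s > 0" "D * s \<le> r / 3" using r by (auto simp: s_def field_simps)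
  interpret M: prob_space M by fact
  interpret N: prob_space N by fact
  interpret G: gaussian_kernel I s by standard (use I s in auto)
  interpret X: gaussian_smoothing I s M "\<xi> n" for n by standard (rule \<xi>)
  interpret Y: gaussian_smoothing I s N \<xi>' by standard (rule \<xi>')
  have err: "L * (real (card I) * (s * sqrt (2 / pi))) \<le> r / 3"
  proof -
    have "L * (real (card I) * (s * sqrt (2 / pi))) \<le> \<bar>L\<bar> * (real (card I) * (s * sqrt (2 / pi)))"
      using s by (intro mult_right_mono) auto
    also have "\<dots> = D * s" by (simp add: D_def)
    finally show ?thesis using s(2) by linarith
  qed
  have FP [measurable]: "F \<in> borel_measurable G.P"
    using borel_measurable_lipschitz_functional[OF I F, of "\<lambda>i y. y i" G.P] by simp
  have lim: "(\<lambda>n. X.p n y) \<longlonglongrightarrow> Y.p y" for y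
  proof -
    let ?g = "\<lambda>\<theta>. complex_of_real (G.g \<theta>) * iexp (- (\<Sum>i\<in>I. \<theta> i * y i))"
    let ?X = "\<lambda>n \<theta>. \<integral>\<omega>. iexp (\<Sum>i\<in>I. \<theta> i * \<xi> n i \<omega>) \<partial>M"
      and ?Y = "\<lambda>\<theta>. \<integral>\<omega>. iexp (\<Sum>i\<in>I. \<theta> i * \<xi>' i \<omega>) \<partial>N"
    have "(\<lambda>n. \<integral>\<theta>. ?g \<theta> * ?X n \<theta> \<partial>G.P) \<longlonglongrightarrow>
          (\<integral>\<theta>. ?g \<theta> * ?Y \<theta> \<partial>G.P)"
    proof (rule integral_dominated_convergence[where w = G.g])
      have [measurable]: "(\<lambda>(\<theta>, \<omega>). iexp (\<Sum>i\<in>I. \<theta> i * \<xi> n i \<omega>)) \<in> borel_measurable (G.P \<Otimes>\<^sub>M M)" for n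
        using \<xi> unfolding split_beta by measurable
      have [measurable]: "(\<lambda>(\<theta>, \<omega>). iexp (\<Sum>i\<in>I. \<theta> i * \<xi>' i \<omega>)) \<in> borel_measurable (G.P \<Otimes>\<^sub>M N)"
        using \<xi>' unfolding split_beta by measurable
      have [measurable]: "?X n \<in> borel_measurable G.P" for n
        by (rule M.borel_measurable_lebesgue_integral) measurable
      have [measurable]: "?Y \<in> borel_measurable G.P"
        by (rule N.borel_measurable_lebesgue_integral) measurable
      show "(\<lambda>\<theta>. ?g \<theta> * ?Y \<theta>) \<in> borel_measurable G.P" by measurable
      show "(\<lambda>\<theta>. ?g \<theta> * ?X n \<theta>) \<in> borel_measurable G.P" for n by measurable
      show "integrable G.P G.g" by (rule G.g_integrable)
      show "AE \<theta> in G.P. (\<lambda>n. ?g \<theta> * ?X n \<theta>) \<longlonglongrightarrow>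
             ?g \<theta> * ?Y \<theta>"
        by (intro AE_I2 tendsto_mult_left cf)
      have "norm (?X n \<theta>) \<le> 1" for \<theta> n
      proof -
        have "norm (?X n \<theta>) \<le> (\<integral>\<omega>. norm (iexp (\<Sum>i\<in>I. \<theta> i * \<xi> n i \<omega>)) \<partial>M)"
          by (rule integral_norm_bound)
        then show ?thesis by (simp add: M.prob_space)
      qed
      then show "AE \<theta> in G.P. norm (?g \<theta> * ?X n \<theta>) \<le> G.g \<theta>" for n
        by (intro AE_I2) (auto simp: norm_mult G.g_nonneg intro!: mult_left_le)
    qed
    then have "(\<lambda>n. complex_of_real (X.p n y)) \<longlonglongrightarrow> complex_of_real (Y.p y)"
      unfolding X.p_fourier Y.p_fourier by (rule tendsto_mult_left)
    then show ?thesis by (simp only: tendsto_of_real_iff)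
  qed
  have "(\<lambda>n. \<integral>\<^sup>+y. ennreal (norm (X.p n y - Y.p y)) \<partial>G.P) \<longlonglongrightarrow> 0"
  proof (rule Scheffe_lemma1)
    show "integrable G.P (X.p n)" for n by (rule X.p_integrable)
    show "integrable G.P Y.p" by (rule Y.p_integrable)
    show "AE y in G.P. (\<lambda>n. X.p n y) \<longlonglongrightarrow> Y.p y" using lim by simp
    have "(\<integral>\<^sup>+y. ennreal (norm (X.p n y)) \<partial>G.P) = 1" for n
      using X.p_integrable[of n] X.p_integral[of n] X.p_nonneg by (simp add: nn_integral_eq_integral)
    moreover have "(\<integral>\<^sup>+y. ennreal (norm (Y.p y)) \<partial>G.P) = 1"
      using Y.p_integrable Y.p_integral Y.p_nonneg by (simp add: nn_integral_eq_integral)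
    ultimately show "limsup (\<lambda>n. \<integral>\<^sup>+y. ennreal (norm (X.p n y)) \<partial>G.P) \<le> (\<integral>\<^sup>+y. ennreal (norm (Y.p y)) \<partial>G.P)"
      by (simp add: Limsup_const)
  qed
  moreover have "(\<integral>\<^sup>+y. ennreal (norm (X.p n y - Y.p y)) \<partial>G.P) = ennreal (\<integral>y. \<bar>X.p n y - Y.p y\<bar> \<partial>G.P)" for n
    using X.p_integrable[of n] Y.p_integrable by (subst nn_integral_eq_integral) auto
  ultimately have "(\<lambda>n. \<integral>y. \<bar>X.p n y - Y.p y\<bar> \<partial>G.P) \<longlonglongrightarrow> 0"
    using tendsto_ennreal_iff[of "\<lambda>n. \<integral>y. \<bar>X.p n y - Y.p y\<bar> \<partial>G.P" sequentially 0]
    by (simp add: integral_nonneg_AE)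
  then have "\<forall>\<^sub>F n in sequentially. (\<integral>y. \<bar>X.p n y - Y.p y\<bar> \<partial>G.P) < r / 3"
    using r by (intro order_tendstoD(2)) auto
  then obtain n0 where n0: "\<And>n. n \<ge> n0 \<Longrightarrow> (\<integral>y. \<bar>X.p n y - Y.p y\<bar> \<partial>G.P) < r / 3"
    unfolding eventually_sequentially by blast
  have "norm ((\<integral>\<omega>. F (\<lambda>i. \<xi> n i \<omega>) \<partial>M) - (\<integral>\<omega>. F (\<lambda>i. \<xi>' i \<omega>) \<partial>N)) < r" if n: "n \<ge> n0" for n
  proof -
    have Fp: "integrable G.P (\<lambda>y. F y * X.p n y)" "integrable G.P (\<lambda>y. F y * Y.p y)"
      by (rule integrable_norm_eq[OF X.p_integrable[of n]] integrable_norm_eq[OF Y.p_integrable];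
          use b X.p_integrable[of n] Y.p_integrable X.p_nonneg[of n] Y.p_nonneg in
          \<open>auto simp: abs_mult intro!: mult_left_le_one_le\<close>)+
    have "\<bar>(\<integral>y. F y * X.p n y \<partial>G.P) - (\<integral>y. F y * Y.p y \<partial>G.P)\<bar> = \<bar>\<integral>y. F y * (X.p n y - Y.p y) \<partial>G.P\<bar>"
      using Fp by (simp add: right_diff_distrib)
    also have "\<dots> \<le> (\<integral>y. \<bar>F y * (X.p n y - Y.p y)\<bar> \<partial>G.P)" by (rule integral_abs_bound)
    also have "\<dots> \<le> (\<integral>y. \<bar>X.p n y - Y.p y\<bar> \<partial>G.P)"
    proof (rule integral_mono)
      have "integrable G.P (\<lambda>y. F y * (X.p n y - Y.p y))" using Fp by (simp add: right_diff_distrib)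
      then show "integrable G.P (\<lambda>y. \<bar>F y * (X.p n y - Y.p y)\<bar>)" by simp
      show "integrable G.P (\<lambda>y. \<bar>X.p n y - Y.p y\<bar>)" using X.p_integrable[of n] Y.p_integrable by simp
      show "\<bar>F y * (X.p n y - Y.p y)\<bar> \<le> \<bar>X.p n y - Y.p y\<bar>" for y
        using b[of y] by (auto simp: abs_mult intro!: mult_left_le_one_le)
    qed
    finally have "\<bar>(\<integral>y. F y * X.p n y \<partial>G.P) - (\<integral>y. F y * Y.p y \<partial>G.P)\<bar> < r / 3"
      using n0[OF n] by simp
    with X.smoothing_error[where F = F, OF F b, of n] Y.smoothing_error[where F = F, OF F b] err
    show ?thesis by (simp only: real_norm_def)
  qed
  then show "\<exists>n0. \<forall>n\<ge>n0. norm ((\<integral>\<omega>. F (\<lambda>i. \<xi> n i \<omega>) \<partial>M) - (\<integral>\<omega>. F (\<lambda>i. \<xi>' i \<omega>) \<partial>N)) < r"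
    by blast
qed

section \<open>Freezing an independent discrete variable\<close>

text \<open>Fubini for the law of the pair \<open>(v (Y \<omega>), X \<omega>)\<close>, a product by
  independence. Discreteness of the first component makes \<open>g\<close> jointly measurable as
  soon as each \<open>g k\<close> is measurable.\<close>

lemma indep_elements_expectation:
  fixes g :: "'v::countable \<Rightarrow> 'x \<Rightarrow> 'e::{banach, second_countable_topology}"
  assumes M: "prob_space M" and ind: "indep_elements M A X B Y"
    and v: "v \<in> B \<rightarrow>\<^sub>M count_space UNIV"
    and g: "\<And>k. g k \<in> borel_measurable A" "\<And>k x. norm (g k x) \<le> c"
  shows "(\<integral>\<omega>. g (v (Y \<omega>)) (X \<omega>) \<partial>M) = (\<integral>\<omega>. (\<integral>\<omega>'. g (v (Y \<omega>)) (X \<omega>') \<partial>M) \<partial>M)"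
proof -
  interpret prob_space M by fact
  have X [measurable]: "X \<in> M \<rightarrow>\<^sub>M A" and Y [measurable]: "Y \<in> M \<rightarrow>\<^sub>M B"
    and inds: "indep_set (sets (vimage_algebra (space M) X A)) (sets (vimage_algebra (space M) Y B))"
    using ind by (auto simp: indep_elements_def)
  note v [measurable] g(1) [measurable]
  define V where "V = (\<lambda>\<omega>. v (Y \<omega>))"
  have V [measurable]: "V \<in> M \<rightarrow>\<^sub>M count_space UNIV" unfolding V_def by measurable
  let ?DV = "distr M (count_space UNIV) V" and ?DX = "distr M A X"
  interpret DV: prob_space ?DV by (rule prob_space_distr) measurable
  interpret DX: prob_space ?DX by (rule prob_space_distr) measurable
  interpret pair_sigma_finite ?DV ?DX ..
  have "?DV \<Otimes>\<^sub>M ?DX = distr M (count_space UNIV \<Otimes>\<^sub>M A) (\<lambda>\<omega>. (V \<omega>, X \<omega>))"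
  proof (rule pair_measure_eqI)
    fix E F assume E: "E \<in> sets ?DV" and F: "F \<in> sets ?DX"
    have FA [measurable]: "F \<in> sets A" using F by simp
    have "X -` F \<inter> space M \<in> sets (vimage_algebra (space M) X A)"
      by (rule in_vimage_algebra) simp
    moreover have "V -` E \<inter> space M = Y -` (v -` E \<inter> space B) \<inter> space M"
      using measurable_space[OF Y] by (auto simp: V_def)
    then have "V -` E \<inter> space M \<in> sets (vimage_algebra (space M) Y B)"
      using measurable_sets[OF v, of E] by (simp only: in_vimage_algebra sets_count_space Pow_UNIV UNIV_I)
    ultimately have "prob ((X -` F \<inter> space M) \<inter> (V -` E \<inter> space M)) =
        prob (X -` F \<inter> space M) * prob (V -` E \<inter> space M)"
      by (rule indep_setD[OF inds])
    moreover have "(\<lambda>\<omega>. (V \<omega>, X \<omega>)) -` (E \<times> F) \<inter> space M = (X -` F \<inter> space M) \<inter> (V -` E \<inter> space M)"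
      by auto
    moreover have "E \<times> F \<in> sets (count_space UNIV \<Otimes>\<^sub>M A)" by auto
    ultimately show "emeasure ?DV E * emeasure ?DX F =
        emeasure (distr M (count_space UNIV \<Otimes>\<^sub>M A) (\<lambda>\<omega>. (V \<omega>, X \<omega>))) (E \<times> F)"
      by (simp add: emeasure_distr emeasure_eq_measure ennreal_mult'[symmetric] mult.commute)
  next
    show "sets (?DV \<Otimes>\<^sub>M ?DX) = sets (distr M (count_space UNIV \<Otimes>\<^sub>M A) (\<lambda>\<omega>. (V \<omega>, X \<omega>)))"
      unfolding sets_distr by (rule sets_pair_measure_cong) simp_all
  qed (rule DV.sigma_finite_measure_axioms DX.sigma_finite_measure_axioms)+
  note D = this
  have gm [measurable]: "(\<lambda>(k, x). g k x) \<in> borel_measurable (count_space UNIV \<Otimes>\<^sub>M A)"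
    by (rule measurable_pair_measure_countable1) auto
  have "(\<integral>\<omega>. g (V \<omega>) (X \<omega>) \<partial>M) = (\<integral>z. (\<lambda>(k, x). g k x) z \<partial>(?DV \<Otimes>\<^sub>M ?DX))"
    unfolding D by (subst integral_distr) (auto simp: gm)
  also have "\<dots> = (\<integral>k. (\<integral>x. g k x \<partial>?DX) \<partial>?DV)"
  proof -
    interpret P: prob_space "?DV \<Otimes>\<^sub>M ?DX" unfolding D by (rule prob_space_distr) measurable
    have "(\<lambda>(k, x). g k x) \<in> borel_measurable (?DV \<Otimes>\<^sub>M ?DX)"
      using gm by (simp cong: measurable_cong_sets add: D)
    then have "integrable (?DV \<Otimes>\<^sub>M ?DX) (\<lambda>(k, x). g k x)"
      by (intro P.integrable_const_bound[where B = c]) (auto simp: g)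
    from integral_fst'[OF this] show ?thesis by simp
  qed
  also have "\<dots> = (\<integral>\<omega>. (\<integral>\<omega>'. g (V \<omega>) (X \<omega>') \<partial>M) \<partial>M)"
    by (subst integral_distr) (auto simp: integral_distr)
  finally show ?thesis by (simp add: V_def)
qed

section \<open>Rearranging sums and products by consecutive blocks\<close>

definition block :: "(nat \<Rightarrow> nat) \<Rightarrow> nat \<Rightarrow> nat" where
  "block p i = (LEAST l. i < p (Suc l))"

lemma block_eq:
  assumes "mono p" "p l \<le> i" "i < p (Suc l)"
  shows "block p i = l"
  unfolding block_def
proof (rule Least_equality)
  fix y assume "i < p (Suc y)"
  then show "l \<le> y"
    using assms(2) monoD[OF assms(1), of "Suc y" l] by (cases "l \<le> y") auto
qed fact

text \<open>It turns sums over increments between the times \<open>p l\<close> into sums over single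
  steps, each carrying the weight of its block. Blocks may be empty, as \<open>p\<close> is only
  monotone.\<close>

lemma sum_blocks:
  fixes f :: "nat \<Rightarrow> nat \<Rightarrow> 'b::comm_monoid_add"
  assumes "mono p" "p 0 = 0"
  shows "(\<Sum>i<p n. f (block p i) i) = (\<Sum>l<n. \<Sum>i\<in>{p l..<p (Suc l)}. f l i)"
proof (induction n)
  case (Suc n)
  have "{..<p (Suc n)} = {..<p n} \<union> {p n..<p (Suc n)}"
    using monoD[OF assms(1), of n "Suc n"] by auto
  then have "(\<Sum>i<p (Suc n). f (block p i) i) =
      (\<Sum>i<p n. f (block p i) i) + (\<Sum>i\<in>{p n..<p (Suc n)}. f (block p i) i)"
    by (simp add: sum.union_disjoint ivl_disj_int)
  also have "(\<Sum>i\<in>{p n..<p (Suc n)}. f (block p i) i) = (\<Sum>i\<in>{p n..<p (Suc n)}. f n i)"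
    using block_eq[OF assms(1)] by (intro sum.cong) auto
  finally show ?case using Suc by simp
qed (use assms in simp)

lemma prod_blocks:
  fixes f :: "nat \<Rightarrow> nat \<Rightarrow> 'b::comm_monoid_mult"
  assumes "mono p" "p 0 = 0"
  shows "(\<Prod>i<p n. f (block p i) i) = (\<Prod>l<n. \<Prod>i\<in>{p l..<p (Suc l)}. f l i)"
proof (induction n)
  case (Suc n)
  have "{..<p (Suc n)} = {..<p n} \<union> {p n..<p (Suc n)}"
    using monoD[OF assms(1), of n "Suc n"] by auto
  then have "(\<Prod>i<p (Suc n). f (block p i) i) =
      (\<Prod>i<p n. f (block p i) i) * (\<Prod>i\<in>{p n..<p (Suc n)}. f (block p i) i)"
    by (simp add: prod.union_disjoint ivl_disj_int)
  also have "(\<Prod>i\<in>{p n..<p (Suc n)}. f (block p i) i) = (\<Prod>i\<in>{p n..<p (Suc n)}. f n i)"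
    using block_eq[OF assms(1)] by (intro prod.cong) auto
  finally show ?case using Suc by simp
qed (use assms in simp)

section \<open>The simple random walk\<close>

definition rvec :: "int ^ 'd \<Rightarrow> real ^ 'd" where "rvec x = (\<chi> i. real_of_int (x $ i))"

lemma rvec_diff: "rvec (x - y) = rvec x - rvec y"
  and rvec_0 [simp]: "rvec 0 = 0"
  and rvec_axis: "rvec (axis i c) = axis i (real_of_int c)"
  by (auto simp: rvec_def vec_eq_iff axis_def)

lemma borel_measurable_vec_nth [measurable]: "(\<lambda>v::real ^ 'd. v $ i) \<in> borel_measurable borel"
  by (intro borel_measurable_continuous_onI continuous_intros)

text \<open>Real valued because opposite steps are equally likely, so that real powers of
  \<open>1 - \<phi> u\<close> make sense.\<close>

definition \<phi> :: "real ^ 'd \<Rightarrow> real" where "\<phi> u = (\<Sum>i\<in>UNIV. cos (u $ i)) / real CARD('d)"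

text \<open>The exponent of the Brownian motion with covariance (t/d) I, and the limit of (1 -
  \<phi> (c u)) / c^2 as c tends to 0.\<close>

abbreviation \<psi> :: "real ^ 'd \<Rightarrow> real" where "\<psi> u \<equiv> (norm u)\<^sup>2 / (2 * real CARD('d))"

lemma finite_lattice_neighbours: "finite (lattice_neighbours :: (int ^ 'd) set)"
  by (simp add: lattice_neighbours_def)

lemma sum_lattice_neighbours:
  fixes f :: "int ^ 'd \<Rightarrow> 'b::comm_monoid_add"
  shows "sum f lattice_neighbours = (\<Sum>i\<in>UNIV. f (axis i 1) + f (axis i (- 1)))"
proof -
  have "sum f (\<Union>i\<in>UNIV. {axis i 1, axis i (- 1)}) = (\<Sum>i\<in>UNIV. sum f {axis i 1, axis i (- 1)})"
    by (rule sum.UNION_disjoint) (auto simp: axis_eq_axis)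
  then show ?thesis by (simp add: lattice_neighbours_def axis_eq_axis)
qed

lemma card_lattice_neighbours: "card (lattice_neighbours :: (int ^ 'd) set) = 2 * CARD('d)"
  using sum_lattice_neighbours[of "\<lambda>_::int ^ 'd. 1::nat"] by simp

lemma lattice_neighbours_nonempty: "lattice_neighbours \<noteq> {}"
  by (simp add: lattice_neighbours_def)

context simple_random_walk
begin

abbreviation "step \<equiv> (\<lambda>n \<omega>. S (Suc n) \<omega> - S n \<omega>)"

lemma measurable_step [measurable]: "step n \<in> M \<rightarrow>\<^sub>M count_space UNIV"
  using indep_steps by (auto simp: indep_vars_def)

lemma measurable_rvec_step [measurable]: "(\<lambda>\<omega>. rvec (step n \<omega>)) \<in> borel_measurable M"
  by (rule measurable_compose[OF measurable_step]) simp

lemma expectation_step: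
  fixes f :: "int ^ 'd \<Rightarrow> 'b::{banach, second_countable_topology}"
  shows "(\<integral>\<omega>. f (step n \<omega>) \<partial>M) = (1 / (2 * real CARD('d))) *\<^sub>R (\<Sum>i\<in>UNIV. f (axis i 1) + f (axis i (- 1)))"
proof -
  have "(\<integral>\<omega>. f (step n \<omega>) \<partial>M) = (\<integral>x. f x \<partial>distr M (count_space UNIV) (step n))"
    by (subst integral_distr) auto
  also have "\<dots> = (\<Sum>x\<in>lattice_neighbours. pmf (pmf_of_set lattice_neighbours) x *\<^sub>R f x)"
    unfolding distr_steps
    by (intro integral_measure_pmf) (simp_all add: finite_lattice_neighbours lattice_neighbours_nonempty)
  also have "\<dots> = (\<Sum>x\<in>lattice_neighbours. (1 / (2 * real CARD('d))) *\<^sub>R f x)"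
    by (intro sum.cong refl)
      (simp add: card_lattice_neighbours finite_lattice_neighbours lattice_neighbours_nonempty)
  finally show "(\<integral>\<omega>. f (step n \<omega>) \<partial>M) = (1 / (2 * real CARD('d))) *\<^sub>R (\<Sum>i\<in>UNIV. f (axis i 1) + f (axis i (- 1)))"
    by (simp add: scaleR_sum_right[symmetric] sum_lattice_neighbours)
qed

lemma AE_norm_step: "AE \<omega> in M. norm (rvec (step n \<omega>)) = 1"
proof -
  have "AE x in distr M (count_space UNIV) (step n). norm (rvec x) = 1"
    unfolding distr_steps AE_measure_pmf_iff
      set_pmf_of_set[OF lattice_neighbours_nonempty finite_lattice_neighbours]
    by (auto simp: lattice_neighbours_def rvec_axis norm_eq_sqrt_inner inner_axis_axis)
  then show ?thesis by (subst (asm) AE_distr_iff) auto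
qed

lemma expectation_step_component: "(\<integral>\<omega>. rvec (step n \<omega>) $ i \<partial>M) = 0"
  by (subst expectation_step[of "\<lambda>x. rvec x $ i"]) (auto simp: rvec_def axis_def intro!: sum.neutral)

lemma step_cf: "(\<integral>\<omega>. iexp (u \<bullet> rvec (step n \<omega>)) \<partial>M) = complex_of_real (\<phi> u)"
proof -
  have "iexp (u \<bullet> axis i 1) + iexp (u \<bullet> axis i (- 1)) = 2 * complex_of_real (cos (u $ i))" for i :: 'd
    by (simp add: inner_axis cos_of_real[symmetric] cos_exp_eq)
  then show ?thesis
    by (subst expectation_step[of "\<lambda>x. iexp (u \<bullet> rvec x)"])
      (simp add: rvec_axis \<phi>_def scaleR_conv_of_real sum_distrib_left[symmetric] field_simps)
qed

lemma rvec_walk_block: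
  assumes "mono p"
  shows "rvec (S (p (Suc l)) \<omega>) - rvec (S (p l) \<omega>) = (\<Sum>i\<in>{p l..<p (Suc l)}. rvec (step i \<omega>))"
proof -
  have "(\<Sum>i\<in>{p l..<p (Suc l)}. rvec (step i \<omega>)) =
      (\<Sum>i\<in>{p l..<p (Suc l)}. rvec (S (Suc i) \<omega>) - rvec (S i \<omega>))"
    by (simp add: rvec_diff)
  also have "\<dots> = rvec (S (p (Suc l)) \<omega>) - rvec (S (p l) \<omega>)"
    using monoD[OF assms, of l "Suc l"] by (intro sum_Suc_diff'[of _ _ "\<lambda>i. rvec (S i \<omega>)"]) simp
  finally show ?thesis ..
qed

text \<open>Every step in block \<open>l\<close> carries the frequency \<open>w l\<close>, and
  independence of the steps factorises the expectation.\<close>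

lemma walk_cf:
  assumes p: "mono p" "p 0 = 0"
  shows "(\<integral>\<omega>. iexp (\<Sum>l<n. w l \<bullet> (rvec (S (p (Suc l)) \<omega>) - rvec (S (p l) \<omega>))) \<partial>M) =
    complex_of_real (\<Prod>l<n. \<phi> (w l) ^ (p (Suc l) - p l))"
proof -
  let ?w = "\<lambda>i. w (block p i)"
  have "(\<Sum>l<n. w l \<bullet> (rvec (S (p (Suc l)) \<omega>) - rvec (S (p l) \<omega>))) = (\<Sum>i<p n. ?w i \<bullet> rvec (step i \<omega>))" for \<omega>
    using sum_blocks[OF p, of "\<lambda>l i. w l \<bullet> rvec (step i \<omega>)" n]
    by (simp add: rvec_walk_block[OF p(1)] inner_sum_right)
  then have "(\<integral>\<omega>. iexp (\<Sum>l<n. w l \<bullet> (rvec (S (p (Suc l)) \<omega>) - rvec (S (p l) \<omega>))) \<partial>M) =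
      (\<integral>\<omega>. (\<Prod>i<p n. iexp (?w i \<bullet> rvec (step i \<omega>))) \<partial>M)"
    by (simp add: exp_sum sum_distrib_left)
  also have "\<dots> = (\<Prod>i<p n. (\<integral>\<omega>. iexp (?w i \<bullet> rvec (step i \<omega>)) \<partial>M))"
  proof (rule indep_vars_lebesgue_integral)
    show "indep_vars (\<lambda>_. borel) (\<lambda>i \<omega>. iexp (?w i \<bullet> rvec (step i \<omega>))) {..<p n}"
      by (rule indep_vars_compose2[OF indep_vars_subset[OF indep_steps], where Y = "\<lambda>i x. iexp (?w i \<bullet> rvec x)"]) auto
    show "integrable M (\<lambda>\<omega>. iexp (?w i \<bullet> rvec (step i \<omega>)))" for i
      by (intro integrable_const_bound[where B = 1]) auto
  qed simp
  also have "\<dots> = (\<Prod>i<p n. complex_of_real (\<phi> (?w i)))" by (simp only: step_cf)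
  also have "\<dots> = complex_of_real (\<Prod>l<n. \<phi> (w l) ^ (p (Suc l) - p l))"
    using prod_blocks[OF p, of "\<lambda>l _. complex_of_real (\<phi> (w l))" n] by simp
  finally show ?thesis .
qed

text \<open>Kolmogorov's inequality: \<open>z\<close> is the thinned walk stopped on leaving the ball of radius \<open>\<delta>\<close>.\<close>

lemma maximal_inequality:
  fixes c :: "nat \<Rightarrow> real"
  assumes c: "\<And>j. c j = 0 \<or> c j = 1" and \<delta>: "\<delta> > 0"
  shows "prob {\<omega>\<in>space M. \<exists>k\<le>n. \<delta> \<le> norm (\<Sum>j<k. c j *\<^sub>R rvec (step j \<omega>))} \<le> (\<Sum>j<n. c j) / \<delta>\<^sup>2"
proof -
  define Z where "Z = (\<lambda>k (x::nat \<Rightarrow> int ^ 'd). \<Sum>j<k. c j *\<^sub>R rvec (x j))"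
  \<comment> \<open>A predictable multiplier: it depends on the first \<open>k\<close> steps, and it
    vanishes once some partial sum up to time \<open>k\<close> has reached norm \<delta>. The
    product form makes its measurability evident.\<close>
  define q where "q = (\<lambda>k (x::nat \<Rightarrow> int ^ 'd). c k * (\<Prod>i\<le>k. if norm (Z i x) < \<delta> then 1 else 0))"
  define z where "z = (\<lambda>k (x::nat \<Rightarrow> int ^ 'd). \<Sum>j<k. q j x *\<^sub>R rvec (x j))"
  have q_eq: "q k x = (if \<forall>i\<le>k. norm (Z i x) < \<delta> then c k else 0)" for k x
    by (auto simp: q_def)
  have q01: "q k x = 0 \<or> q k x = 1" and qc: "q k x \<le> c k" for k x
    using c[of k] by (auto simp: q_eq)
  let ?X = "\<lambda>\<omega> j. step j \<omega>"
  have q2: "(q k x)\<^sup>2 = q k x" for k x using q01[of k x] by auto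
  have cong: "Z k x = Z k y" "q k x = q k y" "z k x = z k y"
    if "\<And>j. j < k \<Longrightarrow> x j = y j" for k x y
  proof -
    show Z: "Z k x = Z k y" unfolding Z_def using that by (intro sum.cong) auto
    have q: "q i x = q i y" if "i \<le> k" for i
    proof -
      have "Z l x = Z l y" if "l \<le> i" for l
        unfolding Z_def using \<open>i \<le> k\<close> \<open>l \<le> i\<close> \<open>\<And>j. j < k \<Longrightarrow> x j = y j\<close> by (intro sum.cong) auto
      then show ?thesis by (simp add: q_def)
    qed
    show "q k x = q k y" by (rule q) simp
    show "z k x = z k y" unfolding z_def using that q by (intro sum.cong) auto
  qed
  have meas: "Z k \<in> borel_measurable (PiM J (\<lambda>_. count_space UNIV))"
    "q k \<in> borel_measurable (PiM J (\<lambda>_. count_space UNIV))"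
    "z k \<in> borel_measurable (PiM J (\<lambda>_. count_space UNIV))" if J: "{..<k} \<subseteq> J" for k J
  proof -
    have comp: "(\<lambda>x::nat \<Rightarrow> int ^ 'd. rvec (x j)) \<in> borel_measurable (PiM J (\<lambda>_. count_space UNIV))" if "j < k" for j
    proof -
      have "(\<lambda>x. x j) \<in> PiM J (\<lambda>_. count_space UNIV) \<rightarrow>\<^sub>M count_space (UNIV :: (int ^ 'd) set)"
        by (rule measurable_component_singleton) (use J that in auto)
      from measurable_compose[OF this, of rvec borel] show ?thesis by simp
    qed
    have Zm [measurable]: "Z i \<in> borel_measurable (PiM J (\<lambda>_. count_space UNIV))" if "i \<le> k" for i
      unfolding Z_def using that
      by (intro borel_measurable_sum borel_measurable_scaleR borel_measurable_const comp) auto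
    have qm: "q i \<in> borel_measurable (PiM J (\<lambda>_. count_space UNIV))" if "i \<le> k" for i
      unfolding q_def
    proof (intro borel_measurable_times borel_measurable_const borel_measurable_prod)
      fix l assume "l \<in> {..i}"
      then have "l \<le> k" using that by simp
      from Zm[OF this] show "(\<lambda>x. if norm (Z l x) < \<delta> then 1 else 0 :: real) \<in>
          borel_measurable (PiM J (\<lambda>_. count_space UNIV))"
        by measurable
    qed
    show "Z k \<in> borel_measurable (PiM J (\<lambda>_. count_space UNIV))" by (rule Zm) simp
    show "q k \<in> borel_measurable (PiM J (\<lambda>_. count_space UNIV))" by (rule qm) simp
    show "z k \<in> borel_measurable (PiM J (\<lambda>_. count_space UNIV))"
      unfolding z_def by (intro borel_measurable_sum borel_measurable_scaleR comp qm) auto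
  qed
  have Xm: "?X \<in> M \<rightarrow>\<^sub>M PiM UNIV (\<lambda>_. count_space UNIV)"
    by (rule measurable_PiM_single') auto
  have [measurable]: "(\<lambda>\<omega>. Z k (?X \<omega>)) \<in> borel_measurable M"
    "(\<lambda>\<omega>. q k (?X \<omega>)) \<in> borel_measurable M" "(\<lambda>\<omega>. z k (?X \<omega>)) \<in> borel_measurable M" for k
    by (rule measurable_compose[OF Xm meas(1)] measurable_compose[OF Xm meas(2)]
        measurable_compose[OF Xm meas(3)]; simp)+
  have AE1: "AE \<omega> in M. \<forall>j. norm (rvec (step j \<omega>)) = 1"
    by (simp add: AE_all_countable AE_norm_step)
  have zb: "AE \<omega> in M. norm (z k (?X \<omega>)) \<le> real k" for k
    using AE1
  proof eventually_elim
    case (elim \<omega>)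
    have "norm (z k (?X \<omega>)) \<le> (\<Sum>j<k. norm (q j (?X \<omega>) *\<^sub>R rvec (step j \<omega>)))"
      unfolding z_def by (rule norm_sum)
    also have "\<dots> \<le> (\<Sum>j<k. 1)"
    proof (rule sum_mono)
      fix j show "norm (q j (?X \<omega>) *\<^sub>R rvec (step j \<omega>)) \<le> 1"
        using q01[of j "?X \<omega>"] elim by auto
    qed
    finally show ?case by simp
  qed
  have z2int: "integrable M (\<lambda>\<omega>. (norm (z k (?X \<omega>)))\<^sup>2)" for k
    by (rule integrable_const_bound[where B = "(real k)\<^sup>2"])
      (use zb[of k] in \<open>auto elim!: eventually_mono intro!: power_mono\<close>)
  \<comment> \<open>Orthogonality of martingale increments: the first factor depends on the steps
    before \<open>k\<close>, and step \<open>k\<close> is independent of them with mean zero. It is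
    checked by coordinates, where the product rule for independent real variables applies.\<close>
  have cross: "(\<integral>\<omega>. (q k (?X \<omega>) *\<^sub>R z k (?X \<omega>)) \<bullet> rvec (step k \<omega>) \<partial>M) = 0"
    and cross_int: "integrable M (\<lambda>\<omega>. (q k (?X \<omega>) *\<^sub>R z k (?X \<omega>)) \<bullet> rvec (step k \<omega>))" for k
  proof -
    let ?f = "\<lambda>i x. (q k x *\<^sub>R z k x) $ i"
    have ind: "indep_var (PiM {..<k} (\<lambda>_. count_space UNIV)) (\<lambda>\<omega>. restrict (\<lambda>i. step i \<omega>) {..<k})
        (PiM {k} (\<lambda>_. count_space UNIV)) (\<lambda>\<omega>. restrict (\<lambda>i. step i \<omega>) {k})"
      by (rule indep_var_restrict[OF indep_steps]) auto
    have prod: "(\<integral>\<omega>. ?f i (?X \<omega>) * rvec (step k \<omega>) $ i \<partial>M) = 0 \<and>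
        integrable M (\<lambda>\<omega>. ?f i (?X \<omega>) * rvec (step k \<omega>) $ i)" for i
    proof -
      have "(\<lambda>x. q k x *\<^sub>R z k x) \<in> borel_measurable (PiM {..<k} (\<lambda>_. count_space UNIV))"
        by (intro borel_measurable_scaleR meas subset_refl)
      from measurable_compose[OF this borel_measurable_vec_nth]
      have "?f i \<in> borel_measurable (PiM {..<k} (\<lambda>_. count_space UNIV))" .
      moreover have "(\<lambda>x. rvec (x k) $ i) \<in> borel_measurable (PiM {k} (\<lambda>_. count_space UNIV))"
        by (rule measurable_compose[OF measurable_component_singleton]) auto
      ultimately have "indep_var borel (?f i \<circ> (\<lambda>\<omega>. restrict (\<lambda>i. step i \<omega>) {..<k}))
          borel ((\<lambda>x. rvec (x k) $ i) \<circ> (\<lambda>\<omega>. restrict (\<lambda>i. step i \<omega>) {k}))"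
        by (rule indep_var_compose[OF ind])
      moreover have "?f i \<circ> (\<lambda>\<omega>. restrict (\<lambda>i. step i \<omega>) {..<k}) = (\<lambda>\<omega>. ?f i (?X \<omega>))"
        using cong(2)[of k "restrict (?X _) {..<k}" "?X _"] cong(3)[of k "restrict (?X _) {..<k}" "?X _"]
        by (auto simp: fun_eq_iff)
      moreover have "(\<lambda>x. rvec (x k) $ i) \<circ> (\<lambda>\<omega>. restrict (\<lambda>i. step i \<omega>) {k}) = (\<lambda>\<omega>. rvec (step k \<omega>) $ i)"
        by (auto simp: fun_eq_iff)
      ultimately have iv: "indep_var borel (\<lambda>\<omega>. ?f i (?X \<omega>)) borel (\<lambda>\<omega>. rvec (step k \<omega>) $ i)"
        by simp
      have int1: "integrable M (\<lambda>\<omega>. ?f i (?X \<omega>))"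
      proof (rule integrable_const_bound[where B = "real k"])
        show "AE \<omega> in M. norm (?f i (?X \<omega>)) \<le> real k"
          using zb[of k]
        proof eventually_elim
          case (elim \<omega>)
          then show ?case
            using q01[of k "?X \<omega>"] component_le_norm_cart[of "z k (?X \<omega>)" i] by auto
        qed
      qed measurable
      have int2: "integrable M (\<lambda>\<omega>. rvec (step k \<omega>) $ i)"
      proof (rule integrable_const_bound[where B = 1])
        show "AE \<omega> in M. norm (rvec (step k \<omega>) $ i) \<le> 1"
          using AE_norm_step[of k]
          by eventually_elim (use component_le_norm_cart in \<open>metis real_norm_def\<close>)
      qed measurable
      show ?thesis
        using indep_var_lebesgue_integral[OF iv int1 int2] indep_var_integrable[OF iv int1 int2]
        by (simp add: expectation_step_component)
    qed
    show "(\<integral>\<omega>. (q k (?X \<omega>) *\<^sub>R z k (?X \<omega>)) \<bullet> rvec (step k \<omega>) \<partial>M) = 0"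
      unfolding inner_vec_def inner_real_def
      using prod by (subst Bochner_Integration.integral_sum) auto
    show "integrable M (\<lambda>\<omega>. (q k (?X \<omega>) *\<^sub>R z k (?X \<omega>)) \<bullet> rvec (step k \<omega>))"
      unfolding inner_vec_def inner_real_def
      using prod by (intro Bochner_Integration.integrable_sum) auto
  qed
  \<comment> \<open>The cross term has mean zero, so each step adds at most \<open>c k\<close>, its
    norm being 1 almost surely.\<close>
  have Ez: "(\<integral>\<omega>. (norm (z k (?X \<omega>)))\<^sup>2 \<partial>M) \<le> (\<Sum>j<k. c j)" for k
  proof (induction k)
    case 0
    then show ?case by (simp add: z_def)
  next
    case (Suc k)
    have "(\<integral>\<omega>. (norm (z (Suc k) (?X \<omega>)))\<^sup>2 \<partial>M) \<le>
        (\<integral>\<omega>. ((norm (z k (?X \<omega>)))\<^sup>2 + 2 * ((q k (?X \<omega>) *\<^sub>R z k (?X \<omega>)) \<bullet> rvec (step k \<omega>))) + c k \<partial>M)"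
    proof (rule integral_mono_AE)
      show "AE \<omega> in M. (norm (z (Suc k) (?X \<omega>)))\<^sup>2 \<le>
        ((norm (z k (?X \<omega>)))\<^sup>2 + 2 * ((q k (?X \<omega>) *\<^sub>R z k (?X \<omega>)) \<bullet> rvec (step k \<omega>))) + c k"
        using AE_norm_step[of k]
      proof eventually_elim
        case (elim \<omega>)
        have "z (Suc k) (?X \<omega>) = z k (?X \<omega>) + q k (?X \<omega>) *\<^sub>R rvec (step k \<omega>)"
          by (simp add: z_def)
        then have "(norm (z (Suc k) (?X \<omega>)))\<^sup>2 = (norm (z k (?X \<omega>)))\<^sup>2 +
            2 * ((q k (?X \<omega>) *\<^sub>R z k (?X \<omega>)) \<bullet> rvec (step k \<omega>)) + (q k (?X \<omega>))\<^sup>2 * (norm (rvec (step k \<omega>)))\<^sup>2"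
          by (simp only: power2_norm_eq_inner)
            (simp add: inner_add_left inner_add_right inner_commute power2_eq_square[of "q k _"])
        then show ?case using elim qc[of k "?X \<omega>"] by (simp add: q2)
      qed
    qed (use z2int cross_int in auto)
    also have "\<dots> = (\<integral>\<omega>. (norm (z k (?X \<omega>)))\<^sup>2 \<partial>M) + c k"
      using z2int[of k] cross_int[of k] cross[of k] by (simp add: prob_space)
    finally show ?case using Suc by simp
  qed
  have "{\<omega>\<in>space M. \<exists>k\<le>n. \<delta> \<le> norm (\<Sum>j<k. c j *\<^sub>R rvec (step j \<omega>))} \<subseteq>
      {\<omega>\<in>space M. (norm (z n (?X \<omega>)))\<^sup>2 \<ge> \<delta>\<^sup>2}"
  proof safe
    fix \<omega> k assume \<omega>: "\<omega> \<in> space M" and k: "k \<le> n" "\<delta> \<le> norm (\<Sum>j<k. c j *\<^sub>R rvec (step j \<omega>))"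
    define x where "x = ?X \<omega>"
    \<comment> \<open>The first exit time. The multiplier is \<open>c j\<close> before it and 0 from
      then on, so \<open>z n\<close> equals \<open>Z m\<close> and is still outside the ball at time
      \<open>n\<close>.\<close>
    define m where "m = (LEAST k. \<delta> \<le> norm (Z k x))"
    have "\<delta> \<le> norm (Z k x)" using k by (simp add: Z_def x_def)
    then have m: "\<delta> \<le> norm (Z m x)" "m \<le> k"
      unfolding m_def by (rule LeastI, rule Least_le)
    have "norm (Z j x) < \<delta>" if "j < m" for j
      using not_less_Least[of j "\<lambda>k. \<delta> \<le> norm (Z k x)"] that by (simp add: m_def)
    then have qm: "q j x = (if j < m then c j else 0)" for j
      using m(1) unfolding q_eq by (auto simp: not_less)
    have "z n x = (\<Sum>j<n. (if j < m then c j *\<^sub>R rvec (x j) else 0))"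
      unfolding z_def by (intro sum.cong) (auto simp: qm)
    also have "\<dots> = Z m x"
      unfolding Z_def using m(2) k(1) by (subst sum.inter_filter[symmetric]) (auto intro!: sum.cong)
    finally have "\<delta>\<^sup>2 \<le> (norm (z n x))\<^sup>2" using m(1) \<delta> by (simp add: power_mono)
    then show "\<delta>\<^sup>2 \<le> (norm (z n (?X \<omega>)))\<^sup>2" by (simp add: x_def)
  qed
  then have "prob {\<omega>\<in>space M. \<exists>k\<le>n. \<delta> \<le> norm (\<Sum>j<k. c j *\<^sub>R rvec (step j \<omega>))} \<le>
      prob {\<omega>\<in>space M. (norm (z n (?X \<omega>)))\<^sup>2 \<ge> \<delta>\<^sup>2}"
    by (intro finite_measure_mono) auto
  also have "\<dots> \<le> (\<integral>\<omega>. (norm (z n (?X \<omega>)))\<^sup>2 \<partial>M) / \<delta>\<^sup>2"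
    by (rule integral_Markov_inequality_measure[where A = "{}"]) (use z2int \<delta> in auto)
  also have "\<dots> \<le> (\<Sum>j<n. c j) / \<delta>\<^sup>2"
    using Ez[of n] by (simp add: divide_right_mono)
  finally show ?thesis .
qed

end

section \<open>The discrete subordinator\<close>

lemma sum_diff_telescope_nat:
  fixes f :: "nat \<Rightarrow> nat"
  assumes "mono f" "a \<le> b"
  shows "(\<Sum>i\<in>{a..<b}. f (Suc i) - f i) = f b - f a"
  using assms(2)
proof (induction rule: dec_induct)
  case (step n)
  then show ?case using monoD[OF assms(1), of a n] monoD[OF assms(1), of n "Suc n"] by simp
qed simp

text \<open>Both sides are compared with 2 * u / (1 + u).\<close>

lemma min_one_le_exp:
  fixes u :: real
  assumes "u \<ge> 0"
  shows "min 1 u \<le> 2 * (1 - exp (- u))"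
proof -
  have "exp (- u) \<le> 1 / (1 + u)"
    using exp_ge_add_one_self[of u] assms by (simp add: exp_minus field_simps)
  moreover have "min 1 u \<le> 2 * (1 - 1 / (1 + u))"
    using assms mult_left_mono[of u 1 u] by (auto simp: min_def field_simps)
  moreover from calculation(1) have "2 * (1 - 1 / (1 + u)) \<le> 2 * (1 - exp (- u))" by simp
  ultimately show ?thesis by (blast intro: order_trans)
qed

context discrete_subordinator
begin

abbreviation "jump \<equiv> (\<lambda>n \<omega>. \<tau> (Suc n) \<omega> - \<tau> n \<omega>)"

lemma measurable_jump [measurable]: "jump n \<in> M \<rightarrow>\<^sub>M count_space UNIV"
  using indep_steps by (auto simp: indep_vars_def)

lemma borel_measurable_jump [measurable]: "(\<lambda>\<omega>. real (jump n \<omega>)) \<in> borel_measurable M"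
  by (rule measurable_compose[OF measurable_jump]) simp

lemma mono_tau: "\<omega> \<in> space M \<Longrightarrow> mono (\<lambda>n. \<tau> n \<omega>)"
  using pos_steps by (intro mono_iff_le_Suc[THEN iffD2]) (auto intro: less_imp_le)

lemma expectation_jump:
  fixes f :: "nat \<Rightarrow> 'b::{banach, second_countable_topology}"
  shows "(\<integral>\<omega>. f (jump n \<omega>) \<partial>M) = (\<integral>\<omega>. f (\<tau> 1 \<omega>) \<partial>M)"
proof -
  have "(\<integral>\<omega>. f (jump n \<omega>) \<partial>M) = (\<integral>x. f x \<partial>distr M (count_space UNIV) (jump n))"
    by (subst integral_distr) auto
  also have "\<dots> = (\<integral>\<omega>. f (\<tau> 1 \<omega> - \<tau> 0 \<omega>) \<partial>M)"
    unfolding distr_steps using measurable_jump[of 0] by (subst integral_distr) auto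
  also have "\<dots> = (\<integral>\<omega>. f (\<tau> 1 \<omega>) \<partial>M)"
    by (intro Bochner_Integration.integral_cong) (auto simp: start)
  finally show ?thesis .
qed

text \<open>The Laplace transform at - ln r, a nonnegative argument exactly for \<open>r\<close> in
  (0, 1].\<close>

lemma expectation_jump_power:
  assumes "0 < r" "r \<le> 1"
  shows "expectation (\<lambda>\<omega>. r ^ jump n \<omega>) = 1 - (1 - r) powr (\<alpha> / 2)"
proof -
  have "r ^ k = exp (- (- ln r) * real k)" for k
    using assms by (simp add: mult.commute[of "ln r"] exp_of_nat_mult)
  then have "expectation (\<lambda>\<omega>. r ^ jump n \<omega>) = expectation (\<lambda>\<omega>. exp (- (- ln r) * real (\<tau> 1 \<omega>)))"
    by (subst expectation_jump[of "\<lambda>k. r ^ k"]) simp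
  also have "\<dots> = (1 - (1 - exp (- (- ln r))) powr (\<alpha> / 2)) ^ 1"
    by (rule laplace) (use assms in simp)
  finally show ?thesis using assms by simp
qed

text \<open>The analogue of \<open>walk_cf\<close> for \<tau>: every jump in block \<open>l\<close>
  carries the base \<open>r l\<close>.\<close>

lemma subordinator_gf:
  assumes q: "mono q" "q 0 = 0" and r: "\<And>l. l < n \<Longrightarrow> 0 < r l \<and> r l \<le> 1"
  shows "expectation (\<lambda>\<omega>. \<Prod>l<n. r l ^ (\<tau> (q (Suc l)) \<omega> - \<tau> (q l) \<omega>)) =
    (\<Prod>l<n. (1 - (1 - r l) powr (\<alpha> / 2)) ^ (q (Suc l) - q l))"
proof -
  \<comment> \<open>Continued by 1, so that the bounds hold at every index.\<close>
  define r' where "r' = (\<lambda>l. if l < n then r l else 1)"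
  have r': "0 < r' l" "r' l \<le> 1" for l using r by (auto simp: r'_def)
  let ?r = "\<lambda>i. r' (block q i)"
  have "(\<Prod>l<n. r l ^ (\<tau> (q (Suc l)) \<omega> - \<tau> (q l) \<omega>)) = (\<Prod>i<q n. ?r i ^ jump i \<omega>)"
    if \<omega>: "\<omega> \<in> space M" for \<omega>
  proof -
    have "r l ^ (\<tau> (q (Suc l)) \<omega> - \<tau> (q l) \<omega>) = (\<Prod>i\<in>{q l..<q (Suc l)}. r' l ^ jump i \<omega>)"
      if "l < n" for l
      using sum_diff_telescope_nat[OF mono_tau[OF \<omega>], of "q l" "q (Suc l)"] monoD[OF q(1), of l "Suc l"] that
      by (simp add: r'_def power_sum[symmetric])
    then show ?thesis by (simp add: prod_blocks[OF q, of "\<lambda>l i. r' l ^ jump i \<omega>"])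
  qed
  then have "expectation (\<lambda>\<omega>. \<Prod>l<n. r l ^ (\<tau> (q (Suc l)) \<omega> - \<tau> (q l) \<omega>)) =
      expectation (\<lambda>\<omega>. \<Prod>i<q n. ?r i ^ jump i \<omega>)"
    by (intro Bochner_Integration.integral_cong) auto
  also have "\<dots> = (\<Prod>i<q n. expectation (\<lambda>\<omega>. ?r i ^ jump i \<omega>))"
  proof (rule indep_vars_lebesgue_integral)
    show "indep_vars (\<lambda>_. borel) (\<lambda>i \<omega>. ?r i ^ jump i \<omega>) {..<q n}"
      by (rule indep_vars_compose2[OF indep_vars_subset[OF indep_steps], where Y = "\<lambda>i k. ?r i ^ k"]) auto
    have [measurable]: "(\<lambda>\<omega>. ?r i ^ jump i \<omega>) \<in> borel_measurable M" for i
      by (rule measurable_compose[OF measurable_jump]) simp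
    show "integrable M (\<lambda>\<omega>. ?r i ^ jump i \<omega>)" for i
      using r'[of "block q i"] by (intro integrable_const_bound[where B = 1]) (auto simp: power_le_one less_imp_le)
  qed simp
  also have "\<dots> = (\<Prod>i<q n. 1 - (1 - ?r i) powr (\<alpha> / 2))"
    using r' by (intro prod.cong refl expectation_jump_power) auto
  also have "\<dots> = (\<Prod>l<n. (1 - (1 - r' l) powr (\<alpha> / 2)) ^ (q (Suc l) - q l))"
    by (subst prod_blocks[OF q, of "\<lambda>l _. 1 - (1 - r' l) powr (\<alpha> / 2)"]) simp
  also have "\<dots> = (\<Prod>l<n. (1 - (1 - r l) powr (\<alpha> / 2)) ^ (q (Suc l) - q l))"
    by (intro prod.cong) (auto simp: r'_def)
  finally show ?thesis .
qed

text \<open>By \<open>min_one_le_exp\<close> it suffices to estimate one minus the Laplace transform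
  at 1/x. This difference is (1 - exp (- 1/x))^(\<alpha>/2), and 1 - exp (- v) is at most v. The
  truncation matters because for \<alpha> < 2 the jumps have infinite mean.\<close>

lemma expectation_truncated_jump:
  assumes x: "x > 0" and \<alpha>: "\<alpha> > 0"
  shows "expectation (\<lambda>\<omega>. min 1 (real (jump n \<omega>) / x)) \<le> 2 * x powr (- (\<alpha> / 2))"
proof -
  have int: "integrable M (\<lambda>\<omega>. exp (- (1 / x) * real (jump n \<omega>)))"
    using x by (intro integrable_const_bound[where B = 1]) auto
  have "expectation (\<lambda>\<omega>. min 1 (real (jump n \<omega>) / x)) \<le>
      expectation (\<lambda>\<omega>. 2 * (1 - exp (- (1 / x) * real (jump n \<omega>))))"
  proof (rule integral_mono)
    show "integrable M (\<lambda>\<omega>. min 1 (real (jump n \<omega>) / x))"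
      using x by (intro integrable_const_bound[where B = 1]) auto
    show "integrable M (\<lambda>\<omega>. 2 * (1 - exp (- (1 / x) * real (jump n \<omega>))))" using int by simp
    show "min 1 (real (jump n \<omega>) / x) \<le> 2 * (1 - exp (- (1 / x) * real (jump n \<omega>)))" for \<omega>
      using min_one_le_exp[of "real (jump n \<omega>) / x"] x by simp
  qed
  also have "\<dots> = 2 * (1 - expectation (\<lambda>\<omega>. exp (- (1 / x) * real (jump n \<omega>))))"
    using int by (simp add: prob_space)
  also have "expectation (\<lambda>\<omega>. exp (- (1 / x) * real (jump n \<omega>))) =
      (1 - (1 - exp (- (1 / x))) powr (\<alpha> / 2)) ^ 1"
    using laplace[of "1 / x" 1] x by (subst expectation_jump[of "\<lambda>k. exp (- (1 / x) * real k)"]) simp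
  also have "2 * (1 - \<dots>) = 2 * (1 - exp (- (1 / x))) powr (\<alpha> / 2)" by simp
  also have "\<dots> \<le> 2 * (1 / x) powr (\<alpha> / 2)"
    using exp_ge_add_one_self[of "- (1 / x)"] x \<alpha> by (intro mult_left_mono powr_mono2) auto
  also have "\<dots> = 2 * x powr (- (\<alpha> / 2))"
    using x by (simp add: powr_minus powr_divide field_simps)
  finally show ?thesis .
qed

lemma prob_big_jump:
  assumes x: "x > 0" and \<alpha>: "\<alpha> > 0"
  shows "prob {\<omega>\<in>space M. x < real (jump n \<omega>)} \<le> 2 * x powr (- (\<alpha> / 2))"
proof -
  have "prob {\<omega>\<in>space M. x < real (jump n \<omega>)} \<le> prob {\<omega>\<in>space M. 1 \<le> min 1 (real (jump n \<omega>) / x)}"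
    using x by (intro finite_measure_mono) auto
  also have "\<dots> \<le> expectation (\<lambda>\<omega>. min 1 (real (jump n \<omega>) / x)) / 1"
    using x by (intro integral_Markov_inequality_measure[where A = "{}"])
      (auto intro!: integrable_const_bound[where B = 1])
  also have "\<dots> \<le> 2 * x powr (- (\<alpha> / 2))" using expectation_truncated_jump[OF assms] by simp
  finally show ?thesis .
qed

lemma prob_two_big_jumps:
  assumes x: "x > 0" and \<alpha>: "\<alpha> > 0" and "k \<noteq> l"
  shows "prob {\<omega>\<in>space M. x < real (jump k \<omega>) \<and> x < real (jump l \<omega>)} \<le> (2 * x powr (- (\<alpha> / 2)))\<^sup>2"
proof -
  let ?A = "\<lambda>j. jump j -` {i. x < real i} \<inter> space M"
  have A: "?A j = {\<omega>\<in>space M. x < real (jump j \<omega>)}" for j by auto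
  have "prob (\<Inter>j\<in>{k, l}. ?A j) = (\<Prod>j\<in>{k, l}. prob (?A j))"
    by (rule indep_varsD[OF indep_steps]) auto
  then have "prob (?A k \<inter> ?A l) = prob (?A k) * prob (?A l)" using \<open>k \<noteq> l\<close> by simp
  moreover have "?A k \<inter> ?A l = {\<omega>\<in>space M. x < real (jump k \<omega>) \<and> x < real (jump l \<omega>)}" by auto
  ultimately have "prob {\<omega>\<in>space M. x < real (jump k \<omega>) \<and> x < real (jump l \<omega>)} = prob (?A k) * prob (?A l)"
    by simp
  also have "\<dots> \<le> (2 * x powr (- (\<alpha> / 2))) * (2 * x powr (- (\<alpha> / 2)))"
    unfolding A by (intro mult_mono prob_big_jump x \<alpha>) auto
  finally show ?thesis by (simp add: power2_eq_square)
qed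

text \<open>A union bound over pairs of indices: for each \<open>k\<close> at most n / m indices
  \<open>l\<close> qualify. The condition \<open>m * (l - k) < n\<close> says that the two times are
  less than 1/m apart after division by n.\<close>

lemma prob_close_big_jumps:
  assumes x: "x > 0" and \<alpha>: "\<alpha> > 0" and m: "m > 0"
  shows "prob {\<omega>\<in>space M. \<exists>k<K. \<exists>l<K. k < l \<and> m * (l - k) < n \<and> x < real (jump k \<omega>) \<and> x < real (jump l \<omega>)}
    \<le> real K * (real n / real m) * (2 * x powr (- (\<alpha> / 2)))\<^sup>2" (is "prob ?E \<le> _")
proof -
  define I where "I = (SIGMA k:{..<K}. {l. l < K \<and> k < l \<and> m * (l - k) < n})"
  let ?A = "\<lambda>(k, l). {\<omega>\<in>space M. x < real (jump k \<omega>) \<and> x < real (jump l \<omega>)}"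
  have fin: "finite I" unfolding I_def by auto
  have card1: "real (card {l. l < K \<and> k < l \<and> m * (l - k) < n}) \<le> real n / real m" for k
  proof -
    have "{l. l < K \<and> k < l \<and> m * (l - k) < n} \<subseteq> (\<lambda>d. k + d) ` {1..n div m}"
    proof
      fix l assume l: "l \<in> {l. l < K \<and> k < l \<and> m * (l - k) < n}"
      then have "l - k \<le> n div m"
        using m by (auto simp: less_eq_div_iff_mult_less_eq mult.commute)
      with l show "l \<in> (\<lambda>d. k + d) ` {1..n div m}" by (intro image_eqI[of _ _ "l - k"]) auto
    qed
    then have "card {l. l < K \<and> k < l \<and> m * (l - k) < n} \<le> card ((\<lambda>d. k + d) ` {1..n div m})"
      by (intro card_mono) auto
    also have "\<dots> \<le> n div m" using card_image_le[of "{1..n div m}" "\<lambda>d. k + d"] by simp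
    finally have "real (card {l. l < K \<and> k < l \<and> m * (l - k) < n}) \<le> real (n div m)" by simp
    also have "\<dots> \<le> real n / real m" by (rule of_nat_div_le_of_nat)
    finally show ?thesis .
  qed
  have "real (card I) = (\<Sum>k<K. real (card {l. l < K \<and> k < l \<and> m * (l - k) < n}))"
    unfolding I_def by simp
  also have "\<dots> \<le> (\<Sum>k<K. real n / real m)" by (intro sum_mono card1)
  finally have card: "real (card I) \<le> real K * (real n / real m)" by simp
  have "?E = (\<Union>i\<in>I. ?A i)" by (auto simp: I_def)
  then have "prob ?E \<le> (\<Sum>i\<in>I. prob (?A i))"
    using fin by (auto intro!: finite_measure_subadditive_finite)
  also have "\<dots> \<le> (\<Sum>i\<in>I. (2 * x powr (- (\<alpha> / 2)))\<^sup>2)"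
  proof (rule sum_mono)
    fix i assume "i \<in> I"
    then obtain k l where "i = (k, l)" "k < l" by (auto simp: I_def)
    then show "prob (?A i) \<le> (2 * x powr (- (\<alpha> / 2)))\<^sup>2" using prob_two_big_jumps[OF x \<alpha>, of k l] by simp
  qed
  also have "\<dots> \<le> real K * (real n / real m) * (2 * x powr (- (\<alpha> / 2)))\<^sup>2"
    unfolding sum_constant by (intro mult_right_mono card) simp
  finally show ?thesis .
qed

text \<open>A jump of length at most \<open>x\<close> equals \<open>x\<close> times its truncation
  \<open>min 1 (real (jump n \<omega>) / x)\<close>.\<close>

lemma expectation_small_jump:
  assumes x: "x > 0" and \<alpha>: "\<alpha> > 0"
  shows "expectation (\<lambda>\<omega>. if real (jump n \<omega>) \<le> x then real (jump n \<omega>) else 0) \<le> x * (2 * x powr (- (\<alpha> / 2)))"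
proof -
  have "expectation (\<lambda>\<omega>. if real (jump n \<omega>) \<le> x then real (jump n \<omega>) else 0) \<le>
      expectation (\<lambda>\<omega>. x * min 1 (real (jump n \<omega>) / x))"
  proof (intro integral_mono integrable_mult_right)
    show "integrable M (\<lambda>\<omega>. if real (jump n \<omega>) \<le> x then real (jump n \<omega>) else 0)"
      using x by (intro integrable_const_bound[where B = x]) auto
    show "integrable M (\<lambda>\<omega>. min 1 (real (jump n \<omega>) / x))"
      using x by (intro integrable_const_bound[where B = 1]) auto
  qed (use x in \<open>auto simp: min_def field_simps\<close>)
  also have "\<dots> = x * expectation (\<lambda>\<omega>. min 1 (real (jump n \<omega>) / x))" by simp
  also have "\<dots> \<le> x * (2 * x powr (- (\<alpha> / 2)))"
    using expectation_truncated_jump[OF assms] x by (intro mult_left_mono) auto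
  finally show ?thesis .
qed

end

section \<open>Scaling limits\<close>

text \<open>In logarithms: for 0 \<le> x < 1/2, ln (1 - x) lies between - x - 2 x^2 and - x, and the
  quadratic error k x^2 is the convergent k x times the null sequence x.\<close>

lemma one_minus_power_limit:
  fixes x :: "nat \<Rightarrow> real" and k :: "nat \<Rightarrow> nat"
  assumes x0: "x \<longlonglongrightarrow> 0" and nn: "\<And>n. 0 \<le> x n" and kx: "(\<lambda>n. real (k n) * x n) \<longlonglongrightarrow> c"
  shows "(\<lambda>n. (1 - x n) ^ k n) \<longlonglongrightarrow> exp (- c)"
proof -
  have ev: "\<forall>\<^sub>F n in sequentially. x n < 1 / 2" by (rule order_tendstoD(2)[OF x0]) simp
  have "(\<lambda>n. real (k n) * ln (1 - x n)) \<longlonglongrightarrow> - c"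
  proof (rule tendsto_sandwich)
    have "(\<lambda>n. - (real (k n) * x n) - 2 * (real (k n) * x n) * x n) \<longlonglongrightarrow> - c - 2 * c * 0"
      by (intro tendsto_intros kx x0)
    then show "(\<lambda>n. - (real (k n) * x n) - 2 * (real (k n) * x n) * x n) \<longlonglongrightarrow> - c" by simp
    show "(\<lambda>n. - (real (k n) * x n)) \<longlonglongrightarrow> - c" by (intro tendsto_intros kx)
    show "\<forall>\<^sub>F n in sequentially. real (k n) * ln (1 - x n) \<le> - (real (k n) * x n)"
      using ev
    proof eventually_elim
      case (elim n)
      have "ln (1 - x n) \<le> - x n" using elim ln_le_minus_one[of "1 - x n"] by simp
      from mult_left_mono[OF this, of "real (k n)"] show ?case by simp
    qed
    show "\<forall>\<^sub>F n in sequentially. - (real (k n) * x n) - 2 * (real (k n) * x n) * x n \<le> real (k n) * ln (1 - x n)"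
      using ev
    proof eventually_elim
      case (elim n)
      have "- x n - 2 * (x n)\<^sup>2 \<le> ln (1 - x n)"
        using elim nn[of n] by (intro ln_one_minus_pos_lower_bound) auto
      from mult_left_mono[OF this, of "real (k n)"] show ?case
        by (simp add: algebra_simps power2_eq_square)
    qed
  qed
  then have "(\<lambda>n. exp (real (k n) * ln (1 - x n))) \<longlonglongrightarrow> exp (- c)" by (intro tendsto_intros)
  moreover have "\<forall>\<^sub>F n in sequentially. exp (real (k n) * ln (1 - x n)) = (1 - x n) ^ k n"
    using ev by eventually_elim (simp add: exp_of_nat_mult)
  ultimately show ?thesis by (rule Lim_transform_eventually)
qed

lemma \<phi>_le_1: "\<phi> (u :: real ^ 'd) \<le> 1"
proof -
  have "(\<Sum>i\<in>UNIV. cos (u $ i)) \<le> (\<Sum>i\<in>(UNIV :: 'd set). 1)" by (intro sum_mono) simp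
  then show ?thesis by (simp add: \<phi>_def field_simps)
qed

lemma one_minus_cos_limit: "((\<lambda>t::real. (1 - cos (t * a)) / t\<^sup>2) \<longlongrightarrow> a\<^sup>2 / 2) (at_right 0)"
proof -
  have "((\<lambda>t::real. (1 - cos (t * a)) / t\<^sup>2) \<longlongrightarrow> a * a / 2) (at_right 0)" by real_asymp
  then show ?thesis by (simp add: power2_eq_square)
qed

text \<open>Coordinatewise 1 - cos v is asymptotically v^2 / 2; averaging over the d coordinates
  gives the factor 1 / (2 d).\<close>

lemma \<phi>_scaling:
  fixes \<theta> :: "real ^ 'd"
  assumes c: "c \<longlonglongrightarrow> 0" "\<forall>\<^sub>F n in sequentially. c n > 0"
  shows "(\<lambda>n. (1 - \<phi> (c n *\<^sub>R \<theta>)) / (c n)\<^sup>2) \<longlonglongrightarrow> \<psi> \<theta>"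
proof -
  have "filterlim c (at_right 0) sequentially"
    using c by (auto simp: filterlim_at elim!: eventually_mono)
  then have "(\<lambda>n. (1 - cos (c n * \<theta> $ i)) / (c n)\<^sup>2) \<longlonglongrightarrow> (\<theta> $ i)\<^sup>2 / 2" for i
    by (rule filterlim_compose[OF one_minus_cos_limit])
  then have "(\<lambda>n. \<Sum>i\<in>UNIV. (1 - cos (c n * \<theta> $ i)) / (c n)\<^sup>2) \<longlonglongrightarrow> (\<Sum>i\<in>UNIV. (\<theta> $ i)\<^sup>2 / 2)"
    by (rule tendsto_sum)
  from tendsto_divide[OF this tendsto_const, of "real CARD('d)"]
  have "(\<lambda>n. (\<Sum>i\<in>UNIV. (1 - cos (c n * \<theta> $ i)) / (c n)\<^sup>2) / real CARD('d)) \<longlonglongrightarrow>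
      (\<Sum>i\<in>UNIV. (\<theta> $ i)\<^sup>2 / 2) / real CARD('d)" by simp
  moreover have "(\<Sum>i\<in>UNIV. (1 - cos (c n * \<theta> $ i)) / (c n)\<^sup>2) / real CARD('d) =
      (1 - \<phi> (c n *\<^sub>R \<theta>)) / (c n)\<^sup>2" for n
    by (simp add: \<phi>_def sum_divide_distrib[symmetric] sum_subtractf field_simps)
  moreover have "(\<Sum>i\<in>UNIV. (\<theta> $ i)\<^sup>2 / 2) / real CARD('d) = \<psi> \<theta>"
    by (simp add: norm_vec_def L2_set_def sum_nonneg sum_divide_distrib[symmetric])
  ultimately show ?thesis by simp
qed

lemma scaled_floor_limit:
  assumes "a \<ge> 0"
  shows "(\<lambda>n. real (nat \<lfloor>real n * a\<rfloor>) / real n) \<longlonglongrightarrow> a"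
proof (rule tendsto_sandwich)
  show "(\<lambda>n. a - 1 / real n) \<longlonglongrightarrow> a" using tendsto_diff[OF tendsto_const lim_1_over_n, of a] by simp
  show "(\<lambda>n. a) \<longlonglongrightarrow> a" by simp
  have *: "real n * a - 1 \<le> real (nat \<lfloor>real n * a\<rfloor>)" "real (nat \<lfloor>real n * a\<rfloor>) \<le> real n * a" for n
    using assms by (auto simp: of_nat_nat)
  show "\<forall>\<^sub>F n in sequentially. a - 1 / real n \<le> real (nat \<lfloor>real n * a\<rfloor>) / real n"
    using eventually_gt_at_top[of 0]
  proof eventually_elim
    case (elim n)
    then have "a - 1 / real n = (real n * a - 1) / real n" by (simp add: field_simps)
    then show ?case using *(1)[of n] elim by (simp add: divide_right_mono)
  qed
  show "\<forall>\<^sub>F n in sequentially. real (nat \<lfloor>real n * a\<rfloor>) / real n \<le> a"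
    using eventually_gt_at_top[of 0]
  proof eventually_elim
    case (elim n)
    then show ?case using *(2)[of n] by (simp add: field_simps)
  qed
qed

text \<open>The spatial scale n^(-1/\<alpha>), squared and raised to the power \<alpha>/2, is
  exactly 1/n. So the base is 1 - x with n x tending to
  \<open>\<psi> \<theta> powr (\<alpha> / 2)\<close>, and the exponent divided by n tends to b -
  a.\<close>

lemma stable_cf_limit:
  fixes \<theta> :: "real ^ 'd"
  assumes \<alpha>: "\<alpha> > 0" and ab: "0 \<le> a" "a \<le> b"
  shows "(\<lambda>n. (1 - (1 - \<phi> (real n powr (- 1 / \<alpha>) *\<^sub>R \<theta>)) powr (\<alpha> / 2)) ^
      (nat \<lfloor>real n * b\<rfloor> - nat \<lfloor>real n * a\<rfloor>)) \<longlonglongrightarrow>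
    exp (- ((b - a) * \<psi> \<theta> powr (\<alpha> / 2)))"
proof (rule one_minus_power_limit)
  let ?c = "\<lambda>n. real n powr (- 1 / \<alpha>)" and ?L = "\<psi> \<theta>"
  let ?x = "\<lambda>n. (1 - \<phi> (?c n *\<^sub>R \<theta>)) powr (\<alpha> / 2)"
  have c0: "?c \<longlonglongrightarrow> 0" using \<alpha> by real_asymp
  have cpos: "\<forall>\<^sub>F n in sequentially. ?c n > 0"
    using eventually_gt_at_top[of 0] by eventually_elim simp
  have nn: "0 \<le> (1 - \<phi> (?c n *\<^sub>R \<theta>)) / (?c n)\<^sup>2" for n using \<phi>_le_1[of "?c n *\<^sub>R \<theta>"] by simp
  have lim: "(\<lambda>n. ((1 - \<phi> (?c n *\<^sub>R \<theta>)) / (?c n)\<^sup>2) powr (\<alpha> / 2)) \<longlonglongrightarrow> ?L powr (\<alpha> / 2)"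
    using \<alpha> nn by (intro tendsto_powr' \<phi>_scaling c0 cpos) auto
  have eq: "\<forall>\<^sub>F n in sequentially. ((1 - \<phi> (?c n *\<^sub>R \<theta>)) / (?c n)\<^sup>2) powr (\<alpha> / 2) = real n * ?x n"
    using eventually_gt_at_top[of 0]
  proof eventually_elim
    case (elim n)
    have "((?c n)\<^sup>2) powr (\<alpha> / 2) = real n powr (- 1 / \<alpha> * 2 * (\<alpha> / 2))"
      using elim by (simp add: powr_powr powr_power)
    also have "\<dots> = 1 / real n" using elim \<alpha> by (simp add: powr_minus_divide)
    finally show ?case
      using \<phi>_le_1[of "?c n *\<^sub>R \<theta>"] by (simp add: powr_divide)
  qed
  have nx: "(\<lambda>n. real n * ?x n) \<longlonglongrightarrow> ?L powr (\<alpha> / 2)"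
    using lim eq by (rule Lim_transform_eventually)
  have "(\<lambda>n. (1 / real n) * (real n * ?x n)) \<longlonglongrightarrow> 0 * ?L powr (\<alpha> / 2)"
    by (intro tendsto_mult nx lim_1_over_n)
  then have "(\<lambda>n. (1 / real n) * (real n * ?x n)) \<longlonglongrightarrow> 0" by simp
  moreover have "\<forall>\<^sub>F n in sequentially. (1 / real n) * (real n * ?x n) = ?x n"
    using eventually_gt_at_top[of 0] by eventually_elim simp
  ultimately show "?x \<longlonglongrightarrow> 0" by (rule Lim_transform_eventually)
  show "0 \<le> ?x n" for n by simp
  let ?k = "\<lambda>n. nat \<lfloor>real n * b\<rfloor> - nat \<lfloor>real n * a\<rfloor>"
  have kn: "real (?k n) = real (nat \<lfloor>real n * b\<rfloor>) - real (nat \<lfloor>real n * a\<rfloor>)" for n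
    using ab by (intro of_nat_diff nat_mono floor_mono mult_left_mono) auto
  have "(\<lambda>n. (real (nat \<lfloor>real n * b\<rfloor>) / real n - real (nat \<lfloor>real n * a\<rfloor>) / real n) * (real n * ?x n)) \<longlonglongrightarrow>
      (b - a) * ?L powr (\<alpha> / 2)"
    using ab by (intro tendsto_mult nx tendsto_diff scaled_floor_limit) auto
  moreover have "\<forall>\<^sub>F n in sequentially. (real (nat \<lfloor>real n * b\<rfloor>) / real n - real (nat \<lfloor>real n * a\<rfloor>) / real n) * (real n * ?x n) =
      real (?k n) * ?x n"
    using eventually_gt_at_top[of 0]
    by eventually_elim (simp only: kn, simp add: diff_divide_distrib[symmetric])
  ultimately show "(\<lambda>n. real (?k n) * ?x n) \<longlonglongrightarrow> (b - a) * ?L powr (\<alpha> / 2)"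
    by (rule Lim_transform_eventually)
qed

section \<open>The subordinate walk\<close>

text \<open>Lists over a countable type form a countable type, so finitely many discrete variables
  can be frozen together as one.\<close>

lemma measurable_map_count_space:
  fixes f :: "'i \<Rightarrow> 'a \<Rightarrow> 'v::countable"
  assumes "\<And>l. l \<in> set xs \<Longrightarrow> f l \<in> M \<rightarrow>\<^sub>M count_space UNIV"
  shows "(\<lambda>\<omega>. map (\<lambda>l. f l \<omega>) xs) \<in> M \<rightarrow>\<^sub>M count_space UNIV"
  using assms
proof (induction xs)
  case (Cons a xs)
  have "(\<lambda>\<omega>. map (\<lambda>l. f l \<omega>) xs) \<in> M \<rightarrow>\<^sub>M count_space UNIV" using Cons by simp
  then have "(\<lambda>\<omega>. i # map (\<lambda>l. f l \<omega>) xs) \<in> M \<rightarrow>\<^sub>M count_space UNIV" for i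
    by (rule measurable_compose) simp
  then have "(\<lambda>\<omega>. f a \<omega> # map (\<lambda>l. f l \<omega>) xs) \<in> M \<rightarrow>\<^sub>M count_space UNIV"
    by (rule measurable_compose_countable) (use Cons in simp)
  then show ?case by simp
qed simp

locale subordinate_walk = W: simple_random_walk M S + T: discrete_subordinator M \<alpha> \<tau>
  for M :: "'a measure" and S :: "nat \<Rightarrow> 'a \<Rightarrow> int ^ 'd" and \<alpha> :: real and \<tau> :: "nat \<Rightarrow> 'a \<Rightarrow> nat" +
  assumes \<alpha>: "0 < \<alpha>" "\<alpha> < 2"
    and indep: "indep_elements M
           (PiM UNIV (\<lambda>_. count_space UNIV)) (\<lambda>\<omega> n. S n \<omega>)
           (PiM UNIV (\<lambda>_. count_space UNIV)) (\<lambda>\<omega> n. \<tau> n \<omega>)"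
begin

definition R :: "nat \<Rightarrow> 'a \<Rightarrow> real ^ 'd" where "R i \<omega> = rvec (S (\<tau> i \<omega>) \<omega>)"

lemma measurable_R [measurable]: "R i \<in> borel_measurable M"
proof -
  have "(\<lambda>\<omega>. rvec (S k \<omega>)) \<in> borel_measurable M" for k
    by (rule measurable_compose[OF W.measurable_walk]) simp
  then show ?thesis
    unfolding R_def by (rule measurable_compose_countable) (rule T.measurable_subordinator)
qed

lemma measurable_walk_coordinate:
  "(\<lambda>s::nat \<Rightarrow> int ^ 'd. rvec (s k)) \<in> borel_measurable (PiM UNIV (\<lambda>_. count_space UNIV))"
proof -
  have "(\<lambda>s. s k) \<in> PiM UNIV (\<lambda>_. count_space UNIV) \<rightarrow>\<^sub>M count_space (UNIV :: (int ^ 'd) set)"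
    by (rule measurable_component_singleton) simp
  from measurable_compose[OF this, of rvec borel] show ?thesis by simp
qed

lemma freeze:
  fixes g :: "nat list \<Rightarrow> (nat \<Rightarrow> int ^ 'd) \<Rightarrow> 'e::{banach, second_countable_topology}"
  assumes "\<And>k. g k \<in> borel_measurable (PiM UNIV (\<lambda>_. count_space UNIV))" "\<And>k x. norm (g k x) \<le> c"
  shows "(\<integral>\<omega>. g (map (\<lambda>l. \<tau> (q l) \<omega>) xs) (\<lambda>n. S n \<omega>) \<partial>M) =
    (\<integral>\<omega>. (\<integral>\<omega>'. g (map (\<lambda>l. \<tau> (q l) \<omega>) xs) (\<lambda>n. S n \<omega>') \<partial>M) \<partial>M)"
proof -
  have "(\<lambda>t. map (\<lambda>l. t (q l)) xs) \<in> PiM UNIV (\<lambda>_. count_space UNIV) \<rightarrow>\<^sub>M count_space (UNIV :: nat list set)"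
    by (intro measurable_map_count_space measurable_component_singleton) simp
  from indep_elements_expectation[OF W.prob_space_axioms indep this, of g c] assms
  show ?thesis by simp
qed

lemma nth_map_upt_Suc: "l \<le> n \<Longrightarrow> map f [0..<Suc n] ! l = f l"
  by (simp del: upt_Suc)

text \<open>Conditioning on \<tau> leaves powers of \<open>\<phi> (w l)\<close>, whose mean is a
  generating function of \<tau>. That function was read off from the Laplace transform, where the
  base has to be positive; hence the condition on \<open>w\<close>.\<close>

lemma cf_increments:
  assumes q: "mono q" "q 0 = 0" and w: "\<And>l. l < n \<Longrightarrow> 0 < \<phi> (w l)"
  shows "(\<integral>\<omega>. iexp (\<Sum>l<n. w l \<bullet> (R (q (Suc l)) \<omega> - R (q l) \<omega>)) \<partial>M) =
    complex_of_real (\<Prod>l<n. (1 - (1 - \<phi> (w l)) powr (\<alpha> / 2)) ^ (q (Suc l) - q l))"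
proof -
  define g where "g = (\<lambda>k (s::nat \<Rightarrow> int ^ 'd). iexp (\<Sum>l<n. w l \<bullet> (rvec (s (k ! Suc l)) - rvec (s (k ! l)))))"
  let ?V = "\<lambda>\<omega>. map (\<lambda>l. \<tau> (q l) \<omega>) [0..<Suc n]"
  have gV: "g (?V \<omega>) s = iexp (\<Sum>l<n. w l \<bullet> (rvec (s (\<tau> (q (Suc l)) \<omega>)) - rvec (s (\<tau> (q l) \<omega>))))" for \<omega> s
    unfolding g_def by (intro arg_cong[where f = iexp] sum.cong) (auto simp: nth_map_upt_Suc simp del: upt_Suc)
  note [measurable] = measurable_walk_coordinate
  have gm: "g k \<in> borel_measurable (PiM UNIV (\<lambda>_. count_space UNIV))" for k
    unfolding g_def by measurable
  have "(\<integral>\<omega>. iexp (\<Sum>l<n. w l \<bullet> (R (q (Suc l)) \<omega> - R (q l) \<omega>)) \<partial>M) = (\<integral>\<omega>. g (?V \<omega>) (\<lambda>n. S n \<omega>) \<partial>M)"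
    by (simp only: gV R_def)
  also have "\<dots> = (\<integral>\<omega>. (\<integral>\<omega>'. g (?V \<omega>) (\<lambda>n. S n \<omega>') \<partial>M) \<partial>M)"
    by (rule freeze[where c = 1]) (auto simp: gm g_def)
  also have "\<dots> = (\<integral>\<omega>. complex_of_real (\<Prod>l<n. \<phi> (w l) ^ (\<tau> (q (Suc l)) \<omega> - \<tau> (q l) \<omega>)) \<partial>M)"
  proof (rule Bochner_Integration.integral_cong[OF refl])
    fix \<omega> assume \<omega>: "\<omega> \<in> space M"
    have "mono (\<lambda>l. \<tau> (q l) \<omega>)"
      using T.mono_tau[OF \<omega>] q(1) by (auto simp: mono_def)
    moreover have "\<tau> (q 0) \<omega> = 0" using q(2) T.start[OF \<omega>] by simp
    ultimately show "(\<integral>\<omega>'. g (?V \<omega>) (\<lambda>n. S n \<omega>') \<partial>M) =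
        complex_of_real (\<Prod>l<n. \<phi> (w l) ^ (\<tau> (q (Suc l)) \<omega> - \<tau> (q l) \<omega>))"
      unfolding gV by (rule W.walk_cf[where p = "\<lambda>l. \<tau> (q l) \<omega>"])
  qed
  also have "\<dots> = complex_of_real (\<integral>\<omega>. (\<Prod>l<n. \<phi> (w l) ^ (\<tau> (q (Suc l)) \<omega> - \<tau> (q l) \<omega>)) \<partial>M)"
    by (rule integral_complex_of_real)
  also have "(\<integral>\<omega>. (\<Prod>l<n. \<phi> (w l) ^ (\<tau> (q (Suc l)) \<omega> - \<tau> (q l) \<omega>)) \<partial>M) =
      (\<Prod>l<n. (1 - (1 - \<phi> (w l)) powr (\<alpha> / 2)) ^ (q (Suc l) - q l))"
    using w by (intro T.subordinator_gf q) (auto simp: \<phi>_le_1)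
  finally show ?thesis .
qed

text \<open>Over a stretch of indices without long jumps its differences are those of
  \<open>R\<close>, so a bound on its running maximum controls the walk between long jumps.\<close>

definition small_sum :: "real \<Rightarrow> nat \<Rightarrow> 'a \<Rightarrow> real ^ 'd" where
  "small_sum x j \<omega> = (\<Sum>i<j. if real (T.jump i \<omega>) \<le> x then R (Suc i) \<omega> - R i \<omega> else 0)"

lemma measurable_small_sum [measurable]: "small_sum x j \<in> borel_measurable M"
  unfolding small_sum_def by measurable

text \<open>Conditionally on \<open>\<tau>\<close>, the contribution of the short jumps of \<open>\<tau>\<close> is a thinned simple random walk.\<close>

lemma prob_small_sum:
  assumes x: "x > 0" and \<delta>: "\<delta> > 0"
  shows "W.prob {\<omega>\<in>space M. \<exists>j\<le>K. \<delta> \<le> norm (small_sum x j \<omega>)} \<le>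
    real K * (x * (2 * x powr (- (\<alpha> / 2)))) / \<delta>\<^sup>2"
proof -
  define G where "G = (\<lambda>k j (s::nat \<Rightarrow> int ^ 'd). \<Sum>i<j. if real (k ! Suc i - k ! i) \<le> x
      then rvec (s (k ! Suc i)) - rvec (s (k ! i)) else 0)"
  define g where "g = (\<lambda>k (s::nat \<Rightarrow> int ^ 'd). if \<exists>j\<in>{..K}. \<delta> \<le> norm (G k j s) then 1 else 0 :: real)"
  let ?V = "\<lambda>\<omega>. map (\<lambda>l. \<tau> l \<omega>) [0..<Suc K]"
  have GV: "G (?V \<omega>) j s = (\<Sum>i<j. if real (T.jump i \<omega>) \<le> x then rvec (s (\<tau> (Suc i) \<omega>)) - rvec (s (\<tau> i \<omega>)) else 0)"
    if "j \<le> K" for \<omega> j s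
    unfolding G_def using that by (intro sum.cong) (auto simp: nth_map_upt_Suc simp del: upt_Suc)
  note [measurable] = measurable_walk_coordinate
  have [measurable]: "G k j \<in> borel_measurable (PiM UNIV (\<lambda>_. count_space UNIV))" for k j
    unfolding G_def by measurable
  have gm: "g k \<in> borel_measurable (PiM UNIV (\<lambda>_. count_space UNIV))" for k
    unfolding g_def by measurable
  let ?s = "\<lambda>i \<omega>. if real (T.jump i \<omega>) \<le> x then real (T.jump i \<omega>) else 0"
  have s_int: "integrable M (?s i)" for i
    using x by (intro W.integrable_const_bound[where B = x]) auto
  have ssG: "small_sum x j \<omega> = G (?V \<omega>) j (\<lambda>n. S n \<omega>)" if "j \<le> K" for j \<omega>
    unfolding GV[OF that] small_sum_def by (intro sum.cong refl) (simp add: R_def)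
  have "W.prob {\<omega>\<in>space M. \<exists>j\<le>K. \<delta> \<le> norm (small_sum x j \<omega>)} =
      (\<integral>\<omega>. indicator {\<omega>\<in>space M. \<exists>j\<in>{..K}. \<delta> \<le> norm (small_sum x j \<omega>)} \<omega> \<partial>M)"
    by (simp add: Bex_def)
  also have "\<dots> = (\<integral>\<omega>. g (?V \<omega>) (\<lambda>n. S n \<omega>) \<partial>M)"
    by (intro Bochner_Integration.integral_cong)
      (auto simp: g_def ssG indicator_def simp del: upt_Suc)
  also have "\<dots> = (\<integral>\<omega>. (\<integral>\<omega>'. g (?V \<omega>) (\<lambda>n. S n \<omega>') \<partial>M) \<partial>M)"
    by (rule freeze[where c = 1 and q = "\<lambda>l. l"]) (auto simp: gm g_def)
  also have "\<dots> \<le> (\<integral>\<omega>. (\<Sum>i<K. ?s i \<omega>) / \<delta>\<^sup>2 \<partial>M)"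
  proof (rule integral_mono_AE')
    show "integrable M (\<lambda>\<omega>. (\<Sum>i<K. ?s i \<omega>) / \<delta>\<^sup>2)"
      using s_int by (intro integrable_divide Bochner_Integration.integrable_sum) auto
    show "AE \<omega> in M. 0 \<le> (\<Sum>i<K. ?s i \<omega>) / \<delta>\<^sup>2"
      by (intro AE_I2 divide_nonneg_nonneg sum_nonneg) auto
    show "AE \<omega> in M. (\<integral>\<omega>'. g (?V \<omega>) (\<lambda>n. S n \<omega>') \<partial>M) \<le> (\<Sum>i<K. ?s i \<omega>) / \<delta>\<^sup>2"
    proof (rule AE_I2)
      fix \<omega> assume \<omega>: "\<omega> \<in> space M"
      define p where "p = (\<lambda>i. \<tau> i \<omega>)"
      have p: "mono p" "p 0 = 0" using T.mono_tau[OF \<omega>] T.start[OF \<omega>] by (auto simp: p_def)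
      define b where "b = (\<lambda>i. if real (p (Suc i) - p i) \<le> x then 1 else 0 :: real)"
      let ?c = "\<lambda>t. b (block p t)"
      have sum_eq: "(\<Sum>t<p j. ?c t *\<^sub>R rvec (W.step t \<omega>')) = G (?V \<omega>) j (\<lambda>n. S n \<omega>')" if "j \<le> K" for j \<omega>'
        unfolding GV[OF that] sum_blocks[OF p, of "\<lambda>l t. b l *\<^sub>R rvec (W.step t \<omega>')"]
          scaleR_sum_right[symmetric]
        using W.rvec_walk_block[OF p(1), of _ \<omega>'] by (intro sum.cong) (auto simp: b_def p_def)
      have "(\<integral>\<omega>'. g (?V \<omega>) (\<lambda>n. S n \<omega>') \<partial>M) =
          (\<integral>\<omega>'. indicator {\<omega>'\<in>space M. \<exists>j\<in>{..K}. \<delta> \<le> norm (G (?V \<omega>) j (\<lambda>n. S n \<omega>'))} \<omega>' \<partial>M)"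
        by (intro Bochner_Integration.integral_cong) (auto simp: g_def indicator_def simp del: upt_Suc)
      also have "\<dots> = W.prob {\<omega>'\<in>space M. \<exists>j\<in>{..K}. \<delta> \<le> norm (G (?V \<omega>) j (\<lambda>n. S n \<omega>'))}"
        by (simp add: Int_absorb2 Collect_restrict del: upt_Suc)
      \<comment> \<open>The sums on the left are the partial sums at the block ends
        \<open>p j\<close>, which are among all those up to \<open>p K\<close>.\<close>
      also have "\<dots> \<le> W.prob {\<omega>'\<in>space M. \<exists>k\<le>p K. \<delta> \<le> norm (\<Sum>t<k. ?c t *\<^sub>R rvec (W.step t \<omega>'))}"
      proof (rule W.finite_measure_mono)
        show "{\<omega>'\<in>space M. \<exists>j\<in>{..K}. \<delta> \<le> norm (G (?V \<omega>) j (\<lambda>n. S n \<omega>'))} \<subseteq>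
            {\<omega>'\<in>space M. \<exists>k\<le>p K. \<delta> \<le> norm (\<Sum>t<k. ?c t *\<^sub>R rvec (W.step t \<omega>'))}"
        proof safe
          fix \<omega>' j assume "j \<le> K" "\<delta> \<le> norm (G (?V \<omega>) j (\<lambda>n. S n \<omega>'))"
          then show "\<exists>k\<le>p K. \<delta> \<le> norm (\<Sum>t<k. ?c t *\<^sub>R rvec (W.step t \<omega>'))"
            using monoD[OF p(1), of j K] by (intro exI[of _ "p j"]) (simp add: sum_eq del: upt_Suc)
        qed
        have "{\<omega>'\<in>space M. \<exists>k\<in>{..p K}. \<delta> \<le> norm (\<Sum>t<k. ?c t *\<^sub>R rvec (W.step t \<omega>'))} \<in> W.events"
          by measurable
        then show "{\<omega>'\<in>space M. \<exists>k\<le>p K. \<delta> \<le> norm (\<Sum>t<k. ?c t *\<^sub>R rvec (W.step t \<omega>'))} \<in> W.events"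
          by (simp add: Bex_def)
      qed
      also have "\<dots> \<le> (\<Sum>t<p K. ?c t) / \<delta>\<^sup>2"
        by (rule W.maximal_inequality[OF _ \<delta>]) (auto simp: b_def)
      \<comment> \<open>The number of retained steps is the total length of the short jumps.\<close>
      also have "(\<Sum>t<p K. ?c t) = (\<Sum>i<K. ?s i \<omega>)"
        unfolding sum_blocks[OF p, of "\<lambda>l t. b l"] by (intro sum.cong) (auto simp: b_def p_def)
      finally show "(\<integral>\<omega>'. g (?V \<omega>) (\<lambda>n. S n \<omega>') \<partial>M) \<le> (\<Sum>i<K. ?s i \<omega>) / \<delta>\<^sup>2" .
    qed
  qed
  also have "\<dots> = (\<Sum>i<K. (\<integral>\<omega>. ?s i \<omega> \<partial>M)) / \<delta>\<^sup>2"
    using s_int by (simp add: Bochner_Integration.integral_sum)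
  also have "\<dots> \<le> (\<Sum>i<K. x * (2 * x powr (- (\<alpha> / 2)))) / \<delta>\<^sup>2"
    using T.expectation_small_jump[OF x \<alpha>(1)] by (intro divide_right_mono sum_mono) auto
  finally show ?thesis by simp
qed

section \<open>Uniform closeness of the rescaled walk to its samples\<close>

abbreviation "X \<equiv> rescaled_subordinate_walk \<alpha> S \<tau>"

lemma X_apply: "t \<ge> 0 \<Longrightarrow> X n \<omega> t = real n powr (- 1 / \<alpha>) *\<^sub>R R (nat \<lfloor>real n * t\<rfloor>) \<omega>"
  by (simp add: rescaled_subordinate_walk_def R_def rvec_def)

lemma X_cadlag: "X n \<omega> \<in> cadlag_paths"
  using step_cadlag[of "real n" "\<lambda>k. real n powr (- 1 / \<alpha>) *\<^sub>R R k \<omega>"]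
  by (simp add: rescaled_subordinate_walk_def R_def rvec_def)

lemma X_measurable: "t \<ge> 0 \<Longrightarrow> (\<lambda>\<omega>. X n \<omega> t) \<in> borel_measurable M"
  by (simp add: X_apply)

text \<open>A statement about a single outcome. Long jumps supply the cuts, and an increment of
  \<open>R\<close> between them is a difference of two values of \<open>small_sum\<close>, so its
  norm is below 2 * \<delta>.\<close>

lemma X_near_sample_path:
  assumes \<omega>: "\<omega> \<in> space M" and n: "n > 0" and m: "m > 0" "T \<le> real m" "1 / real m < \<epsilon>"
    and K: "T + 1 \<le> real T'" and \<delta>: "real n powr (- 1 / \<alpha>) * (2 * \<delta>) \<le> \<epsilon>"
    and close: "\<not> (\<exists>k<n * T'. \<exists>l<n * T'. k < l \<and> m * (l - k) < n \<and> x < real (T.jump k \<omega>) \<and> x < real (T.jump l \<omega>))"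
    and small: "\<not> (\<exists>j\<le>n * T'. \<delta> \<le> norm (small_sum x j \<omega>))"
  shows "X n \<omega> \<in> J1_nbhd (sample_path m (X n \<omega>)) T \<epsilon>"
proof -
  \<comment> \<open>The jump with index \<open>k\<close> leads from \<tau> at k to \<tau> at k + 1,
    so it shows in the path at time (k + 1) / n.\<close>
  define D where "D = (\<lambda>k. real (Suc k) / real n) ` {k. k < n * T' \<and> x < real (T.jump k \<omega>)}"
  show ?thesis
  proof (rule sample_path_nbhd[OF X_cadlag m(1,2)])
    show "finite D" "D \<subseteq> {0<..}" using n by (auto simp: D_def)
    show "1 / real m < \<epsilon>" by fact
    show "1 / real m \<le> s' - s" if ss: "s \<in> D" "s' \<in> D" "s < s'" for s s'
    proof -
      obtain k l where kl: "s = real (Suc k) / real n" "s' = real (Suc l) / real n"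
        "k < n * T'" "l < n * T'" "x < real (T.jump k \<omega>)" "x < real (T.jump l \<omega>)"
        using ss(1,2) unfolding D_def by blast
      then have "k < l" using ss(3) n by (simp add: divide_less_cancel)
      then have "n \<le> m * (l - k)" using close kl by (meson not_le)
      then have "real n \<le> real m * (real l - real k)"
        using \<open>k < l\<close> by (metis of_nat_diff of_nat_le_iff of_nat_mult less_imp_le)
      then show ?thesis using n m by (simp add: kl diff_divide_distrib[symmetric] field_simps)
    qed
    have *: "dist (X n \<omega> a) (X n \<omega> b) < \<epsilon>"
      if ab: "0 \<le> a" "a \<le> b" "b \<le> T + 1" "\<forall>s\<in>D. s \<le> a \<longleftrightarrow> s \<le> b" for a b
    proof -
      define i j where "i = nat \<lfloor>real n * a\<rfloor>" and "j = nat \<lfloor>real n * b\<rfloor>"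
      have ij: "i \<le> j" unfolding i_def j_def using ab by (intro nat_mono floor_mono mult_left_mono) auto
      have jb: "real j \<le> real n * b" using ab by (simp add: j_def of_nat_nat)
      have "real n * b \<le> real n * real T'" using ab K by (intro mult_left_mono) auto
      with jb have jK: "j \<le> n * T'" by (metis of_nat_le_iff of_nat_mult order_trans)
      have ia: "real n * a < real i + 1" using ab by (simp add: i_def of_nat_nat)
      \<comment> \<open>A long jump with index in this range would put a point of \<open>D\<close>
        into (a, b].\<close>
      have sm: "real (T.jump k \<omega>) \<le> x" if k: "i \<le> k" "k < j" for k
      proof (rule ccontr)
        assume "\<not> real (T.jump k \<omega>) \<le> x"
        then have "real (Suc k) / real n \<in> D" using k jK by (auto simp: D_def)
        then have "real (Suc k) / real n \<le> a \<longleftrightarrow> real (Suc k) / real n \<le> b" using ab(4) by blast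
        moreover have "real (Suc k) \<le> real n * b" using k jb by linarith
        then have "real (Suc k) / real n \<le> b" using n by (simp add: field_simps)
        moreover have "real n * a < real (Suc k)" using k ia by linarith
        then have "\<not> real (Suc k) / real n \<le> a" using n by (simp add: field_simps)
        ultimately show False by blast
      qed
      have "small_sum x j \<omega> - small_sum x i \<omega> =
          (\<Sum>k\<in>{i..<j}. if real (T.jump k \<omega>) \<le> x then R (Suc k) \<omega> - R k \<omega> else 0)"
        unfolding small_sum_def lessThan_atLeast0 using ij by (intro sum_diff_nat_ivl) auto
      also have "\<dots> = (\<Sum>k\<in>{i..<j}. R (Suc k) \<omega> - R k \<omega>)" using sm by (intro sum.cong) auto
      also have "\<dots> = R j \<omega> - R i \<omega>" using ij by (rule sum_Suc_diff')
      finally have "R j \<omega> - R i \<omega> = small_sum x j \<omega> - small_sum x i \<omega>" ..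
      then have "norm (R j \<omega> - R i \<omega>) \<le> norm (small_sum x j \<omega>) + norm (small_sum x i \<omega>)"
        by (simp add: norm_triangle_ineq4)
      also have "\<dots> < 2 * \<delta>" using small jK ij by (smt (verit) not_le order_trans)
      finally have "real n powr (- 1 / \<alpha>) * norm (R j \<omega> - R i \<omega>) < real n powr (- 1 / \<alpha>) * (2 * \<delta>)"
        using n by (intro mult_strict_left_mono) auto
      moreover have "dist (X n \<omega> a) (X n \<omega> b) = real n powr (- 1 / \<alpha>) * norm (R j \<omega> - R i \<omega>)"
        using ab by (simp add: X_apply i_def j_def dist_norm norm_minus_commute flip: scaleR_diff_right)
      ultimately show ?thesis using \<delta> by linarith
    qed
    fix a b assume ab: "0 \<le> a" "0 \<le> b" "a \<le> T + 1" "b \<le> T + 1" "\<forall>s\<in>D. s \<le> a \<longleftrightarrow> s \<le> b"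
    show "dist (X n \<omega> a) (X n \<omega> b) < \<epsilon>"
    proof (cases "a \<le> b")
      case True
      show ?thesis by (rule *[OF ab(1) True ab(4,5)])
    next
      case False
      have "\<forall>s\<in>D. s \<le> b \<longleftrightarrow> s \<le> a" using ab(5) by blast
      then have "dist (X n \<omega> b) (X n \<omega> a) < \<epsilon>" using False by (intro *[OF ab(2) _ ab(3)]) simp_all
      then show ?thesis by (simp add: dist_commute)
    qed
  qed
qed

text \<open>Two events are excluded: \<open>A1\<close>, where two long jumps are close, and
  \<open>A2\<close>, where the short jumps alone carry the walk far. Each receives half of
  \<kappa>.\<close>

lemma X_tight:
  assumes T: "T > 0" and \<epsilon>: "\<epsilon> > 0" and \<kappa>: "\<kappa> > 0"
  shows "\<forall>\<^sub>F m in sequentially. \<forall>\<^sub>F n in sequentially. well_sampled M (X n) m T \<epsilon> \<kappa>"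
proof -
  obtain T' :: nat where T': "T + 1 \<le> real T'" using real_arch_simple by blast
  define \<delta> where "\<delta> = \<epsilon> / 2"
  have \<delta>: "\<delta> > 0" using \<epsilon> by (simp add: \<delta>_def)
  \<comment> \<open>This is the bound for the short jumps, in which neither \<open>n\<close> nor
    \<open>m\<close> occurs; it becomes small with \<eta> because 1 - \<alpha>/2 is positive. Only
    then is \<open>m\<close> chosen, in terms of \<eta>.\<close>
  obtain \<eta> where \<eta>: "\<eta> > 0" "2 * real T' * \<eta> powr (1 - \<alpha> / 2) / \<delta>\<^sup>2 < \<kappa> / 2"
  proof -
    have "((\<lambda>\<eta>. 2 * real T' * \<eta> powr (1 - \<alpha> / 2) / \<delta>\<^sup>2) \<longlongrightarrow> 2 * real T' * 0 / \<delta>\<^sup>2) (at_right 0)"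
    proof (intro tendsto_intros)
      show "((\<lambda>\<eta>. \<eta> powr (1 - \<alpha> / 2)) \<longlongrightarrow> 0) (at_right 0)" using \<alpha> by real_asymp
    qed (use \<delta> in simp)
    then have "\<forall>\<^sub>F \<eta> in at_right 0. 2 * real T' * \<eta> powr (1 - \<alpha> / 2) / \<delta>\<^sup>2 < \<kappa> / 2"
      using \<kappa> by (intro order_tendstoD(2)) auto
    then obtain b where b: "b > 0" "\<And>\<eta>. 0 < \<eta> \<Longrightarrow> \<eta> < b \<Longrightarrow> 2 * real T' * \<eta> powr (1 - \<alpha> / 2) / \<delta>\<^sup>2 < \<kappa> / 2"
      unfolding eventually_at_right_field by blast
    then show ?thesis using that[of "b / 2"] by simp
  qed
  have lim: "(\<lambda>m. 1 / real m) \<longlonglongrightarrow> 0" by (rule lim_1_over_n)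
  have "(\<lambda>m. 4 * real T' * \<eta> powr (- \<alpha>) * (1 / real m)) \<longlonglongrightarrow> 4 * real T' * \<eta> powr (- \<alpha>) * 0"
    by (intro tendsto_mult tendsto_const lim)
  then have "\<forall>\<^sub>F m in sequentially. 4 * real T' * \<eta> powr (- \<alpha>) * (1 / real m) < \<kappa> / 2"
    using \<kappa> by (intro order_tendstoD(2)) auto
  moreover have "\<forall>\<^sub>F m in sequentially. 1 / real m < \<epsilon>" by (rule order_tendstoD(2)[OF lim \<epsilon>])
  moreover have "\<forall>\<^sub>F m in sequentially. T \<le> real m"
    using eventually_ge_at_top[of "nat \<lceil>T\<rceil>"] by eventually_elim linarith
  moreover have "\<forall>\<^sub>F m::nat in sequentially. 0 < m" by (rule eventually_gt_at_top)
  ultimately show ?thesis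
  proof eventually_elim
    case (elim m)
    note m = this
    show ?case
      using eventually_gt_at_top[of 0]
    proof eventually_elim
      case (elim n)
      then have n: "real n > 0" by simp
      \<comment> \<open>The threshold on the natural scale of \<tau> after n steps;
        \<open>\<delta>'\<close> is \<delta> before the spatial rescaling.\<close>
      define x where "x = \<eta> * real n powr (2 / \<alpha>)"
      define \<delta>' where "\<delta>' = \<delta> * real n powr (1 / \<alpha>)"
      have x: "x > 0" and \<delta>': "\<delta>' > 0" using n \<eta> \<delta> by (auto simp: x_def \<delta>'_def)
      have xp: "x powr (- (\<alpha> / 2)) = \<eta> powr (- (\<alpha> / 2)) / real n"
        using n \<eta> \<alpha> by (simp add: x_def powr_mult powr_powr powr_minus_divide)
      define A1 where "A1 = {\<omega>\<in>space M. \<exists>k\<in>{..<n * T'}. \<exists>l\<in>{..<n * T'}. k < l \<and> m * (l - k) < n \<and> x < real (T.jump k \<omega>) \<and> x < real (T.jump l \<omega>)}"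
      define A2 where "A2 = {\<omega>\<in>space M. \<exists>j\<in>{..n * T'}. \<delta>' \<le> norm (small_sum x j \<omega>)}"
      have A [measurable]: "A1 \<in> W.events" "A2 \<in> W.events"
        unfolding A1_def A2_def by measurable
      have "W.prob A1 \<le> real (n * T') * (real n / real m) * (2 * x powr (- (\<alpha> / 2)))\<^sup>2"
        using T.prob_close_big_jumps[OF x \<alpha>(1) m(4), of "n * T'" n] by (simp add: A1_def Bex_def)
      \<comment> \<open>The n T' indices, the n / m neighbours of each and the squared probability,
        of order 1 / n^2, cancel in \<open>n\<close>.\<close>
      also have "\<dots> = 4 * real T' * (\<eta> powr (- (\<alpha> / 2)))\<^sup>2 * (1 / real m)"
        using n by (simp add: xp power2_eq_square)
      also have "(\<eta> powr (- (\<alpha> / 2)))\<^sup>2 = \<eta> powr (- \<alpha>)"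
        using \<eta> by (simp add: power2_eq_square flip: powr_add)
      finally have 1: "W.prob A1 \<le> \<kappa> / 2" using m(1) by linarith
      have "W.prob A2 \<le> real (n * T') * (x * (2 * x powr (- (\<alpha> / 2)))) / \<delta>'\<^sup>2"
        using prob_small_sum[OF x \<delta>', of "n * T'"] by (simp add: A2_def Bex_def)
      also have "\<dots> = 2 * real T' * (\<eta> * \<eta> powr (- (\<alpha> / 2))) * (real n powr (2 / \<alpha>) / (real n powr (1 / \<alpha>))\<^sup>2) / \<delta>\<^sup>2"
        unfolding xp unfolding x_def \<delta>'_def using n by (simp add: power_mult_distrib ac_simps)
      \<comment> \<open>Diffusive scaling: the walk needs a time of order n^(2/\<alpha>) to move by
        n^(1/\<alpha>).\<close>
      also have "real n powr (2 / \<alpha>) / (real n powr (1 / \<alpha>))\<^sup>2 = 1"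
        using n by (simp add: power2_eq_square flip: powr_add)
      also have "\<eta> * \<eta> powr (- (\<alpha> / 2)) = \<eta> powr (1 - \<alpha> / 2)"
        using \<eta> powr_add[of \<eta> 1 "- (\<alpha> / 2)"] by simp
      finally have 2: "W.prob A2 \<le> \<kappa> / 2" using \<eta> by linarith
      have "W.prob (A1 \<union> A2) \<le> W.prob A1 + W.prob A2" by (intro measure_Un_le A)
      then have "W.prob (A1 \<union> A2) \<le> \<kappa>" using 1 2 by linarith
      moreover have "X n \<omega> \<in> J1_nbhd (sample_path m (X n \<omega>)) T \<epsilon>" if "\<omega> \<in> space M - (A1 \<union> A2)" for \<omega>
      proof (rule X_near_sample_path[where \<delta> = \<delta>' and x = x and T' = T'])
        have "real n powr (- 1 / \<alpha>) * real n powr (1 / \<alpha>) = 1" using n by (simp flip: powr_add)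
        then show "real n powr (- 1 / \<alpha>) * (2 * \<delta>') \<le> \<epsilon>"
          by (simp add: \<delta>'_def \<delta>_def mult.commute mult.left_commute)
      qed (use that m elim T' in \<open>auto simp: A1_def A2_def\<close>)
      ultimately show ?case by (intro bexI[of _ "A1 \<union> A2"]) auto
    qed
  qed
qed

end

section \<open>The limit process\<close>

lemma prod_Basis_cart:
  fixes x :: "real ^ 'd" and h :: "real \<Rightarrow> real"
  shows "(\<Prod>i\<in>UNIV. h (x $ i)) = (\<Prod>b\<in>Basis. h (x \<bullet> b))"
proof -
  have "inj (\<lambda>i::'d. axis i (1::real))" by (auto simp: inj_def axis_eq_axis)
  then have "(\<Prod>b\<in>range (\<lambda>i::'d. axis i (1::real)). h (x \<bullet> b)) = (\<Prod>i\<in>UNIV. h (x $ i))"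
    by (subst prod.reindex) (simp_all add: inner_axis)
  moreover have "(Basis :: (real ^ 'd) set) = range (\<lambda>i. axis i 1)" by (auto simp: Basis_vec_def)
  ultimately show ?thesis by metis
qed

text \<open>Lebesgue measure on the vector space is the image of the product measure over the
  standard basis, so the integral splits into one-dimensional Gaussian transforms.\<close>

lemma gaussian_vector_cf:
  fixes \<theta> :: "real ^ 'd"
  assumes v: "v > 0"
  shows "(\<integral>x. (\<Prod>i\<in>UNIV. normal_density 0 v (x $ i)) *\<^sub>R iexp (\<theta> \<bullet> x) \<partial>(lborel :: (real ^ 'd) measure)) =
    complex_of_real (exp (- (v\<^sup>2 * (norm \<theta>)\<^sup>2 / 2)))"
proof -
  interpret product_sigma_finite "\<lambda>_::real ^ 'd. lborel :: real measure" by standard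
  let ?x = "\<lambda>f. \<Sum>b\<in>Basis. f b *\<^sub>R (b :: real ^ 'd)"
  let ?f = "\<lambda>b t. complex_of_real (normal_density 0 v t) * iexp ((\<theta> \<bullet> b) * t)"
  have xb: "?x f \<bullet> b = f b" if "b \<in> Basis" for f b
    using that by (simp add: inner_sum_left inner_Basis sum.delta if_distrib cong: if_cong)
  have "(\<integral>x. (\<Prod>i\<in>UNIV. normal_density 0 v (x $ i)) *\<^sub>R iexp (\<theta> \<bullet> x) \<partial>(lborel :: (real ^ 'd) measure)) =
      (\<integral>f. (\<Prod>b\<in>Basis. normal_density 0 v (?x f \<bullet> b)) *\<^sub>R iexp (\<theta> \<bullet> ?x f) \<partial>(\<Pi>\<^sub>M b\<in>Basis. lborel))"
    unfolding prod_Basis_cart by (subst lborel_eq, subst integral_distr) (auto simp: normal_density_def)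
  also have "\<dots> = (\<integral>f. (\<Prod>b\<in>Basis. ?f b (f b)) \<partial>(\<Pi>\<^sub>M b\<in>Basis. lborel))"
  proof (rule Bochner_Integration.integral_cong[OF refl])
    fix f :: "real ^ 'd \<Rightarrow> real"
    have "\<theta> \<bullet> ?x f = (\<Sum>b\<in>Basis. (\<theta> \<bullet> b) * f b)"
      by (simp add: inner_sum_right mult.commute)
    moreover have "(\<Prod>b\<in>Basis. normal_density 0 v (?x f \<bullet> b)) = (\<Prod>b\<in>Basis. normal_density 0 v (f b))"
      by (intro prod.cong refl) (simp only: xb)
    ultimately show "(\<Prod>b\<in>Basis. normal_density 0 v (?x f \<bullet> b)) *\<^sub>R iexp (\<theta> \<bullet> ?x f) = (\<Prod>b\<in>Basis. ?f b (f b))"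
      by (simp only:) (simp add: scaleR_conv_of_real prod.distrib exp_sum sum_distrib_left)
  qed
  also have "\<dots> = (\<Prod>b\<in>Basis. (\<integral>t. ?f b t \<partial>lborel))"
    by (rule product_integral_prod[OF finite_Basis, where f = ?f],
        rule integrable_norm_eq[where g = "normal_density 0 v"])
      (use v in \<open>auto simp: norm_mult\<close>)
  also have "\<dots> = (\<Prod>b\<in>Basis. complex_of_real (exp (- (v * (\<theta> \<bullet> b))\<^sup>2 / 2)))"
    using v by (intro prod.cong refl fourier_normal_density)
  also have "\<dots> = complex_of_real (exp (\<Sum>b\<in>Basis. - (v * (\<theta> \<bullet> b))\<^sup>2 / 2))"
    by (simp add: exp_sum)
  also have "(\<Sum>b\<in>Basis. - (v * (\<theta> \<bullet> b))\<^sup>2 / 2) = - (v\<^sup>2 * (norm \<theta>)\<^sup>2 / 2)"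
    unfolding power2_norm_eq_inner euclidean_inner[of \<theta> \<theta>]
    by (simp add: power_mult_distrib sum_distrib_left sum_divide_distrib sum_negf power2_eq_square ac_simps)
  finally show ?thesis .
qed

section \<open>Characteristic functions of Brownian increments\<close>

context walk_brownian_motion
begin

lemma increment_cf:
  assumes "0 \<le> s" "s \<le> t"
  shows "(\<integral>\<omega>. iexp (\<theta> \<bullet> (B t \<omega> - B s \<omega>)) \<partial>M) =
    complex_of_real (exp (- ((t - s) * \<psi> \<theta>)))"
proof (cases "s = t")
  \<comment> \<open>The law of the zero increment has no density, so it is treated apart.\<close>
  case True
  then show ?thesis by (simp add: prob_space)
next
  case False
  let ?v = "sqrt ((t - s) / real CARD('d))"
  have v: "?v > 0" using assms False by simp
  have dist: "distributed M lborel (\<lambda>\<omega>. B t \<omega> - B s \<omega>) (\<lambda>x. \<Prod>i\<in>UNIV. ennreal (normal_density 0 ?v (x $ i)))"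
    using assms False by (intro gaussian_increments) auto
  have "(\<integral>\<omega>. iexp (\<theta> \<bullet> (B t \<omega> - B s \<omega>)) \<partial>M) = (\<integral>x. iexp (\<theta> \<bullet> x) \<partial>distr M lborel (\<lambda>\<omega>. B t \<omega> - B s \<omega>))"
    using distributed_measurable[OF dist] by (subst integral_distr) auto
  also have "\<dots> = (\<integral>x. iexp (\<theta> \<bullet> x) \<partial>density lborel (\<lambda>x. ennreal (\<Prod>i\<in>UNIV. normal_density 0 ?v (x $ i))))"
    by (simp add: distributed_distr_eq_density[OF dist] prod_ennreal)
  also have "\<dots> = (\<integral>x. (\<Prod>i\<in>UNIV. normal_density 0 ?v (x $ i)) *\<^sub>R iexp (\<theta> \<bullet> x) \<partial>lborel)"
    by (subst integral_density) (auto simp: normal_density_def intro!: prod_nonneg)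
  also have "\<dots> = complex_of_real (exp (- (?v\<^sup>2 * (norm \<theta>)\<^sup>2 / 2)))" by (rule gaussian_vector_cf[OF v])
  finally show ?thesis using assms by simp
qed

lemma joint_increment_cf:
  assumes "0 \<le> s 0" "\<And>l. l < k \<Longrightarrow> s l \<le> s (Suc l)"
  shows "(\<integral>\<omega>. iexp (\<Sum>l<k. \<theta> l \<bullet> (B (s (Suc l)) \<omega> - B (s l) \<omega>)) \<partial>M) =
    complex_of_real (\<Prod>l<k. exp (- ((s (Suc l) - s l) * \<psi> (\<theta> l))))"
proof -
  have s: "0 \<le> s l" if "l \<le> k" for l
    using that assms by (induction l) (auto intro: order_trans)
  have ind: "indep_vars (\<lambda>_. borel) (\<lambda>l \<omega>. B (s (Suc l)) \<omega> - B (s l) \<omega>) {..<k}"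
    using indep_increments assms unfolding independent_increments_def by blast
  have "(\<integral>\<omega>. iexp (\<Sum>l<k. \<theta> l \<bullet> (B (s (Suc l)) \<omega> - B (s l) \<omega>)) \<partial>M) =
      (\<integral>\<omega>. (\<Prod>l<k. iexp (\<theta> l \<bullet> (B (s (Suc l)) \<omega> - B (s l) \<omega>))) \<partial>M)"
    by (simp add: exp_sum sum_distrib_left)
  also have "\<dots> = (\<Prod>l<k. (\<integral>\<omega>. iexp (\<theta> l \<bullet> (B (s (Suc l)) \<omega> - B (s l) \<omega>)) \<partial>M))"
  proof (rule indep_vars_lebesgue_integral)
    show "indep_vars (\<lambda>_. borel) (\<lambda>l \<omega>. iexp (\<theta> l \<bullet> (B (s (Suc l)) \<omega> - B (s l) \<omega>))) {..<k}"
      by (rule indep_vars_compose2[OF ind, where Y = "\<lambda>l x. iexp (\<theta> l \<bullet> x)"]) auto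
    show "integrable M (\<lambda>\<omega>. iexp (\<theta> l \<bullet> (B (s (Suc l)) \<omega> - B (s l) \<omega>)))" if "l \<in> {..<k}" for l
      using that measurable_process[OF s, of l] measurable_process[OF s, of "Suc l"]
      by (intro integrable_const_bound[where B = 1]) auto
  qed simp
  also have "\<dots> = (\<Prod>l<k. complex_of_real (exp (- ((s (Suc l) - s l) * \<psi> (\<theta> l)))))"
    using s assms by (intro prod.cong refl increment_cf) auto
  finally show ?thesis by simp
qed

end

section \<open>Laplace transforms of the increments of the stable subordinator\<close>

context stable_subordinator
begin

lemma \<sigma>_nonneg: "\<omega> \<in> space M \<Longrightarrow> 0 \<le> t \<Longrightarrow> 0 \<le> \<sigma> t \<omega>"
  using nondecreasing[of \<omega>] start[of \<omega>] by (auto dest: mono_onD[of _ _ 0 t])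

lemma \<sigma>_mono: "\<omega> \<in> space M \<Longrightarrow> 0 \<le> s \<Longrightarrow> s \<le> t \<Longrightarrow> \<sigma> s \<omega> \<le> \<sigma> t \<omega>"
  using nondecreasing[of \<omega>] by (auto dest: mono_onD[of _ _ s t])

lemma increment_laplace:
  assumes "0 \<le> s" "s \<le> t" "c \<ge> 0"
  shows "expectation (\<lambda>\<omega>. exp (- (c * (\<sigma> t \<omega> - \<sigma> s \<omega>)))) = exp (- ((t - s) * c powr (\<alpha> / 2)))"
proof -
  have [measurable]: "\<sigma> t \<in> borel_measurable M" "\<sigma> s \<in> borel_measurable M" "\<sigma> (t - s) \<in> borel_measurable M"
    using assms by (auto intro: measurable_process)
  have "expectation (\<lambda>\<omega>. exp (- (c * (\<sigma> t \<omega> - \<sigma> s \<omega>)))) =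
      (\<integral>x. exp (- (c * x)) \<partial>distr M borel (\<lambda>\<omega>. \<sigma> t \<omega> - \<sigma> s \<omega>))"
    by (subst integral_distr) auto
  also have "\<dots> = (\<integral>x. exp (- (c * x)) \<partial>distr M borel (\<sigma> (t - s)))"
    using assms by (simp add: stationary_increments)
  also have "\<dots> = expectation (\<lambda>\<omega>. exp (- c * \<sigma> (t - s) \<omega>))"
    by (subst integral_distr) auto
  also have "\<dots> = exp (- (t - s) * c powr (\<alpha> / 2))"
    using assms by (intro laplace) auto
  finally show ?thesis by (simp only: mult_minus_left)
qed

lemma joint_increment_laplace:
  assumes t: "0 \<le> t 0" "\<And>l. l < k \<Longrightarrow> t l \<le> t (Suc l)" and c: "\<And>l. c l \<ge> 0"
  shows "expectation (\<lambda>\<omega>. \<Prod>l<k. exp (- (c l * (\<sigma> (t (Suc l)) \<omega> - \<sigma> (t l) \<omega>)))) =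
    (\<Prod>l<k. exp (- ((t (Suc l) - t l) * c l powr (\<alpha> / 2))))"
proof -
  have tn: "0 \<le> t l" if "l \<le> k" for l
    using that t by (induction l) (auto intro: order_trans)
  have ind: "indep_vars (\<lambda>_. borel) (\<lambda>l \<omega>. \<sigma> (t (Suc l)) \<omega> - \<sigma> (t l) \<omega>) {..<k}"
    using indep_increments t unfolding independent_increments_def by blast
  have "expectation (\<lambda>\<omega>. \<Prod>l<k. exp (- (c l * (\<sigma> (t (Suc l)) \<omega> - \<sigma> (t l) \<omega>)))) =
      (\<Prod>l<k. expectation (\<lambda>\<omega>. exp (- (c l * (\<sigma> (t (Suc l)) \<omega> - \<sigma> (t l) \<omega>)))))"
  proof (rule indep_vars_lebesgue_integral)
    show "indep_vars (\<lambda>_. borel) (\<lambda>l \<omega>. exp (- (c l * (\<sigma> (t (Suc l)) \<omega> - \<sigma> (t l) \<omega>)))) {..<k}"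
      by (rule indep_vars_compose2[OF ind, where Y = "\<lambda>l x. exp (- (c l * x))"]) auto
    show "integrable M (\<lambda>\<omega>. exp (- (c l * (\<sigma> (t (Suc l)) \<omega> - \<sigma> (t l) \<omega>))))" if "l \<in> {..<k}" for l
    proof (rule integrable_const_bound[where B = 1])
      have "0 \<le> c l * (\<sigma> (t (Suc l)) \<omega> - \<sigma> (t l) \<omega>)" if "\<omega> \<in> space M" for \<omega>
        using \<sigma>_mono[OF that, of "t l" "t (Suc l)"] tn[of l] t(2)[of l] c[of l] \<open>l \<in> {..<k}\<close> by simp
      then show "AE \<omega> in M. norm (exp (- (c l * (\<sigma> (t (Suc l)) \<omega> - \<sigma> (t l) \<omega>)))) \<le> 1"
        by (intro AE_I2) simp
      have [measurable]: "\<sigma> (t l) \<in> borel_measurable M" "\<sigma> (t (Suc l)) \<in> borel_measurable M"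
        using that tn by (auto intro: measurable_process)
      show "(\<lambda>\<omega>. exp (- (c l * (\<sigma> (t (Suc l)) \<omega> - \<sigma> (t l) \<omega>)))) \<in> borel_measurable M" by measurable
    qed
  qed simp
  also have "\<dots> = (\<Prod>l<k. exp (- ((t (Suc l) - t l) * c l powr (\<alpha> / 2))))"
    using t tn c by (intro prod.cong refl increment_laplace) auto
  finally show ?thesis .
qed

end

lemma ceiling_approx_limit:
  assumes "x \<ge> (0::real)"
  shows "(\<lambda>n. real (nat \<lceil>real (Suc n) * x\<rceil>) / real (Suc n)) \<longlonglongrightarrow> x"
proof (rule tendsto_sandwich)
  have *: "real (Suc n) * x \<le> real (nat \<lceil>real (Suc n) * x\<rceil>)"
    "real (nat \<lceil>real (Suc n) * x\<rceil>) \<le> real (Suc n) * x + 1" for n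
  proof -
    have "0 \<le> real (Suc n) * x" using assms by simp
    then have "real (nat \<lceil>real (Suc n) * x\<rceil>) = of_int \<lceil>real (Suc n) * x\<rceil>" by (simp add: of_nat_nat)
    then show "real (Suc n) * x \<le> real (nat \<lceil>real (Suc n) * x\<rceil>)"
      "real (nat \<lceil>real (Suc n) * x\<rceil>) \<le> real (Suc n) * x + 1" by linarith+
  qed
  show "\<forall>\<^sub>F n in sequentially. x \<le> real (nat \<lceil>real (Suc n) * x\<rceil>) / real (Suc n)"
    using *(1) by (intro always_eventually allI) (simp add: field_simps)
  show "\<forall>\<^sub>F n in sequentially. real (nat \<lceil>real (Suc n) * x\<rceil>) / real (Suc n) \<le> x + 1 / real (Suc n)"
  proof (intro always_eventually allI)
    fix n
    have "x + 1 / real (Suc n) = (real (Suc n) * x + 1) / real (Suc n)" by (simp add: field_simps)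
    then show "real (nat \<lceil>real (Suc n) * x\<rceil>) / real (Suc n) \<le> x + 1 / real (Suc n)"
      using divide_right_mono[OF *(2)[of n], of "real (Suc n)"] by simp
  qed
  show "(\<lambda>n. x + 1 / real (Suc n)) \<longlonglongrightarrow> x"
    using tendsto_add[OF tendsto_const LIMSEQ_Suc[OF lim_1_over_n], of x] by simp
qed simp

section \<open>Brownian motion at an independent random time\<close>

locale subordinate_bm = Bm: walk_brownian_motion N B + Sg: stable_subordinator N \<sigma> \<alpha>
  for N :: "'b measure" and B :: "real \<Rightarrow> 'b \<Rightarrow> real ^ 'd" and \<sigma> :: "real \<Rightarrow> 'b \<Rightarrow> real" and \<alpha> :: real +
  assumes indep: "indep_elements N
           (PiM {0..} (\<lambda>_. borel)) (\<lambda>\<omega>. \<lambda>t\<in>{0..}. B t \<omega>)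
           (PiM {0..} (\<lambda>_. borel)) (\<lambda>\<omega>. \<lambda>t\<in>{0..}. \<sigma> t \<omega>)"
begin

text \<open>\<sigma> rounded up to multiples of 1/(n + 1) and stored as an integer, because
  \<open>indep_elements_expectation\<close> freezes discrete variables. Rounding preserves the order
  in \<open>t\<close>, and continuity of the Brownian paths undoes it in the limit.\<close>

definition approx :: "nat \<Rightarrow> real \<Rightarrow> 'b \<Rightarrow> nat" where
  "approx n t \<omega> = nat \<lceil>real (Suc n) * \<sigma> t \<omega>\<rceil>"

lemma measurable_approx: "t \<ge> 0 \<Longrightarrow> approx n t \<in> N \<rightarrow>\<^sub>M count_space UNIV"
  using Sg.measurable_process[of t] unfolding approx_def by measurable

definition grid_B :: "nat \<Rightarrow> real \<Rightarrow> 'b \<Rightarrow> real ^ 'd" where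
  "grid_B n t \<omega> = B (approx n t \<omega> / Suc n) \<omega>"

lemma measurable_grid_B: "t \<ge> 0 \<Longrightarrow> grid_B n t \<in> borel_measurable N"
  unfolding grid_B_def
  by (rule measurable_compose_countable[OF _ measurable_approx]) (auto intro: Bm.measurable_process)

lemma approx_limit:
  assumes "\<omega> \<in> space N" "t \<ge> 0"
  shows "(\<lambda>n. approx n t \<omega> / Suc n) \<longlonglongrightarrow> \<sigma> t \<omega>"
  unfolding approx_def by (rule ceiling_approx_limit) (rule Sg.\<sigma>_nonneg[OF assms])

lemma grid_B_limit:
  assumes "\<omega> \<in> space N" "t \<ge> 0"
  shows "(\<lambda>n. grid_B n t \<omega>) \<longlonglongrightarrow> B (\<sigma> t \<omega>) \<omega>"
  unfolding grid_B_def
  by (rule continuous_on_tendsto_compose[OF Bm.continuous_paths[OF assms(1)] approx_limit[OF assms]])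
    (use Sg.\<sigma>_nonneg[OF assms] in auto)

lemma measurable_subordinate: "t \<ge> 0 \<Longrightarrow> (\<lambda>\<omega>. B (\<sigma> t \<omega>) \<omega>) \<in> borel_measurable N"
  by (rule borel_measurable_LIMSEQ_metric[OF measurable_grid_B grid_B_limit])

text \<open>Once the rounded times are frozen they form a deterministic increasing sequence, over
  which the increments of \<open>B\<close> are independent Gaussian vectors.\<close>

lemma grid_cf:
  assumes t: "0 \<le> t 0" "mono t"
  shows "(\<integral>\<omega>. iexp (\<Sum>l<k. \<theta> l \<bullet> (grid_B n (t (Suc l)) \<omega> - grid_B n (t l) \<omega>)) \<partial>N) =
    complex_of_real (\<integral>\<omega>. (\<Prod>l<k. exp (- (\<psi> (\<theta> l) *
      (approx n (t (Suc l)) \<omega> / Suc n - approx n (t l) \<omega> / Suc n)))) \<partial>N)"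
proof -
  have tn: "0 \<le> t l" for l using t monoD[OF t(2), of 0 l] by simp
  define g where "g = (\<lambda>v (b :: real \<Rightarrow> real ^ 'd). iexp (\<Sum>l<k. \<theta> l \<bullet>
    (b (real (v ! Suc l) / real (Suc n)) - b (real (v ! l) / real (Suc n)))))"
  let ?V = "\<lambda>\<omega>. map (\<lambda>l. approx n (t l) \<omega>) [0..<Suc k]"
  let ?v = "\<lambda>s. map (\<lambda>l. nat \<lceil>real (Suc n) * s (t l)\<rceil>) [0..<Suc k]"
  have v: "?v \<in> PiM {0..} (\<lambda>_. borel) \<rightarrow>\<^sub>M count_space UNIV"
  proof (rule measurable_map_count_space)
    fix l
    have [measurable]: "(\<lambda>s. s (t l)) \<in> PiM {0..} (\<lambda>_. borel) \<rightarrow>\<^sub>M (borel :: real measure)"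
      by (rule measurable_component_singleton) (use tn in simp)
    show "(\<lambda>s. nat \<lceil>real (Suc n) * s (t l)\<rceil>) \<in> PiM {0..} (\<lambda>_. borel) \<rightarrow>\<^sub>M count_space UNIV"
      by measurable
  qed
  have [measurable]: "(\<lambda>b. b (real i / real (Suc n))) \<in> PiM {0..} (\<lambda>_. borel) \<rightarrow>\<^sub>M (borel :: (real ^ 'd) measure)" for i
    by (rule measurable_component_singleton) simp
  have gm: "g v \<in> borel_measurable (PiM {0..} (\<lambda>_. borel))" for v
    unfolding g_def by measurable
  have vV: "?v (\<lambda>t\<in>{0..}. \<sigma> t \<omega>) = ?V \<omega>" for \<omega>
    using tn by (simp add: approx_def del: upt_Suc)
  have gV: "g (?V \<omega>) (\<lambda>t\<in>{0..}. B t \<omega>') = iexp (\<Sum>l<k. \<theta> l \<bullet>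
      (B (approx n (t (Suc l)) \<omega> / Suc n) \<omega>' - B (approx n (t l) \<omega> / Suc n) \<omega>'))" for \<omega> \<omega>'
    unfolding g_def
    by (intro arg_cong[where f = iexp] sum.cong refl) (simp del: upt_Suc)
  have "(\<integral>\<omega>. iexp (\<Sum>l<k. \<theta> l \<bullet> (grid_B n (t (Suc l)) \<omega> - grid_B n (t l) \<omega>)) \<partial>N) =
      (\<integral>\<omega>. g (?v (\<lambda>t\<in>{0..}. \<sigma> t \<omega>)) (\<lambda>t\<in>{0..}. B t \<omega>) \<partial>N)"
    unfolding vV gV grid_B_def ..
  also have "\<dots> = (\<integral>\<omega>. (\<integral>\<omega>'. g (?v (\<lambda>t\<in>{0..}. \<sigma> t \<omega>)) (\<lambda>t\<in>{0..}. B t \<omega>') \<partial>N) \<partial>N)"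
    by (rule indep_elements_expectation[OF Bm.prob_space_axioms indep v gm, where c = 1]) (simp add: g_def)
  also have "\<dots> = (\<integral>\<omega>. complex_of_real (\<Prod>l<k. exp (- (\<psi> (\<theta> l) *
      (approx n (t (Suc l)) \<omega> / Suc n - approx n (t l) \<omega> / Suc n)))) \<partial>N)"
  proof (rule Bochner_Integration.integral_cong[OF refl])
    fix \<omega> assume \<omega>: "\<omega> \<in> space N"
    have "approx n (t l) \<omega> \<le> approx n (t (Suc l)) \<omega>" for l
      unfolding approx_def
      using Sg.\<sigma>_mono[OF \<omega> tn, of l "t (Suc l)"] monoD[OF t(2), of l "Suc l"]
      by (intro nat_mono ceiling_mono mult_left_mono) auto
    then have "approx n (t l) \<omega> / Suc n \<le> approx n (t (Suc l)) \<omega> / Suc n" for l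
      by (simp add: divide_right_mono)
    then show "(\<integral>\<omega>'. g (?v (\<lambda>t\<in>{0..}. \<sigma> t \<omega>)) (\<lambda>t\<in>{0..}. B t \<omega>') \<partial>N) =
       complex_of_real (\<Prod>l<k. exp (- (\<psi> (\<theta> l) *
      (approx n (t (Suc l)) \<omega> / Suc n - approx n (t l) \<omega> / Suc n))))"
      unfolding vV gV
      by (subst Bm.joint_increment_cf[where s = "\<lambda>l. approx n (t l) \<omega> / Suc n"])
        (simp_all add: mult.commute)
  qed
  finally show ?thesis by (simp only: integral_complex_of_real)
qed

text \<open>Both sides are limits of one sequence as the mesh tends to 0: on one side by continuity
  of the paths of \<open>B\<close>, on the other by convergence of the rounded times, which leaves
  the Laplace transform of the increments of \<sigma> at \<open>\<psi> (\<theta> l)\<close>.\<close>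

lemma subordinate_cf:
  assumes t: "0 \<le> t 0" "mono t"
  shows "(\<integral>\<omega>. iexp (\<Sum>l<k. \<theta> l \<bullet> (B (\<sigma> (t (Suc l)) \<omega>) \<omega> - B (\<sigma> (t l) \<omega>) \<omega>)) \<partial>N) =
    complex_of_real (\<Prod>l<k. exp (- ((t (Suc l) - t l) * \<psi> (\<theta> l) powr (\<alpha> / 2))))"
proof (rule LIMSEQ_unique)
  have tn: "0 \<le> t l" for l using t monoD[OF t(2), of 0 l] by simp
  have tm: "t l \<le> t (Suc l)" for l using monoD[OF t(2), of l "Suc l"] by simp
  note [measurable] = measurable_grid_B[OF tn] measurable_subordinate[OF tn]
    measurable_compose[OF measurable_approx[OF tn] measurable_count_space]
  have [measurable]: "(\<lambda>\<omega>. real (approx n (t l) \<omega>)) \<in> borel_measurable N" for n l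
    by (rule measurable_compose[OF measurable_approx[OF tn]]) simp
  have [measurable]: "\<sigma> (t l) \<in> borel_measurable N" for l by (rule Sg.measurable_process[OF tn])
  let ?c = "\<lambda>l. \<psi> (\<theta> l)"
  let ?p = "\<lambda>n l \<omega>. approx n (t l) \<omega> / Suc n"
  show "(\<lambda>n. \<integral>\<omega>. iexp (\<Sum>l<k. \<theta> l \<bullet> (grid_B n (t (Suc l)) \<omega> - grid_B n (t l) \<omega>)) \<partial>N) \<longlonglongrightarrow>
      (\<integral>\<omega>. iexp (\<Sum>l<k. \<theta> l \<bullet> (B (\<sigma> (t (Suc l)) \<omega>) \<omega> - B (\<sigma> (t l) \<omega>) \<omega>)) \<partial>N)"
  proof (rule integral_dominated_convergence[where w = "\<lambda>_. 1"])
    show "AE \<omega> in N. (\<lambda>n. iexp (\<Sum>l<k. \<theta> l \<bullet> (grid_B n (t (Suc l)) \<omega> - grid_B n (t l) \<omega>))) \<longlonglongrightarrow>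
        iexp (\<Sum>l<k. \<theta> l \<bullet> (B (\<sigma> (t (Suc l)) \<omega>) \<omega> - B (\<sigma> (t l) \<omega>) \<omega>))"
      by (intro AE_I2 tendsto_intros grid_B_limit tn)
  qed auto
  have "(\<lambda>n. \<integral>\<omega>. (\<Prod>l<k. exp (- (?c l * (?p n (Suc l) \<omega> - ?p n l \<omega>)))) \<partial>N) \<longlonglongrightarrow>
      (\<integral>\<omega>. (\<Prod>l<k. exp (- (?c l * (\<sigma> (t (Suc l)) \<omega> - \<sigma> (t l) \<omega>)))) \<partial>N)"
  proof (rule integral_dominated_convergence[where w = "\<lambda>_. 1"])
    show "AE \<omega> in N. (\<lambda>n. \<Prod>l<k. exp (- (?c l * (?p n (Suc l) \<omega> - ?p n l \<omega>)))) \<longlonglongrightarrow>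
        (\<Prod>l<k. exp (- (?c l * (\<sigma> (t (Suc l)) \<omega> - \<sigma> (t l) \<omega>))))"
      by (intro AE_I2 tendsto_prod tendsto_exp tendsto_minus tendsto_mult tendsto_const tendsto_diff approx_limit tn)
    \<comment> \<open>Rounding is monotone, so every exponent is nonpositive and 1
      dominates.\<close>
    show "AE \<omega> in N. norm (\<Prod>l<k. exp (- (?c l * (?p n (Suc l) \<omega> - ?p n l \<omega>)))) \<le> 1" for n
    proof (rule AE_I2)
      fix \<omega> assume \<omega>: "\<omega> \<in> space N"
      have "approx n (t l) \<omega> \<le> approx n (t (Suc l)) \<omega>" for l
        unfolding approx_def using Sg.\<sigma>_mono[OF \<omega> tn tm, of l]
        by (intro nat_mono ceiling_mono mult_left_mono) auto
      then have "0 \<le> ?p n (Suc l) \<omega> - ?p n l \<omega>" for l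
        by (simp add: divide_right_mono)
      then have "0 \<le> ?c l * (?p n (Suc l) \<omega> - ?p n l \<omega>)" for l
        by (intro mult_nonneg_nonneg) auto
      then have "(\<Prod>l<k. exp (- (?c l * (?p n (Suc l) \<omega> - ?p n l \<omega>)))) \<le> 1"
        by (intro prod_le_1) auto
      then show "norm (\<Prod>l<k. exp (- (?c l * (?p n (Suc l) \<omega> - ?p n l \<omega>)))) \<le> 1"
        by (simp add: prod_nonneg)
    qed
  qed auto
  also have "(\<integral>\<omega>. (\<Prod>l<k. exp (- (?c l * (\<sigma> (t (Suc l)) \<omega> - \<sigma> (t l) \<omega>)))) \<partial>N) =
      (\<Prod>l<k. exp (- ((t (Suc l) - t l) * ?c l powr (\<alpha> / 2))))"
    using t tm by (intro Sg.joint_increment_laplace) auto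
  finally show "(\<lambda>n. \<integral>\<omega>. iexp (\<Sum>l<k. \<theta> l \<bullet> (grid_B n (t (Suc l)) \<omega> - grid_B n (t l) \<omega>)) \<partial>N) \<longlonglongrightarrow>
      complex_of_real (\<Prod>l<k. exp (- ((t (Suc l) - t l) * ?c l powr (\<alpha> / 2))))"
    unfolding grid_cf[OF t] by (rule tendsto_of_real)
qed

text \<open>Composition with a continuous path: a left limit of \<sigma> is again nonnegative, so it
  lies where \<open>B\<close> is continuous.\<close>

lemma subordinate_cadlag:
  assumes \<omega>: "\<omega> \<in> space N"
  shows "subordinate_process B \<sigma> \<omega> \<in> cadlag_paths"
proof -
  let ?Y = "\<lambda>t. B (\<sigma> t \<omega>) \<omega>" and ?s = "\<lambda>t\<in>{0..}. \<sigma> t \<omega>" and ?y = "\<lambda>t\<in>{0..}. B (\<sigma> t \<omega>) \<omega>"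
  have c: "?s \<in> cadlag_paths" by (rule Sg.cadlag[OF \<omega>])
  have nn: "?s t \<ge> 0" if "t \<ge> 0" for t using Sg.\<sigma>_nonneg[OF \<omega> that] that by simp
  have lim: "(?y \<longlongrightarrow> B l \<omega>) F" if l: "(?s \<longlongrightarrow> l) F" and ev: "\<forall>\<^sub>F t in F. t \<ge> 0" and F: "F \<noteq> bot" for l F
  proof -
    have evs: "\<forall>\<^sub>F t in F. ?s t \<in> {0..}" using ev by eventually_elim (use nn in auto)
    have "l \<ge> 0"
      by (rule tendsto_lowerbound[OF l _ F]) (use evs in \<open>auto elim: eventually_mono\<close>)
    then have "((\<lambda>t. B (?s t) \<omega>) \<longlongrightarrow> B l \<omega>) F"
      by (intro continuous_on_tendsto_compose[OF Bm.continuous_paths[OF \<omega>] l _ evs]) simp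
    moreover have "\<forall>\<^sub>F t in F. B (?s t) \<omega> = ?y t" using ev by eventually_elim simp
    ultimately show ?thesis by (rule Lim_transform_eventually)
  qed
  have "(?y \<longlongrightarrow> ?y t) (at_right t)" if t: "t \<ge> 0" for t
  proof -
    have "(?s \<longlongrightarrow> ?s t) (at_right t)" using c t by (simp add: cadlag_paths_def)
    moreover have "\<forall>\<^sub>F u in at_right t. u \<ge> 0"
      using t unfolding eventually_at_right_field by (intro exI[of _ "t + 1"]) auto
    ultimately have "(?y \<longlongrightarrow> B (?s t) \<omega>) (at_right t)" by (rule lim) simp
    then show ?thesis using t by simp
  qed
  moreover have "\<exists>l. (?y \<longlongrightarrow> l) (at_left t)" if t: "t > 0" for t
  proof -
    obtain l where "(?s \<longlongrightarrow> l) (at_left t)" using c t unfolding cadlag_paths_def by blast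
    moreover have "\<forall>\<^sub>F u in at_left t. u \<ge> 0"
      using t unfolding eventually_at_left_field by (intro exI[of _ 0]) auto
    ultimately have "(?y \<longlongrightarrow> B l \<omega>) (at_left t)" by (rule lim) simp
    then show ?thesis by blast
  qed
  ultimately show ?thesis by (simp add: cadlag_paths_def subordinate_process_def)
qed

end

section \<open>Convergence of the subordinate walk\<close>

text \<open>This provides, for large \<open>n\<close>, the positivity required by
  \<open>cf_increments\<close>.\<close>

lemma \<phi>_tendsto_1:
  fixes \<theta> :: "real ^ 'd"
  assumes c: "c \<longlonglongrightarrow> 0"
  shows "(\<lambda>n. \<phi> (c n *\<^sub>R \<theta>)) \<longlonglongrightarrow> 1"
proof -
  have "(\<lambda>n. (\<Sum>i\<in>(UNIV :: 'd set). cos (c n * \<theta> $ i)) / real CARD('d)) \<longlonglongrightarrow>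
      (\<Sum>i\<in>(UNIV :: 'd set). cos (0 * \<theta> $ i)) / real CARD('d)"
    by (intro tendsto_intros c) auto
  then show ?thesis by (simp add: \<phi>_def)
qed

lemma vec_of_grid_lipschitz:
  fixes v w :: "nat \<times> 'd::finite \<Rightarrow> real"
  assumes "k \<le> n"
  shows "dist (\<Sum>l<k. \<chi> i. v (l, i)) (\<Sum>l<k. \<chi> i. w (l, i)) \<le> (\<Sum>p\<in>{..<n} \<times> UNIV. dist (v p) (w p))"
proof -
  have "(\<Sum>l<k. \<chi> i. v (l, i)) - (\<Sum>l<k. \<chi> i. w (l, i)) = (\<Sum>l<k. \<chi> i. v (l, i) - w (l, i))"
    by (simp add: vec_eq_iff sum_subtractf)
  then have "dist (\<Sum>l<k. \<chi> i. v (l, i)) (\<Sum>l<k. \<chi> i. w (l, i)) = norm (\<Sum>l<k. \<chi> i. v (l, i) - w (l, i))"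
    by (simp only: dist_norm)
  also have "\<dots> \<le> (\<Sum>l<k. norm (\<chi> i. v (l, i) - w (l, i)))" by (rule norm_sum)
  also have "\<dots> \<le> (\<Sum>l<k. \<Sum>i\<in>UNIV. \<bar>v (l, i) - w (l, i)\<bar>)"
  proof (rule sum_mono)
    fix l
    show "norm (\<chi> i. v (l, i) - w (l, i)) \<le> (\<Sum>i\<in>UNIV. \<bar>v (l, i) - w (l, i)\<bar>)"
      using norm_le_l1_cart[of "\<chi> i. v (l, i) - w (l, i)"] by simp
  qed
  also have "\<dots> \<le> (\<Sum>l<n. \<Sum>i\<in>UNIV. \<bar>v (l, i) - w (l, i)\<bar>)"
    using assms by (intro sum_mono2 sum_nonneg) auto
  also have "\<dots> = (\<Sum>p\<in>{..<n} \<times> UNIV. dist (v p) (w p))"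
    by (simp add: sum.cartesian_product dist_real_def split_beta)
  finally show ?thesis .
qed

text \<open>Characteristic functions are known for increments, while \<open>G\<close> acts on
  values. As both processes start at 0, values are partial sums of increments, and \<open>G\<close>
  composed with summation is again Lipschitz.\<close>

lemma grid_functional_convergence:
  fixes X :: "nat \<Rightarrow> 'a \<Rightarrow> real \<Rightarrow> real ^ 'd" and Y :: "'c \<Rightarrow> real \<Rightarrow> real ^ 'd" and t :: "nat \<Rightarrow> real"
  assumes "prob_space M" "prob_space N"
    and X: "\<And>n k. (\<lambda>\<omega>. X n \<omega> (t k)) \<in> borel_measurable M" "\<And>n \<omega>. \<omega> \<in> space M \<Longrightarrow> X n \<omega> (t 0) = 0"
    and Y: "\<And>k. (\<lambda>\<omega>. Y \<omega> (t k)) \<in> borel_measurable N" "\<And>\<omega>. \<omega> \<in> space N \<Longrightarrow> Y \<omega> (t 0) = 0"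
    and cf: "\<And>\<theta>. (\<lambda>n. \<integral>\<omega>. iexp (\<Sum>l<K. \<theta> l \<bullet> (X n \<omega> (t (Suc l)) - X n \<omega> (t l))) \<partial>M) \<longlonglongrightarrow>
      (\<integral>\<omega>. iexp (\<Sum>l<K. \<theta> l \<bullet> (Y \<omega> (t (Suc l)) - Y \<omega> (t l))) \<partial>N)"
    and G: "\<And>v. 0 \<le> G v \<and> G v \<le> 1" "\<And>v w. \<bar>G v - G w\<bar> \<le> L * (\<Sum>k\<le>K. dist (v k) (w k))"
  shows "(\<lambda>n. \<integral>\<omega>. G (\<lambda>k. X n \<omega> (t k)) \<partial>M) \<longlonglongrightarrow> (\<integral>\<omega>. G (\<lambda>k. Y \<omega> (t k)) \<partial>N)"
proof -
  define I where "I = {..<K} \<times> (UNIV :: 'd set)"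
  define F where "F = (\<lambda>v :: nat \<times> 'd \<Rightarrow> real. G (\<lambda>k. \<Sum>l<k. \<chi> i. v (l, i)))"
  define inc where "inc = (\<lambda>(x :: real \<Rightarrow> real ^ 'd) (p :: nat \<times> 'd). (x (t (Suc (fst p))) - x (t (fst p))) $ snd p)"
  have I: "finite I" by (simp add: I_def)
  have tele: "(\<Sum>l<k. \<chi> i. inc x (l, i)) = x (t k)" if "x (t 0) = 0" for x k
  proof -
    have "(\<Sum>l<k. \<chi> i. inc x (l, i)) = (\<Sum>l<k. x (t (Suc l)) - x (t l))"
      by (intro sum.cong) (auto simp: inc_def vec_eq_iff)
    also have "\<dots> = x (t k)" using that sum_lessThan_telescope[of "\<lambda>l. x (t l)" k] by simp
    finally show ?thesis .
  qed
  have F_inc: "F (inc x) = G (\<lambda>k. x (t k))" if "x (t 0) = 0" for x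
    using tele[of x] that by (simp add: F_def)
  have inner: "(\<Sum>p\<in>I. \<theta> p * inc x p) = (\<Sum>l<K. (\<chi> i. \<theta> (l, i)) \<bullet> (x (t (Suc l)) - x (t l)))" for \<theta> x
    unfolding I_def by (simp add: inc_def inner_vec_def sum.cartesian_product split_beta)
  have "(\<lambda>n. \<integral>\<omega>. F (\<lambda>p. inc (X n \<omega>) p) \<partial>M) \<longlonglongrightarrow> (\<integral>\<omega>. F (\<lambda>p. inc (Y \<omega>) p) \<partial>N)"
  proof (rule levy_continuity_lipschitz[OF assms(1,2) I, where F = F
        and \<xi> = "\<lambda>n p \<omega>. inc (X n \<omega>) p" and \<xi>' = "\<lambda>p \<omega>. inc (Y \<omega>) p"])
    note [measurable] = X(1) Y(1)
    show "(\<lambda>\<omega>. inc (X n \<omega>) p) \<in> borel_measurable M" for n p unfolding inc_def by measurable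
    show "(\<lambda>\<omega>. inc (Y \<omega>) p) \<in> borel_measurable N" for p unfolding inc_def by measurable
    show "(\<lambda>n. \<integral>\<omega>. iexp (\<Sum>p\<in>I. \<theta> p * inc (X n \<omega>) p) \<partial>M) \<longlonglongrightarrow> (\<integral>\<omega>. iexp (\<Sum>p\<in>I. \<theta> p * inc (Y \<omega>) p) \<partial>N)" for \<theta>
      unfolding inner by (rule cf)
    show "\<bar>F y\<bar> \<le> 1" for y using G(1) by (simp add: F_def)
    \<comment> \<open>Each of the K + 1 grid values is a sum of increments, which accounts for
      \<open>Suc K\<close>; the modulus covers a negative \<open>L\<close>.\<close>
    show "\<bar>F v - F w\<bar> \<le> (\<bar>L\<bar> * real (Suc K)) * (\<Sum>p\<in>I. dist (v p) (w p))" for v w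
    proof -
      let ?d = "\<Sum>k\<le>K. dist (\<Sum>l<k. \<chi> i. v (l, i)) (\<Sum>l<k. \<chi> i. w (l, i))"
      have "?d \<le> (\<Sum>k\<le>K. \<Sum>p\<in>I. dist (v p) (w p))"
        unfolding I_def by (intro sum_mono vec_of_grid_lipschitz) auto
      then have d: "?d \<le> real (Suc K) * (\<Sum>p\<in>I. dist (v p) (w p))" by simp
      have "\<bar>F v - F w\<bar> \<le> L * ?d" unfolding F_def by (rule G(2))
      also have "\<dots> \<le> \<bar>L\<bar> * ?d" by (intro mult_right_mono sum_nonneg) auto
      also have "\<dots> \<le> \<bar>L\<bar> * (real (Suc K) * (\<Sum>p\<in>I. dist (v p) (w p)))"
        by (intro mult_left_mono d) auto
      finally show ?thesis by (simp add: mult.assoc)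
    qed
  qed
  moreover have "(\<integral>\<omega>. F (\<lambda>p. inc (X n \<omega>) p) \<partial>M) = (\<integral>\<omega>. G (\<lambda>k. X n \<omega> (t k)) \<partial>M)" for n
    using F_inc X(2) by (intro Bochner_Integration.integral_cong) auto
  moreover have "(\<integral>\<omega>. F (\<lambda>p. inc (Y \<omega>) p) \<partial>N) = (\<integral>\<omega>. G (\<lambda>k. Y \<omega> (t k)) \<partial>N)"
    using F_inc Y(2) by (intro Bochner_Integration.integral_cong) auto
  ultimately show ?thesis by simp
qed

theorem theorem1:
  fixes M :: "'a measure" and N :: "'b measure" and \<alpha> :: real
    and S :: "nat \<Rightarrow> 'a \<Rightarrow> int ^ 'd" and \<tau> :: "nat \<Rightarrow> 'a \<Rightarrow> nat"
    and B :: "real \<Rightarrow> 'b \<Rightarrow> real ^ 'd" and \<sigma> :: "real \<Rightarrow> 'b \<Rightarrow> real"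
  assumes "0 < \<alpha>" "\<alpha> < 2"
    and "simple_random_walk M S"
    and "discrete_subordinator M \<alpha> \<tau>"
    and "indep_elements M
           (PiM UNIV (\<lambda>_. count_space UNIV)) (\<lambda>\<omega> n. S n \<omega>)
           (PiM UNIV (\<lambda>_. count_space UNIV)) (\<lambda>\<omega> n. \<tau> n \<omega>)"
    and "walk_brownian_motion N B"
    and "stable_subordinator N \<sigma> \<alpha>"
    and "indep_elements N
           (PiM {0..} (\<lambda>_. borel)) (\<lambda>\<omega>. \<lambda>t\<in>{0..}. B t \<omega>)
           (PiM {0..} (\<lambda>_. borel)) (\<lambda>\<omega>. \<lambda>t\<in>{0..}. \<sigma> t \<omega>)"
  shows "converges_in_law skorohod_J1
           M (rescaled_subordinate_walk \<alpha> S \<tau>)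
           N (subordinate_process B \<sigma>)"
proof -
  interpret subordinate_walk M S \<alpha> \<tau>
    unfolding subordinate_walk_def subordinate_walk_axioms_def using assms by blast
  interpret L: subordinate_bm N B \<sigma> \<alpha>
    unfolding subordinate_bm_def subordinate_bm_axioms_def using assms by blast
  let ?Y = "subordinate_process B \<sigma>"
  have Ym: "(\<lambda>\<omega>. ?Y \<omega> t) \<in> borel_measurable N" if "t \<ge> 0" for t
    using L.measurable_subordinate[OF that] that by (simp add: subordinate_process_def)
  interpret discretised_convergence M N X ?Y
  proof
    show "X n \<omega> \<in> cadlag_paths" for n \<omega> by (rule X_cadlag)
    show "t \<ge> 0 \<Longrightarrow> (\<lambda>\<omega>. X n \<omega> t) \<in> borel_measurable M" for n t by (rule X_measurable)
    show "\<omega> \<in> space N \<Longrightarrow> ?Y \<omega> \<in> cadlag_paths" for \<omega> by (rule L.subordinate_cadlag)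
    show "t \<ge> 0 \<Longrightarrow> (\<lambda>\<omega>. ?Y \<omega> t) \<in> borel_measurable N" for t by (rule Ym)
    show "\<forall>\<^sub>F m in sequentially. \<forall>\<^sub>F n in sequentially. well_sampled M (X n) m T \<epsilon> \<kappa>"
      if "T > 0" "\<epsilon> > 0" "\<kappa> > 0" for T \<epsilon> \<kappa> :: real
      using that by (rule X_tight)
    fix m :: nat and G :: "(nat \<Rightarrow> real ^ 'd) \<Rightarrow> real" and L
    assume m: "m > 0" and G: "\<And>v. 0 \<le> G v \<and> G v \<le> 1"
      "\<And>v w. \<bar>G v - G w\<bar> \<le> L * (\<Sum>k\<le>m * m. dist (v k) (w k))"
    define t where "t = (\<lambda>k. real k / real m)"
    have t: "0 \<le> t k" "t 0 = 0" "mono t" "t k \<le> t (Suc k)" for k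
      by (auto simp: t_def mono_def divide_right_mono)
    show "(\<lambda>n. \<integral>\<omega>. G (\<lambda>k. X n \<omega> (real k / real m)) \<partial>M) \<longlonglongrightarrow> (\<integral>\<omega>. G (\<lambda>k. ?Y \<omega> (real k / real m)) \<partial>N)"
      unfolding t_def[symmetric, THEN fun_cong]
    proof (rule grid_functional_convergence[OF W.prob_space_axioms L.Bm.prob_space_axioms _ _ _ _ _ G])
      show "(\<lambda>\<omega>. X n \<omega> (t k)) \<in> borel_measurable M" for n k by (intro X_measurable t)
      show "(\<lambda>\<omega>. ?Y \<omega> (t k)) \<in> borel_measurable N" for k by (intro Ym t)
      show "X n \<omega> (t 0) = 0" if "\<omega> \<in> space M" for n \<omega>
        using that by (simp add: t X_apply R_def T.start W.start)
      show "?Y \<omega> (t 0) = 0" if "\<omega> \<in> space N" for \<omega>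
        using that by (simp add: t subordinate_process_def L.Sg.start L.Bm.start)
      fix \<theta> :: "nat \<Rightarrow> real ^ 'd"
      let ?c = "\<lambda>n. real n powr (- 1 / \<alpha>)" and ?q = "\<lambda>n k. nat \<lfloor>real n * t k\<rfloor>"
      \<comment> \<open>For large \<open>n\<close>, \<open>?f n\<close> is the joint characteristic
        function of the grid increments of the walk; \<open>?l\<close> is that of the limit
        process.\<close>
      let ?f = "\<lambda>n. \<Prod>l<m * m. (1 - (1 - \<phi> (?c n *\<^sub>R \<theta> l)) powr (\<alpha> / 2)) ^ (?q n (Suc l) - ?q n l)"
      let ?l = "\<Prod>l<m * m. exp (- ((t (Suc l) - t l) * \<psi> (\<theta> l) powr (\<alpha> / 2)))"
      have "?f \<longlonglongrightarrow> ?l"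
        by (intro tendsto_prod stable_cf_limit \<alpha> t)
      then have "(\<lambda>n. complex_of_real (?f n)) \<longlonglongrightarrow> complex_of_real ?l" by (rule tendsto_of_real)
      \<comment> \<open>For small \<open>n\<close> some \<open>\<phi>\<close> may fail to be
        positive, outside the reach of \<open>cf_increments\<close>; hence an eventual
        identity.\<close>
      moreover have "\<forall>\<^sub>F n in sequentially. complex_of_real (?f n) =
          (\<integral>\<omega>. iexp (\<Sum>l<m * m. \<theta> l \<bullet> (X n \<omega> (t (Suc l)) - X n \<omega> (t l))) \<partial>M)"
      proof -
        have "?c \<longlonglongrightarrow> 0" using \<alpha> by real_asymp
        then have "\<forall>\<^sub>F n in sequentially. 0 < \<phi> (?c n *\<^sub>R \<theta> l)" for l
          by (intro order_tendstoD(1)[OF \<phi>_tendsto_1]) auto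
        then have "\<forall>\<^sub>F n in sequentially. \<forall>l\<in>{..<m * m}. 0 < \<phi> (?c n *\<^sub>R \<theta> l)"
          by (intro eventually_ball_finite) auto
        then show ?thesis
        proof eventually_elim
          case (elim n)
          have "mono (?q n)"
            using t(3) by (auto simp: mono_def intro!: nat_mono floor_mono mult_left_mono)
          moreover have "?q n 0 = 0" by (simp add: t)
          ultimately have "(\<integral>\<omega>. iexp (\<Sum>l<m * m. (?c n *\<^sub>R \<theta> l) \<bullet> (R (?q n (Suc l)) \<omega> - R (?q n l) \<omega>)) \<partial>M) =
              complex_of_real (?f n)"
            using elim by (intro cf_increments) auto
          moreover have "\<theta> l \<bullet> (X n \<omega> (t (Suc l)) - X n \<omega> (t l)) =
              (?c n *\<^sub>R \<theta> l) \<bullet> (R (?q n (Suc l)) \<omega> - R (?q n l) \<omega>)" for l \<omega>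
            by (simp add: X_apply t(1) flip: scaleR_diff_right)
          ultimately show ?case by simp
        qed
      qed
      ultimately have "(\<lambda>n. \<integral>\<omega>. iexp (\<Sum>l<m * m. \<theta> l \<bullet> (X n \<omega> (t (Suc l)) - X n \<omega> (t l))) \<partial>M) \<longlonglongrightarrow>
          complex_of_real ?l"
        by (rule Lim_transform_eventually)
      also have "complex_of_real ?l = (\<integral>\<omega>. iexp (\<Sum>l<m * m. \<theta> l \<bullet> (?Y \<omega> (t (Suc l)) - ?Y \<omega> (t l))) \<partial>N)"
        using L.subordinate_cf[of t \<theta> "m * m"] t by (simp add: subordinate_process_def)
      finally show "(\<lambda>n. \<integral>\<omega>. iexp (\<Sum>l<m * m. \<theta> l \<bullet> (X n \<omega> (t (Suc l)) - X n \<omega> (t l))) \<partial>M) \<longlonglongrightarrow>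
          (\<integral>\<omega>. iexp (\<Sum>l<m * m. \<theta> l \<bullet> (?Y \<omega> (t (Suc l)) - ?Y \<omega> (t l))) \<partial>N)" .
    qed
  qed
  show ?thesis by (rule converges_in_law_skorohod_J1)
qed

end
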